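(* Let $L$ be a $d$-dimensional tropical linear space in $n$-space. Then $L$ has at most $\binom{n-2}{d-1}$ vertices, with equality if and only if $L$ is series-parallel.
   Context: A function $p:\binom{[n]}{d}\to\mathbb{R}$ is a tropical Plücker vector if for every $S\in\binom{[n]}{d-2}$ and distinct $i,j,k,l\notin S$, the minimum of $p_{S\cup\{i,j\}}+p_{S\cup\{k,l\}}$, $p_{S\cup\{i,k\}}+p_{S\cup\{j,l\}}$, $p_{S\cup\{i,l\}}+p_{S\cup\{j,k\}}$ is attained at least twice. A $d$-dimensional tropical linear space in $n$-space is $L(p)=\{x\in\mathbb{R}^n:$ for every $J\in\binom{[n]}{d+1}$ the minimum over $j\in J$ of $p_{J\setminus\{j\}}+x_j$ is attained at least twice$\}$ for such $p$. For $w\in\mathbb{R}^n$ let $M_w$ be the set of $I$ minimizing $p_I-\sum_{i\in I}w_i$; faces of $L(p)$ are closures of the sets $\{w:M_w=\mathcal{M}\}$ contained in $L(p)$. A vertex of $L$ is a face whose image in $\mathbb{R}^n/\mathbb{R}(1,\dots,1)$ is a single point. With $e_I=\sum_{i\in I}e_i$ and $\Delta(d,n)=\mathrm{conv}\{e_I\}$, the regular subdivision $\mathcal{D}_p$ is the projection to $\Delta(d,n)$ of the lower faces of $\mathrm{conv}\{(e_I,p_I)\}\subset\mathbb{R}^{n}\times\mathbb{R}$. For a matroid $M$, $P_M=\mathrm{conv}\{e_B:B\text{ basis}\}$. A matroid is series-parallel if it is the cycle matroid of a graph obtained from a single edge joining two distinct vertices by repeated series extensions (subdividing an edge) and parallel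 extensions (adding a parallel edge). $L(p)$ is series-parallel if every maximal cell of $\mathcal{D}_p$ is $P_M$ for a series-parallel matroid $M$. *)

theory Defs
  imports "HOL-Analysis.Analysis"
begin

text \<open>The ground set \<open>[n]\<close> is the universe of a finite type \<open>'n\<close>. A function on the
  \<open>d\<close>-subsets of \<open>[n]\<close> is a function \<open>p :: 'n set \<Rightarrow> real\<close> of which only the values at sets
  of cardinality \<open>d\<close> are ever used.\<close>

definition min_attained_twice :: "('a \<Rightarrow> real) \<Rightarrow> 'a set \<Rightarrow> bool" where
  "min_attained_twice f A \<longleftrightarrow>
     (\<exists>i\<in>A. \<exists>j\<in>A. i \<noteq> j \<and> f i = f j \<and> (\<forall>k\<in>A. f i \<le> f k))"

definition tropical_plucker :: "nat \<Rightarrow> ('n::finite set \<Rightarrow> real) \<Rightarrow> bool" where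
  "tropical_plucker d p \<longleftrightarrow>
     (\<forall>S i j k l. card S + 2 = d \<and> distinct [i, j, k, l] \<and> {i, j, k, l} \<inter> S = {} \<longrightarrow>
        min_attained_twice
          (nth [p (S \<union> {i, j}) + p (S \<union> {k, l}),
                p (S \<union> {i, k}) + p (S \<union> {j, l}),
                p (S \<union> {i, l}) + p (S \<union> {j, k})]) {..<3})"

definition tropical_linear_space :: "nat \<Rightarrow> ('n::finite set \<Rightarrow> real) \<Rightarrow> (real ^ 'n) set" where
  "tropical_linear_space d p =
     {x. \<forall>J. card J = d + 1 \<longrightarrow> min_attained_twice (\<lambda>j. p (J - {j}) + x $ j) J}"

definition initial_bases :: "nat \<Rightarrow> ('n::finite set \<Rightarrow> real) \<Rightarrow> real ^ 'n \<Rightarrow> 'n set set" where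
  "initial_bases d p w =
     {I. card I = d \<and>
         (\<forall>J. card J = d \<longrightarrow> p I - (\<Sum>i\<in>I. w $ i) \<le> p J - (\<Sum>i\<in>J. w $ i))}"

definition tls_faces :: "nat \<Rightarrow> ('n::finite set \<Rightarrow> real) \<Rightarrow> (real ^ 'n) set set" where
  "tls_faces d p =
     {closure C | C. (\<exists>\<M>. C = {w. initial_bases d p w = \<M>}) \<and> C \<noteq> {} \<and>
                     C \<subseteq> tropical_linear_space d p}"

definition ones_rel :: "((real ^ 'n::finite) \<times> (real ^ 'n)) set" where
  "ones_rel = {(x, y). \<exists>t::real. y = x + t *\<^sub>R (\<chi> i. 1)}"

text \<open>The image of \<open>F\<close> in the quotient of real \<open>n\<close>-space by the line through the all-ones
  vector is \<open>F // ones_rel\<close>, the set of translates of that line which meet \<open>F\<close>.\<close>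

definition tls_vertices :: "nat \<Rightarrow> ('n::finite set \<Rightarrow> real) \<Rightarrow> (real ^ 'n) set set" where
  "tls_vertices d p = {F \<in> tls_faces d p. is_singleton (F // ones_rel)}"

definition indicator_vec :: "'n::finite set \<Rightarrow> real ^ 'n" where
  "indicator_vec I = (\<Sum>i\<in>I. axis i 1)"

definition lifted_polytope :: "nat \<Rightarrow> ('n::finite set \<Rightarrow> real) \<Rightarrow> ((real ^ 'n) \<times> real) set" where
  "lifted_polytope d p = convex hull {(indicator_vec I, p I) | I. card I = d}"

text \<open>Lower faces: the nonempty faces having an inner normal whose last coordinate is
  positive.\<close>

definition lower_face :: "((real ^ 'n) \<times> real) set \<Rightarrow> ((real ^ 'n::finite) \<times> real) set \<Rightarrow> bool" where
  "lower_face Q F \<longleftrightarrow>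
     F \<noteq> {} \<and>
     (\<exists>w s c. s > 0 \<and> (\<forall>z\<in>Q. c \<le> (w, s) \<bullet> z) \<and> F = {z \<in> Q. (w, s) \<bullet> z = c})"

definition regular_subdivision :: "nat \<Rightarrow> ('n::finite set \<Rightarrow> real) \<Rightarrow> (real ^ 'n) set set" where
  "regular_subdivision d p = {fst ` F | F. lower_face (lifted_polytope d p) F}"

definition maximal_cells :: "nat \<Rightarrow> ('n::finite set \<Rightarrow> real) \<Rightarrow> (real ^ 'n) set set" where
  "maximal_cells d p =
     {C \<in> regular_subdivision d p. \<forall>C'\<in>regular_subdivision d p. C \<subseteq> C' \<longrightarrow> C' = C}"

text \<open>Multigraphs; \<open>ends\<close> gives the set of the two endpoints of an edge (one endpoint for a
  loop), and is irrelevant outside \<open>edges\<close>.\<close>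

record ('v, 'e) multigraph =
  verts :: "'v set"
  edges :: "'e set"
  ends :: "'e \<Rightarrow> 'v set"

definition is_cycle :: "('v, 'e) multigraph \<Rightarrow> 'e set \<Rightarrow> bool" where
  "is_cycle G C \<longleftrightarrow>
     (\<exists>es vs. es \<noteq> [] \<and> length vs = length es \<and> distinct es \<and> distinct vs \<and>
        set es = C \<and> C \<subseteq> edges G \<and>
        (\<forall>i<length es. ends G (es ! i) = {vs ! i, vs ! (Suc i mod length es)}))"

definition is_forest :: "('v, 'e) multigraph \<Rightarrow> 'e set \<Rightarrow> bool" where
  "is_forest G F \<longleftrightarrow> F \<subseteq> edges G \<and> (\<nexists>C. is_cycle G C \<and> C \<subseteq> F)"

definition cycle_matroid_bases :: "('v, 'e) multigraph \<Rightarrow> 'e set set" where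
  "cycle_matroid_bases G = {B. is_forest G B \<and> (\<forall>F. is_forest G F \<and> B \<subseteq> F \<longrightarrow> F = B)}"

inductive series_parallel_graph :: "('v, 'e) multigraph \<Rightarrow> bool" where
  single_edge:
    "u \<noteq> v \<Longrightarrow> \<epsilon> e = {u, v} \<Longrightarrow>
     series_parallel_graph \<lparr>verts = {u, v}, edges = {e}, ends = \<epsilon>\<rparr>"
| series_extension:
    "series_parallel_graph G \<Longrightarrow> f \<in> edges G \<Longrightarrow> ends G f = {u, v} \<Longrightarrow>
     w \<notin> verts G \<Longrightarrow> e \<notin> edges G \<Longrightarrow>
     series_parallel_graph
       \<lparr>verts = insert w (verts G), edges = insert e (edges G),
        ends = (ends G)(f := {u, w}, e := {w, v})\<rparr>"
| parallel_extension:
    "series_parallel_graph G \<Longrightarrow> f \<in> edges G \<Longrightarrow> e \<notin> edges G \<Longrightarrow>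
     series_parallel_graph
       \<lparr>verts = verts G, edges = insert e (edges G), ends = (ends G)(e := ends G f)\<rparr>"

text \<open>A matroid is given by its ground set and its set of bases. The graphs involved are
  finite, so taking their vertices in \<open>nat\<close> is no restriction.\<close>

definition series_parallel_matroid :: "'e set \<Rightarrow> 'e set set \<Rightarrow> bool" where
  "series_parallel_matroid E \<B> \<longleftrightarrow>
     (\<exists>G :: (nat, 'e) multigraph.
        series_parallel_graph G \<and> edges G = E \<and> cycle_matroid_bases G = \<B>)"

definition matroid_polytope :: "'n::finite set set \<Rightarrow> (real ^ 'n) set" where
  "matroid_polytope \<B> = convex hull (indicator_vec ` \<B>)"

definition series_parallel_tls :: "nat \<Rightarrow> ('n::finite set \<Rightarrow> real) \<Rightarrow> bool" where
  "series_parallel_tls d p \<longleftrightarrow>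
     (\<forall>C\<in>maximal_cells d p. \<exists>\<B>. series_parallel_matroid UNIV \<B> \<and> C = matroid_polytope \<B>)"

end

theory Submission
  imports Defs
begin

text \<open>
  Vertices of the tropical linear space and maximal cells of the subdivision both correspond to
  the connected matroids among the \<open>M\<^sub>w\<close>. Order the ground set linearly, and call a basis \<open>B\<close> of a
  matroid \<open>M\<close> a beta basis if every element except the first can be exchanged, across \<open>B\<close>, with a
  smaller one. For a \<open>d\<close>-set \<open>B\<close> the conditions that \<open>B \<in> M\<^sub>w\<close> and that the exchanges with smaller
  elements are tight determine the coordinates of \<open>w\<close> recursively up to a common shift, and they can
  be met exactly if \<open>B\<close> contains the first element and misses the second. Hence the numbers of beta
  bases of the connected \<open>M\<^sub>w\<close> add up to \<open>(n - 2) choose (d - 1)\<close>.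

  The number of beta bases is Crapo's beta invariant: it does not depend on the order, satisfies
  \<open>\<beta>(M) = \<beta>(M \ e) + \<beta>(M / e)\<close> and is positive iff \<open>M\<close> is connected. If \<open>\<beta>(M) = 1\<close>, then for each \<open>e\<close>
  one of \<open>M \ e\<close> and \<open>M / e\<close> is disconnected, which decomposes \<open>M\<close> along \<open>e\<close> and inductively yields
  a series or parallel pair avoiding \<open>e\<close>; so \<open>\<beta>(M) = 1\<close> characterises connected series-parallel
  matroids.
\<close>

section \<open>Matroids given by their bases\<close>

text \<open>The recursion for \<open>w\<close> works because every condition on \<open>B\<close>
  compares one element of \<open>B\<close> with one outside it: all inequalities between a new
  coordinate and the earlier ones bound it from the same side, so the extreme admissible value meets
  them and makes one tight. Checking single exchanges is enough because valuated exchange turns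
  local optimality of \<open>B\<close> into global optimality. Two descriptions of one number are
  kept because each shows what the other hides. Beta bases give nonnegativity and a partition of a
  fixed family of sets; the alternating rank sum \<open>beta\<close> visibly ignores the order and
  behaves well under duality. Freedom of order is needed to put \<open>e\<close> first when
  \<open>M / e\<close> has a separator; duality carries the result over to separators of the
  deletion. The pair is asked to avoid a prescribed \<open>e\<close> so that the induction closes:
  applied to the smaller matroid on a separator with \<open>e\<close> adjoined, it gives a pair
  inside the separator, and such a pair lifts to \<open>M\<close>.\<close>

text \<open>Symmetric exchange is equivalent to the usual basis exchange, passes to minors and duals
  without effort, and is what a tropical Pluecker vector provides.\<close>

definition matroid :: "'a set \<Rightarrow> 'a set set \<Rightarrow> bool" where
  "matroid E M \<longleftrightarrow> finite E \<and> M \<noteq> {} \<and> M \<subseteq> Pow E \<and> (\<forall>I\<in>M. \<forall>K\<in>M. card I = card K) \<and>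
     (\<forall>I\<in>M. \<forall>K\<in>M. \<forall>i\<in>I - K. \<exists>k\<in>K - I. insert k (I - {i}) \<in> M \<and> insert i (K - {k}) \<in> M)"

text \<open>For a matroid on \<open>E\<close> this says that its polytope has dimension \<open>card E - 1\<close>, i.e. that the
  matroid is connected.\<close>

definition connected_bases :: "'a set \<Rightarrow> 'a set set \<Rightarrow> bool" where
  "connected_bases E M \<longleftrightarrow>
     (\<forall>A. A \<noteq> {} \<longrightarrow> A \<subset> E \<longrightarrow> (\<exists>I\<in>M. \<exists>K\<in>M. card (I \<inter> A) \<noteq> card (K \<inter> A)))"

text \<open>If every basis contains \<open>e\<close> this family is empty, hence no matroid;
  likewise \<open>contraction\<close> if no basis contains \<open>e\<close>. This is why lemmas on
  minors carry a basis avoiding or containing \<open>e\<close> as a witness.\<close>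

definition deletion :: "'a set set \<Rightarrow> 'a \<Rightarrow> 'a set set" where
  "deletion M e = {B \<in> M. e \<notin> B}"

definition contraction :: "'a set set \<Rightarrow> 'a \<Rightarrow> 'a set set" where
  "contraction M e = {B. e \<notin> B \<and> insert e B \<in> M}"

definition dual_bases :: "'a set \<Rightarrow> 'a set set \<Rightarrow> 'a set set" where
  "dual_bases E M = {B. B \<subseteq> E \<and> E - B \<in> M}"

text \<open>This is the usual rank, since a largest independent subset of \<open>A\<close> extends
  to a basis; written this way it speaks of bases only.\<close>

definition rank_of :: "'a set set \<Rightarrow> 'a set \<Rightarrow> nat" where
  "rank_of M A = Max ((\<lambda>B. card (B \<inter> A)) ` M)"

lemma matroid_finite: "matroid E M \<Longrightarrow> finite E"
  by (simp add: matroid_def)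

lemma matroid_nonempty: "matroid E M \<Longrightarrow> \<exists>B. B \<in> M"
  by (auto simp: matroid_def)

lemma matroid_sub: "matroid E M \<Longrightarrow> B \<in> M \<Longrightarrow> B \<subseteq> E"
  by (auto simp: matroid_def)

lemma matroid_finite_basis: "matroid E M \<Longrightarrow> B \<in> M \<Longrightarrow> finite B"
  by (meson matroid_finite matroid_sub finite_subset)

lemma matroid_finite_bases: "matroid E M \<Longrightarrow> finite M"
  by (meson matroid_def finite_Pow_iff finite_subset)

lemma matroid_card: "matroid E M \<Longrightarrow> I \<in> M \<Longrightarrow> K \<in> M \<Longrightarrow> card I = card K"
  unfolding matroid_def by blast

lemma matroid_exchange:
  assumes "matroid E M" "I \<in> M" "K \<in> M" "i \<in> I" "i \<notin> K"
  obtains k where "k \<in> K" "k \<notin> I" "insert k (I - {i}) \<in> M" "insert i (K - {k}) \<in> M"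
  using assms unfolding matroid_def by (metis DiffD1 DiffD2 DiffI)

lemma matroid_deletion:
  assumes "matroid E M" "B \<in> M" "e \<notin> B"
  shows "matroid (E - {e}) (deletion M e)"
  unfolding matroid_def
proof (intro conjI ballI)
  show "finite (E - {e})" using assms by (simp add: matroid_finite)
  show "deletion M e \<noteq> {}" using assms by (auto simp: deletion_def)
  show "deletion M e \<subseteq> Pow (E - {e})" using matroid_sub[OF assms(1)] by (auto simp: deletion_def)
next
  fix I K assume "I \<in> deletion M e" "K \<in> deletion M e"
  then show "card I = card K" using matroid_card[OF assms(1)] by (auto simp: deletion_def)
next
  fix I K i assume "I \<in> deletion M e" "K \<in> deletion M e" "i \<in> I - K"
  then show "\<exists>k\<in>K - I. insert k (I - {i}) \<in> deletion M e \<and> insert i (K - {k}) \<in> deletion M e"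
    using matroid_exchange[OF assms(1), of I K i] by (auto simp: deletion_def)
qed

lemma matroid_contraction:
  assumes "matroid E M" "B \<in> M" "e \<in> B"
  shows "matroid (E - {e}) (contraction M e)"
  unfolding matroid_def
proof (intro conjI ballI)
  show "finite (E - {e})" using assms by (simp add: matroid_finite)
  have "B - {e} \<in> contraction M e" using assms by (auto simp: contraction_def insert_absorb)
  then show "contraction M e \<noteq> {}" by blast
  show "contraction M e \<subseteq> Pow (E - {e})"
    using matroid_sub[OF assms(1)] by (auto simp: contraction_def)
next
  fix I K assume IK: "I \<in> contraction M e" "K \<in> contraction M e"
  then have *: "insert e I \<in> M" "insert e K \<in> M" by (auto simp: contraction_def)
  then have "card (insert e I) = card (insert e K)" "finite (insert e I)" "finite (insert e K)"
    using matroid_card[OF assms(1) *] matroid_finite_basis[OF assms(1) *(1)]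
      matroid_finite_basis[OF assms(1) *(2)] by auto
  then show "card I = card K" using IK by (simp add: contraction_def)
next
  fix I K i assume IK: "I \<in> contraction M e" "K \<in> contraction M e" "i \<in> I - K"
  then have *: "insert e I \<in> M" "insert e K \<in> M" "i \<in> insert e I" "i \<notin> insert e K" "e \<notin> I" "e \<notin> K"
    by (auto simp: contraction_def)
  then obtain k where k: "k \<in> insert e K" "k \<notin> insert e I"
    "insert k (insert e I - {i}) \<in> M" "insert i (insert e K - {k}) \<in> M"
    using matroid_exchange[OF assms(1)] by metis
  then have "insert k (insert e I - {i}) = insert e (insert k (I - {i}))"
    "insert i (insert e K - {k}) = insert e (insert i (K - {k}))"
    using * IK(3) by auto
  then show "\<exists>k\<in>K - I. insert k (I - {i}) \<in> contraction M e \<and> insert i (K - {k}) \<in> contraction M e"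
    using k * IK(3) by (intro bexI[of _ k]) (auto simp: contraction_def)
qed

lemma matroid_dual:
  assumes "matroid E M"
  shows "matroid E (dual_bases E M)"
  unfolding matroid_def
proof (intro conjI ballI)
  show fin: "finite E" using assms by (simp add: matroid_finite)
  obtain B where "B \<in> M" "B \<subseteq> E" using assms matroid_nonempty matroid_sub by metis
  then have "E - B \<in> dual_bases E M" by (simp add: dual_bases_def double_diff)
  then show "dual_bases E M \<noteq> {}" by blast
  show "dual_bases E M \<subseteq> Pow E" by (auto simp: dual_bases_def)
  fix I K assume IK: "I \<in> dual_bases E M" "K \<in> dual_bases E M"
  then have sub: "I \<subseteq> E" "K \<subseteq> E" "E - I \<in> M" "E - K \<in> M" by (auto simp: dual_bases_def)
  then have "card (E - I) = card (E - K)" using matroid_card[OF assms] by blast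
  moreover have "card (E - I) = card E - card I" "card (E - K) = card E - card K"
    using fin sub by (auto intro: card_Diff_subset finite_subset)
  moreover have "card I \<le> card E" "card K \<le> card E" using fin sub by (auto intro: card_mono)
  ultimately show "card I = card K" by linarith
  fix i assume i: "i \<in> I - K"
  then obtain k where k: "k \<in> E - I" "k \<notin> E - K"
     "insert k (E - K - {i}) \<in> M" "insert i (E - I - {k}) \<in> M"
    using matroid_exchange[OF assms sub(4,3), of i] sub by blast
  moreover have "insert k (E - K - {i}) = E - insert i (K - {k})"
     "insert i (E - I - {k}) = E - insert k (I - {i})" using k sub i by auto
  ultimately show "\<exists>k\<in>K - I. insert k (I - {i}) \<in> dual_bases E M
      \<and> insert i (K - {k}) \<in> dual_bases E M"
    using sub i by (intro bexI[of _ k]) (auto simp: dual_bases_def)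
qed

section \<open>The rank function and its behaviour under minors\<close>

lemma rank_ge: "matroid E M \<Longrightarrow> B \<in> M \<Longrightarrow> card (B \<inter> A) \<le> rank_of M A"
  unfolding rank_of_def by (auto intro!: Max_ge dest: matroid_finite_bases)

lemma rank_attained:
  assumes "matroid E M"
  obtains B where "B \<in> M" "card (B \<inter> A) = rank_of M A"
proof -
  have "rank_of M A \<in> (\<lambda>B. card (B \<inter> A)) ` M"
    unfolding rank_of_def using matroid_finite_bases[OF assms] matroid_nonempty[OF assms]
    by (intro Max_in) auto
  then show ?thesis using that by force
qed

lemma rank_eqI:
  assumes "matroid E M" "B \<in> M" "card (B \<inter> A) = k" "\<And>B. B \<in> M \<Longrightarrow> card (B \<inter> A) \<le> k"
  shows "rank_of M A = k"
  using assms by (metis rank_attained rank_ge le_antisym)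

lemma rank_ground: "matroid E M \<Longrightarrow> B \<in> M \<Longrightarrow> rank_of M E = card B"
  by (rule rank_eqI[of E M B])
    (auto simp: Int_absorb2 matroid_sub dest: matroid_card)

text \<open>A basis that is optimal on \<open>A\<close> can trade \<open>e\<close> for an element of
  \<open>B'\<close>; since \<open>e\<close> lies outside \<open>A\<close>, nothing is lost
  there.\<close>

lemma rank_attained_delete:
  assumes "matroid E M" "B' \<in> M" "e \<notin> B'" "e \<notin> A"
  obtains B where "B \<in> M" "e \<notin> B" "card (B \<inter> A) = rank_of M A"
proof -
  obtain B where B: "B \<in> M" "card (B \<inter> A) = rank_of M A" using rank_attained[OF assms(1)] .
  show ?thesis
  proof (cases "e \<in> B")
    case True
    obtain k where k: "k \<in> B'" "k \<notin> B" "insert k (B - {e}) \<in> M"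
      using matroid_exchange[OF assms(1) B(1) assms(2) True assms(3)] by blast
    have "card (B \<inter> A) \<le> card (insert k (B - {e}) \<inter> A)"
      using matroid_finite_basis[OF assms(1)] B k assms(4) by (intro card_mono) auto
    then have "card (insert k (B - {e}) \<inter> A) = rank_of M A"
      using B(2) rank_ge[OF assms(1) k(3)] by (metis le_antisym)
    then show ?thesis using that[of "insert k (B - {e})"] k assms by auto
  qed (use B that in blast)
qed

text \<open>Exchange brings \<open>e\<close> into an optimal basis at the cost of one element, and
  \<open>e\<close> itself makes up for the loss.\<close>

lemma rank_attained_contract:
  assumes "matroid E M" "B' \<in> M" "e \<in> B'"
  obtains B where "B \<in> M" "e \<in> B" "card (B \<inter> insert e A) = rank_of M (insert e A)"
proof -
  obtain B where B: "B \<in> M" "card (B \<inter> insert e A) = rank_of M (insert e A)"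
    using rank_attained[OF assms(1)] .
  show ?thesis
  proof (cases "e \<in> B")
    case False
    obtain k where k: "k \<in> B" "k \<notin> B'" "insert e (B - {k}) \<in> M"
      using matroid_exchange[OF assms(1,2) B(1) assms(3) False] by blast
    have fin: "finite B" using matroid_finite_basis[OF assms(1)] B by blast
    have "insert e (B - {k}) \<inter> insert e A = insert e ((B \<inter> insert e A) - {k})" 
      using k assms False by auto
    then have "card (B \<inter> insert e A) \<le> card (insert e (B - {k}) \<inter> insert e A)"
      using fin False k by (cases "k \<in> A") (auto simp: card_insert_if card_Diff_singleton_if)
    then have "card (insert e (B - {k}) \<inter> insert e A) = rank_of M (insert e A)"
      using B(2) rank_ge[OF assms(1) k(3)] by (metis le_antisym)
    then show ?thesis using that[of "insert e (B - {k})"] k by auto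
  qed (use B that in blast)
qed

lemma rank_deletion:
  assumes "matroid E M" "B' \<in> M" "e \<notin> B'" "e \<notin> A"
  shows "rank_of (deletion M e) A = rank_of M A"
proof -
  obtain B where "B \<in> M" "e \<notin> B" "card (B \<inter> A) = rank_of M A"
    using rank_attained_delete[OF assms] .
  then show ?thesis
    by (intro rank_eqI[OF matroid_deletion[OF assms(1-3)]])
      (auto simp: deletion_def rank_ge[OF assms(1)])
qed

lemma rank_contraction:
  assumes "matroid E M" "B' \<in> M" "e \<in> B'" "e \<notin> A"
  shows "rank_of M (insert e A) = Suc (rank_of (contraction M e) A)"
proof -
  note mc = matroid_contraction[OF assms(1-3)]
  have cd: "card (insert e X \<inter> insert e A) = Suc (card (X \<inter> A))" if "X \<in> contraction M e" for X
  proof -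
    have "finite X" using matroid_finite_basis[OF mc that] .
    then show ?thesis using that assms(4) by (auto simp: contraction_def)
  qed
  obtain B where B: "B \<in> M" "e \<in> B" "card (B \<inter> insert e A) = rank_of M (insert e A)"
    using rank_attained_contract[OF assms(1-3)] .
  have Be: "B - {e} \<in> contraction M e" "insert e (B - {e}) = B"
    using B by (auto simp: contraction_def insert_absorb)
  have "rank_of (contraction M e) A = rank_of M (insert e A) - 1"
  proof (rule rank_eqI[OF mc Be(1)])
    show "card ((B - {e}) \<inter> A) = rank_of M (insert e A) - 1"
      using cd[OF Be(1)] unfolding Be(2) B(3) by simp
    fix X assume X: "X \<in> contraction M e"
    then have "card (insert e X \<inter> insert e A) \<le> rank_of M (insert e A)"
      using rank_ge[OF assms(1)] unfolding contraction_def by blast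
    then show "card (X \<inter> A) \<le> rank_of M (insert e A) - 1" using cd[OF X] by simp
  qed
  moreover have "rank_of M (insert e A) \<noteq> 0" using cd[OF Be(1)] unfolding Be(2) B(3) by simp
  ultimately show ?thesis by simp
qed

text \<open>One basis serves two nested sets: a basis optimal on \<open>U\<close> can be improved on
  \<open>V\<close> by exchanging elements outside \<open>V\<close>, which leaves its trace on
  \<open>U\<close> intact. Submodularity of the rank follows.\<close>

lemma rank_nested_attained:
  assumes M: "matroid E M" and "U \<subseteq> V"
  obtains B where "B \<in> M" "card (B \<inter> U) = rank_of M U" "card (B \<inter> V) = rank_of M V"
proof -
  define S where "S = {B \<in> M. card (B \<inter> U) = rank_of M U}"
  obtain B' where B': "B' \<in> M" "card (B' \<inter> V) = rank_of M V" using rank_attained[OF M] .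
  have "finite S" using matroid_finite_bases[OF M] by (simp add: S_def)
  have "S \<noteq> {}" using rank_attained[OF M, of U] unfolding S_def by blast
  \<comment> \<open>A lexicographic order: first the trace on \<open>V\<close>, then the overlap
    with \<open>B'\<close>. The factor \<open>card B' + 1\<close> exceeds every possible
    overlap.\<close>
  define f where "f B = card (B \<inter> V) * (card B' + 1) + card (B \<inter> B')" for B
  obtain B where B: "B \<in> S" and mx: "\<And>X. X \<in> S \<Longrightarrow> f X \<le> f B"
    using Max_in[of "f ` S"] Max_ge[of "f ` S"] \<open>finite S\<close> \<open>S \<noteq> {}\<close>
    by (metis (no_types, lifting) finite_imageI imageE image_eqI image_is_empty)
  have BM: "B \<in> M" "card (B \<inter> U) = rank_of M U" using B by (auto simp: S_def)
  have fin: "finite B" "finite B'" using matroid_finite_basis[OF M] BM B' by auto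
  have "card (B \<inter> V) = rank_of M V"
  proof (rule ccontr)
    assume "card (B \<inter> V) \<noteq> rank_of M V"
    then have lt: "card (B \<inter> V) < card (B' \<inter> V)" using rank_ge[OF M BM(1), of V] B' by simp
    have "card B = card (B \<inter> V) + card (B - V)" "card B' = card (B' \<inter> V) + card (B' - V)"
      using fin by (simp_all add: card_Int_Diff)
    \<comment> \<open>Having too little inside \<open>V\<close>, \<open>B\<close> has too much
      outside: some \<open>i\<close> there is missing from \<open>B'\<close>, and exchanging it
      increases the overlap with \<open>B'\<close> at no cost on \<open>U\<close> or
      \<open>V\<close>.\<close>
    then have "card (B' - V) < card (B - V)" using lt matroid_card[OF M BM(1) B'(1)] by linarith
    then have "\<not> B - V \<subseteq> B' - V" using fin card_mono[of "B' - V" "B - V"] by auto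
    then obtain i where i: "i \<in> B" "i \<notin> B'" "i \<notin> V" by blast
    obtain k where k: "k \<in> B'" "k \<notin> B" "insert k (B - {i}) \<in> M"
      using matroid_exchange[OF M BM(1) B'(1) i(1,2)] by blast
    let ?X = "insert k (B - {i})"
    have "card (B \<inter> U) \<le> card (?X \<inter> U)" using fin i assms(2) by (intro card_mono) auto
    then have "?X \<in> S" using k BM rank_ge[OF M k(3), of U] by (simp add: S_def)
    moreover have "card (B \<inter> V) \<le> card (?X \<inter> V)" using fin i by (intro card_mono) auto
    moreover have "card (?X \<inter> B') = Suc (card (B \<inter> B'))"
    proof -
      have "?X \<inter> B' = insert k (B \<inter> B')" using i k by auto
      then show ?thesis using fin k by simp
    qed
    ultimately show False using mx[of ?X] mult_le_mono1[of "card (B \<inter> V)" "card (?X \<inter> V)"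
        "card B' + 1"]
      by (simp add: f_def)
  qed
  then show ?thesis using that BM by blast
qed

text \<open>A basis optimal on both the intersection and the union reduces the claim to modularity
  of cardinality.\<close>

lemma rank_submodular:
  assumes M: "matroid E M"
  shows "rank_of M (S \<inter> T) + rank_of M (S \<union> T) \<le> rank_of M S + rank_of M T"
proof -
  obtain B where B: "B \<in> M" "card (B \<inter> (S \<inter> T)) = rank_of M (S \<inter> T)"
    "card (B \<inter> (S \<union> T)) = rank_of M (S \<union> T)"
    using rank_nested_attained[OF M, of "S \<inter> T" "S \<union> T"] by blast
  have "finite B" using matroid_finite_basis[OF M B(1)] .
  then have "card (B \<inter> S) + card (B \<inter> T) = card ((B \<inter> S) \<union> (B \<inter> T)) + card ((B \<inter> S) \<inter> (B \<inter> T))"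
    by (intro card_Un_Int) auto
  moreover have "(B \<inter> S) \<union> (B \<inter> T) = B \<inter> (S \<union> T)" "(B \<inter> S) \<inter> (B \<inter> T) = B \<inter> (S \<inter> T)" by auto
  ultimately show ?thesis using B rank_ge[OF M B(1), of S] rank_ge[OF M B(1), of T] by simp
qed

text \<open>The traces of a basis on \<open>A\<close> and \<open>E - A\<close> add up to the full
  rank, so constancy means that every basis is optimal on both. In rank form, separators become
  accessible to submodularity.\<close>

lemma constant_card_iff_rank:
  assumes M: "matroid E M" and A: "A \<subseteq> E"
  shows "(\<forall>I\<in>M. \<forall>K\<in>M. card (I \<inter> A) = card (K \<inter> A)) \<longleftrightarrow>
    rank_of M A + rank_of M (E - A) \<le> rank_of M E"
proof -
  have split: "card (B \<inter> A) + card (B \<inter> (E - A)) = rank_of M E" if "B \<in> M" for B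
  proof -
    have "B \<inter> (E - A) = B - A" using matroid_sub[OF M that] by auto
    then show ?thesis
      using rank_ground[OF M that] card_Int_Diff[OF matroid_finite_basis[OF M that], of A] by simp
  qed
  obtain B where B: "B \<in> M" "card (B \<inter> A) = rank_of M A" using rank_attained[OF M] .
  obtain B' where B': "B' \<in> M" "card (B' \<inter> (E - A)) = rank_of M (E - A)" using rank_attained[OF M] .
  show ?thesis
  proof
    assume "\<forall>I\<in>M. \<forall>K\<in>M. card (I \<inter> A) = card (K \<inter> A)"
    then have "card (B \<inter> A) = card (B' \<inter> A)" using B B' by blast
    then show "rank_of M A + rank_of M (E - A) \<le> rank_of M E" using split[OF B'(1)] B B' by simp
  next
    assume le: "rank_of M A + rank_of M (E - A) \<le> rank_of M E"
    have "card (I \<inter> A) = rank_of M A" if "I \<in> M" for I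
      using split[OF that] rank_ge[OF M that, of A] rank_ge[OF M that, of "E - A"] le by linarith
    then show "\<forall>I\<in>M. \<forall>K\<in>M. card (I \<inter> A) = card (K \<inter> A)" by simp
  qed
qed

lemma disconnectedE:
  assumes "\<not> connected_bases E M"
  obtains A where "A \<noteq> {}" "A \<subset> E" "\<forall>I\<in>M. \<forall>K\<in>M. card (I \<inter> A) = card (K \<inter> A)"
  using assms unfolding connected_bases_def by metis

lemma connected_no_loop:
  assumes "matroid E M" "connected_bases E M" "e \<in> E" "E \<noteq> {e}"
  shows "\<exists>B\<in>M. e \<in> B" "\<exists>B\<in>M. e \<notin> B"
proof -
  obtain I K where "I \<in> M" "K \<in> M" "card (I \<inter> {e}) \<noteq> card (K \<inter> {e})"
    using assms unfolding connected_bases_def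
        by (metis empty_not_insert empty_subsetI insert_subset psubsetI)
  then show "\<exists>B\<in>M. e \<in> B" "\<exists>B\<in>M. e \<notin> B" by (cases "e \<in> I"; cases "e \<in> K"; auto)+
qed

text \<open>Tutte's theorem, by uncrossing a separator of the deletion with one of the
  contraction.\<close>

lemma connected_deletion_or_contraction:
  assumes M: "matroid E M" and conn: "connected_bases E M" and e: "e \<in> E"
  shows "connected_bases (E - {e}) (deletion M e) \<or> connected_bases (E - {e}) (contraction M e)"
proof (cases "E = {e}")
  case True
  then show ?thesis by (auto simp: connected_bases_def)
next
  case ne: False
  obtain B1 B2 where B1: "B1 \<in> M" "e \<in> B1" and B2: "B2 \<in> M" "e \<notin> B2"
    using connected_no_loop[OF M conn e ne] by blast
  note md = matroid_deletion[OF M B2] and mc = matroid_contraction[OF M B1]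
  let ?E = "E - {e}" and ?r = "rank_of M"
  show ?thesis
  proof (rule ccontr)
    assume "\<not> ?thesis"
    then obtain X Y where X: "X \<noteq> {}" "X \<subset> ?E"
      "\<forall>I\<in>deletion M e. \<forall>K\<in>deletion M e. card (I \<inter> X) = card (K \<inter> X)"
      and Y: "Y \<noteq> {}" "Y \<subset> ?E"
      "\<forall>I\<in>contraction M e. \<forall>K\<in>contraction M e. card (I \<inter> Y) = card (K \<inter> Y)"
      unfolding connected_bases_def by metis
    have rX: "?r X + ?r (?E - X) \<le> ?r E"
    proof -
      have "rank_of (deletion M e) X + rank_of (deletion M e) (?E - X) \<le> rank_of (deletion M e) ?E"
        using constant_card_iff_rank[OF md, of X] X by blast
      moreover have "e \<notin> X" using X by auto
      ultimately have "?r X + ?r (?E - X) \<le> ?r ?E"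
        using rank_deletion[OF M B2, of X] rank_deletion[OF M B2, of "?E - X"]
          rank_deletion[OF M B2, of ?E] by simp
      moreover have "?r ?E \<le> ?r E"
        using rank_attained[OF M, of ?E] rank_ground[OF M] matroid_finite_basis[OF M]
        by (metis Int_lower1 card_mono)
      ultimately show ?thesis by linarith
    qed
    have rY: "?r (insert e Y) + ?r (insert e (?E - Y)) \<le> ?r E + 1"
    proof -
      have "rank_of (contraction M e) Y + rank_of (contraction M e) (?E - Y)
          \<le> rank_of (contraction M e) ?E"
        using constant_card_iff_rank[OF mc, of Y] Y by blast
      moreover have "e \<notin> Y" "insert e ?E = E" using Y e by auto
      ultimately show ?thesis
        using rank_contraction[OF M B1, of Y] rank_contraction[OF M B1, of "?E - Y"]
          rank_contraction[OF M B1, of ?E] by simp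
    qed
    \<comment> \<open>If two opposite corners of the crossing are nonempty, connectedness gives them
      together a rank sum of at least \<open>2 * ?r E + 2\<close>, while submodularity bounds it by
      \<open>2 * ?r E + 1\<close>.\<close>
    have no: False if sep: "X' \<inter> Y' \<noteq> {}" "(?E - X') \<inter> (?E - Y') \<noteq> {}" "X' \<subseteq> ?E" "Y' \<subseteq> ?E"
      and rX: "?r X' + ?r (?E - X') \<le> ?r E"
      and rY: "?r (insert e Y') + ?r (insert e (?E - Y')) \<le> ?r E + 1" for X' Y'
    proof -
      have big: "?r E < ?r A + ?r (E - A)" if "A \<noteq> {}" "A \<subset> E" for A
      proof -
        have "\<not> (\<forall>I\<in>M. \<forall>K\<in>M. card (I \<inter> A) = card (K \<inter> A))"
          using conn[unfolded connected_bases_def, rule_format, OF that] by blast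
        then show ?thesis using constant_card_iff_rank[OF M, of A] that
            by (simp add: psubset_imp_subset)
      qed
      have 1: "?r (X' \<inter> Y') + ?r (X' \<union> insert e Y') \<le> ?r X' + ?r (insert e Y')"
      proof -
        have "X' \<inter> insert e Y' = X' \<inter> Y'" using sep by auto
        then show ?thesis using rank_submodular[OF M, of X' "insert e Y'"] by simp
      qed
      have 2: "?r ((?E - X') \<inter> (?E - Y')) + ?r ((?E - X') \<union> insert e (?E - Y'))
         \<le> ?r (?E - X') + ?r (insert e (?E - Y'))"
        using rank_submodular[OF M, of "?E - X'" "insert e (?E - Y')"] by simp
      have eq: "(?E - X') \<union> insert e (?E - Y') = E - X' \<inter> Y'"
        "X' \<union> insert e Y' = E - (?E - X') \<inter> (?E - Y')" using sep e by auto
      have "?r E < ?r (X' \<inter> Y') + ?r (E - X' \<inter> Y')" using sep e by (intro big) auto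
      moreover have "?r E < ?r ((?E - X') \<inter> (?E - Y')) + ?r (E - (?E - X') \<inter> (?E - Y'))"
        using sep e by (intro big) auto
      ultimately show False using 1 2 rX rY unfolding eq by linarith
    qed
    have XX: "?E - (?E - X) = X" "X \<subseteq> ?E" "Y \<subseteq> ?E" using X Y by auto
    \<comment> \<open>Each pair of opposite corners has an empty member. Two empty corners from
      different pairs are adjacent, so one of \<open>X\<close>, \<open>Y\<close> and their
      complements in \<open>?E\<close> is empty.\<close>
    have "X \<inter> Y = {} \<or> (?E - X) \<inter> (?E - Y) = {}" using no[of X Y] rX rY XX by blast
    moreover have "(?E - X) \<inter> Y = {} \<or> X \<inter> (?E - Y) = {}"
      using no[of "?E - X" Y] rX rY XX by (simp add: add.commute) blast
    ultimately show False using X(1,2) Y(1,2) by blast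
  qed
qed

section \<open>Beta bases and Crapo's beta invariant\<close>

text \<open>In Tutte's terminology these are the bases of internal activity one and external activity
  zero for the order given by \<open>ord\<close>; the first element always belongs to such a basis.\<close>

definition beta_bases :: "'a set \<Rightarrow> ('a \<Rightarrow> nat) \<Rightarrow> 'a set set \<Rightarrow> 'a set set" where
  "beta_bases E ord M = {B \<in> M.
     (\<forall>j\<in>E - B. \<exists>i\<in>B. ord i < ord j \<and> insert j (B - {i}) \<in> M) \<and>
     (\<forall>i\<in>B. (\<exists>k\<in>E. ord k < ord i) \<longrightarrow> (\<exists>j\<in>E - B. ord j < ord i \<and> insert j (B - {i}) \<in> M))}"

text \<open>Crapo's formula. No order enters, so its agreement with the number of beta bases makes
  that number independent of the order.\<close>

definition beta :: "'a set \<Rightarrow> 'a set set \<Rightarrow> int" where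
  "beta E M = (- 1) ^ rank_of M E * (\<Sum>A\<in>Pow E. (- 1) ^ card A * int (rank_of M A))"

lemma beta_bases_subset: "beta_bases E ord M \<subseteq> M"
  by (auto simp: beta_bases_def)

lemma finite_beta_bases: "matroid E M \<Longrightarrow> finite (beta_bases E ord M)"
  by (rule finite_subset[OF beta_bases_subset matroid_finite_bases])

lemma beta_basesD:
  assumes "B \<in> beta_bases E ord M"
  shows "B \<in> M"
    and "\<And>j. j \<in> E \<Longrightarrow> j \<notin> B \<Longrightarrow> \<exists>i\<in>B. ord i < ord j \<and> insert j (B - {i}) \<in> M"
    and "\<And>i k. i \<in> B \<Longrightarrow> k \<in> E \<Longrightarrow> ord k < ord i \<Longrightarrow>
           \<exists>j\<in>E - B. ord j < ord i \<and> insert j (B - {i}) \<in> M"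
  using assms unfolding beta_bases_def by blast+

lemma beta_basesI:
  assumes "B \<in> M"
    and "\<And>j. j \<in> E \<Longrightarrow> j \<notin> B \<Longrightarrow> \<exists>i\<in>B. ord i < ord j \<and> insert j (B - {i}) \<in> M"
    and "\<And>i k. i \<in> B \<Longrightarrow> k \<in> E \<Longrightarrow> ord k < ord i \<Longrightarrow>
           \<exists>j\<in>E - B. ord j < ord i \<and> insert j (B - {i}) \<in> M"
  shows "B \<in> beta_bases E ord M"
  using assms unfolding beta_bases_def by blast

text \<open>The last element is too large to be the smaller partner of another element, so the
  conditions at the others are those of the contraction. The condition at \<open>e\<close> itself
  holds because \<open>B1\<close> avoids \<open>e\<close> and every replacement precedes
  \<open>e\<close>.\<close>

lemma beta_bases_last_in:
  assumes M: "matroid E M" and e: "e \<in> E" and last: "\<forall>x\<in>E - {e}. ord x < ord e"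
    and co: "B1 \<in> M" "e \<notin> B1" and B: "e \<notin> B"
  shows "insert e B \<in> beta_bases E ord M \<longleftrightarrow> B \<in> beta_bases (E - {e}) ord (contraction M e)"
proof
  assume L: "insert e B \<in> beta_bases E ord M"
  note D = beta_basesD[OF L]
  show "B \<in> beta_bases (E - {e}) ord (contraction M e)"
  proof (rule beta_basesI)
    show "B \<in> contraction M e" using D(1) B by (simp add: contraction_def)
  next
    fix j assume j: "j \<in> E - {e}" "j \<notin> B"
    then obtain i where i: "i \<in> insert e B" "ord i < ord j" "insert j (insert e B - {i}) \<in> M"
      using D(2)[of j] by blast
    moreover have "ord j < ord e" using last j by simp
    ultimately have "i \<noteq> e" by auto
    moreover from this have "insert j (insert e B - {i}) = insert e (insert j (B - {i}))" by auto
    ultimately show "\<exists>i\<in>B. ord i < ord j \<and> insert j (B - {i}) \<in> contraction M e"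
      using i j B by (intro bexI[of _ i]) (auto simp: contraction_def)
  next
    fix i k assume ik: "i \<in> B" "k \<in> E - {e}" "ord k < ord i"
    then obtain j where j: "j \<in> E - insert e B" "ord j < ord i" "insert j (insert e B - {i}) \<in> M"
      using D(3)[of i k] by auto
    moreover have "insert j (insert e B - {i}) = insert e (insert j (B - {i}))" using ik B by auto
    ultimately show "\<exists>j\<in>E - {e} - B. ord j < ord i \<and> insert j (B - {i}) \<in> contraction M e"
      using B by (intro bexI[of _ j]) (auto simp: contraction_def)
  qed
next
  assume R: "B \<in> beta_bases (E - {e}) ord (contraction M e)"
  note D = beta_basesD[OF R]
  have BM: "insert e B \<in> M" using D(1) by (simp add: contraction_def)
  show "insert e B \<in> beta_bases E ord M"
  proof (rule beta_basesI)
    show "insert e B \<in> M" by fact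
  next
    fix j assume j: "j \<in> E" "j \<notin> insert e B"
    then obtain i where i: "i \<in> B" "ord i < ord j" "insert e (insert j (B - {i})) \<in> M"
      using D(2)[of j] by (auto simp: contraction_def)
    moreover have "insert j (insert e B - {i}) = insert e (insert j (B - {i}))" using i B by auto
    ultimately show "\<exists>i\<in>insert e B. ord i < ord j \<and> insert j (insert e B - {i}) \<in> M" by auto
  next
    fix i k assume ik: "i \<in> insert e B" "k \<in> E" "ord k < ord i"
    show "\<exists>j\<in>E - insert e B. ord j < ord i \<and> insert j (insert e B - {i}) \<in> M"
    proof (cases "i = e")
      case True
      obtain j where "j \<in> B1" "j \<notin> insert e B" "insert j (insert e B - {e}) \<in> M"
        using matroid_exchange[OF M BM co(1) _ co(2)] by blast
      then show ?thesis using True last matroid_sub[OF M co(1)] by auto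
    next
      case False
      have "i \<in> E" using matroid_sub[OF M BM] ik by auto
      then have "k \<noteq> e" using bspec[OF last, of i] False ik by auto
      then obtain j where j: "j \<in> E - {e} - B" "ord j < ord i" "insert e (insert j (B - {i})) \<in> M"
        using D(3)[of i k] ik False by (auto simp: contraction_def)
      moreover have "insert j (insert e B - {i}) = insert e (insert j (B - {i}))" using False
          by auto
      ultimately show ?thesis by auto
    qed
  qed
qed

text \<open>The dual situation: now the basis \<open>B1\<close> through \<open>e\<close> supplies
  the exchange that the last element requires.\<close>

lemma beta_bases_last_notin:
  assumes M: "matroid E M" and e: "e \<in> E" and last: "\<forall>x\<in>E - {e}. ord x < ord e"
    and co: "B1 \<in> M" "e \<in> B1" and B: "e \<notin> B"
  shows "B \<in> beta_bases E ord M \<longleftrightarrow> B \<in> beta_bases (E - {e}) ord (deletion M e)"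
proof
  assume L: "B \<in> beta_bases E ord M"
  note D = beta_basesD[OF L]
  show "B \<in> beta_bases (E - {e}) ord (deletion M e)"
  proof (rule beta_basesI)
    show "B \<in> deletion M e" using D(1) B by (simp add: deletion_def)
  next
    fix j assume j: "j \<in> E - {e}" "j \<notin> B"
    then show "\<exists>i\<in>B. ord i < ord j \<and> insert j (B - {i}) \<in> deletion M e"
      using D(2)[of j] B by (auto simp: deletion_def)
  next
    fix i k assume ik: "i \<in> B" "k \<in> E - {e}" "ord k < ord i"
    then obtain j where j: "j \<in> E - B" "ord j < ord i" "insert j (B - {i}) \<in> M"
      using D(3)[of i k] by auto
    moreover have "ord i < ord e" using last matroid_sub[OF M D(1)] ik B
        by (metis Diff_iff singletonD subsetD)
    moreover from this have "j \<noteq> e" using j(2) by auto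
    ultimately show "\<exists>j\<in>E - {e} - B. ord j < ord i \<and> insert j (B - {i}) \<in> deletion M e"
      using B by (auto simp: deletion_def)
  qed
next
  assume R: "B \<in> beta_bases (E - {e}) ord (deletion M e)"
  note D = beta_basesD[OF R]
  have BM: "B \<in> M" using D(1) by (simp add: deletion_def)
  show "B \<in> beta_bases E ord M"
  proof (rule beta_basesI)
    show "B \<in> M" by fact
  next
    fix j assume j: "j \<in> E" "j \<notin> B"
    show "\<exists>i\<in>B. ord i < ord j \<and> insert j (B - {i}) \<in> M"
    proof (cases "j = e")
      case True
      obtain i where "i \<in> B" "i \<notin> B1" "insert e (B - {i}) \<in> M"
        using matroid_exchange[OF M co(1) BM co(2) B] by blast
      then show ?thesis using True B last matroid_sub[OF M BM] by auto
    next
      case False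
      then show ?thesis using D(2)[of j] j by (auto simp: deletion_def)
    qed
  next
    fix i k assume ik: "i \<in> B" "k \<in> E" "ord k < ord i"
    have "i \<in> E" "i \<noteq> e" using matroid_sub[OF M BM] ik B by auto
    then have "k \<noteq> e" using bspec[OF last, of i] ik by auto
    then show "\<exists>j\<in>E - B. ord j < ord i \<and> insert j (B - {i}) \<in> M"
      using D(3)[of i k] ik by (auto simp: deletion_def)
  qed
qed

lemma card_beta_bases_last:
  assumes M: "matroid E M" and e: "e \<in> E" and last: "\<forall>x\<in>E - {e}. ord x < ord e"
    and B: "B0 \<in> M" "e \<notin> B0" "B1 \<in> M" "e \<in> B1"
  shows "card (beta_bases E ord M) = card (beta_bases (E - {e}) ord (deletion M e)) +
    card (beta_bases (E - {e}) ord (contraction M e))"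
proof -
  let ?D = "beta_bases (E - {e}) ord (deletion M e)"
      and ?C = "beta_bases (E - {e}) ord (contraction M e)"
  have D: "e \<notin> X" if "X \<in> ?D" for X
    using that beta_bases_subset[of _ _ "deletion M e"] by (auto simp: deletion_def)
  have C: "e \<notin> X" if "X \<in> ?C" for X
    using that beta_bases_subset[of _ _ "contraction M e"] by (auto simp: contraction_def)
  have "beta_bases E ord M = ?D \<union> insert e ` ?C"
  proof (intro set_eqI)
    fix X
    show "X \<in> beta_bases E ord M \<longleftrightarrow> X \<in> ?D \<union> insert e ` ?C"
    proof (cases "e \<in> X")
      case True
      then obtain Y where Y: "X = insert e Y" "e \<notin> Y" by (metis mk_disjoint_insert)
      have "X \<in> insert e ` ?C \<longleftrightarrow> Y \<in> ?C"
        using Y C by (auto simp: insert_ident image_iff)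
      moreover have "X \<in> beta_bases E ord M \<longleftrightarrow> Y \<in> ?C"
        using beta_bases_last_in[OF M e last B(1,2) Y(2)] Y(1) by simp
      moreover have "X \<notin> ?D" using D True by blast
      ultimately show ?thesis by blast
    next
      case False
      then show ?thesis using beta_bases_last_notin[OF M e last B(3,4) False] by blast
    qed
  qed
  moreover have "?D \<inter> insert e ` ?C = {}" using D by auto
  moreover have "inj_on (insert e) ?C" using C by (auto simp: inj_on_def insert_ident)
  moreover have "finite ?D" "finite ?C"
    using finite_beta_bases[OF matroid_deletion[OF M B(1,2)]]
      finite_beta_bases[OF matroid_contraction[OF M B(3,4)]] by auto
  ultimately show ?thesis by (simp add: card_Un_disjoint card_image)
qed

lemma card_Int_exchange_eq:
  assumes "finite B" "i \<in> B" "j \<notin> B" "card (insert j (B - {i}) \<inter> A) = card (B \<inter> A)"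
  shows "i \<in> A \<longleftrightarrow> j \<in> A"
proof (rule ccontr)
  assume "\<not> ?thesis"
  then consider "i \<in> A" "j \<notin> A" | "i \<notin> A" "j \<in> A" by blast
  then show False
  proof cases
    case 1
    then have "insert j (B - {i}) \<inter> A \<subset> B \<inter> A" using assms by auto
    then have "card (insert j (B - {i}) \<inter> A) < card (B \<inter> A)"
      by (intro psubset_card_mono) (use assms in auto)
    then show False using assms(4) by simp
  next
    case 2
    then have "B \<inter> A \<subset> insert j (B - {i}) \<inter> A" using assms by auto
    then have "card (B \<inter> A) < card (insert j (B - {i}) \<inter> A)"
      by (intro psubset_card_mono) (use assms in auto)
    then show False using assms(4) by simp
  qed
qed

lemma obtain_first:
  fixes ord :: "'a \<Rightarrow> nat"
  assumes "finite E" "E \<noteq> {}"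
  obtains m where "m \<in> E" "\<forall>x\<in>E. ord m \<le> ord x"
proof -
  have "Min (ord ` E) \<in> ord ` E" using assms by simp
  then obtain m where m: "m \<in> E" "ord m = Min (ord ` E)" by auto
  then show ?thesis using that assms by simp
qed

text \<open>An exchange between bases with equal trace on \<open>A\<close> swaps elements on the
  same side of \<open>A\<close>. A beta basis ties every element but the first to a smaller one, so
  by descent all lie on the side of the first.\<close>

lemma beta_bases_imp_connected:
  assumes M: "matroid E M" and inj: "inj_on ord E" and B: "B \<in> beta_bases E ord M"
  shows "connected_bases E M"
  unfolding connected_bases_def
proof (intro allI impI, rule ccontr)
  fix A assume A: "A \<noteq> {}" "A \<subset> E" and nc: "\<not> (\<exists>I\<in>M. \<exists>K\<in>M. card (I \<inter> A) \<noteq> card (K \<inter> A))"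
  note D = beta_basesD[OF B]
  have BE: "B \<subseteq> E" and fin: "finite B"
      using matroid_sub[OF M D(1)] matroid_finite_basis[OF M D(1)] by auto
  have same: "i \<in> A \<longleftrightarrow> j \<in> A" if "i \<in> B" "j \<notin> B" "insert j (B - {i}) \<in> M" for i j
  proof (rule card_Int_exchange_eq[OF fin that(1,2)])
    show "card (insert j (B - {i}) \<inter> A) = card (B \<inter> A)" using nc that(3) D(1) by metis
  qed
  have "E \<noteq> {}" using A by blast
  obtain m where m: "m \<in> E" "\<forall>x\<in>E. ord m \<le> ord x"
    using obtain_first[OF matroid_finite[OF M] \<open>E \<noteq> {}\<close>] .
  have "x \<in> A \<longleftrightarrow> m \<in> A" if "x \<in> E" for x using that
  proof (induction "ord x" arbitrary: x rule: less_induct)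
    case less
    show ?case
    proof (cases "x = m")
      case False
      then have lt: "ord m < ord x" using m less.prems inj by (metis inj_onD le_neq_implies_less)
      show ?thesis
      proof (cases "x \<in> B")
        case True
        then obtain j where "j \<in> E - B" "ord j < ord x" "insert j (B - {x}) \<in> M"
            using D(3)[OF True m(1) lt] by blast
        then show ?thesis using same[OF True, of j] less.hyps[of j] by blast
      next
        case False
        then obtain i where "i \<in> B" "ord i < ord x" "insert x (B - {i}) \<in> M"
            using D(2)[OF less.prems] by blast
        then show ?thesis using same[of i x] False less.hyps[of i] BE by blast
      qed
    qed simp
  qed
  then show False using A by blast
qed

lemma obtain_last:
  fixes ord :: "'a \<Rightarrow> nat"
  assumes "finite E" "E \<noteq> {}" "inj_on ord E"
  obtains e where "e \<in> E" "\<forall>x\<in>E - {e}. ord x < ord e"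
proof -
  have "Max (ord ` E) \<in> ord ` E" using assms by simp
  then obtain e where e: "e \<in> E" "ord e = Max (ord ` E)" by auto
  show ?thesis
  proof (rule that[OF e(1)], rule ballI)
    fix x assume x: "x \<in> E - {e}"
    then have "ord x \<le> ord e" using e assms by simp
    moreover have "ord x \<noteq> ord e" using x e assms(3) by (metis DiffE inj_onD singletonI)
    ultimately show "ord x < ord e" by simp
  qed
qed

text \<open>Removing the last element leaves a connected deletion or contraction, whose beta bases
  survive in \<open>M\<close>. The case \<open>M = {{}}\<close> is excluded because a single loop is
  vacuously connected but has no beta basis.\<close>

lemma connected_imp_beta_bases:
  assumes "matroid E M" "inj_on ord E" "connected_bases E M" "E \<noteq> {}" "M \<noteq> {{}}"
  shows "beta_bases E ord M \<noteq> {}"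
  using assms
proof (induction "card E" arbitrary: E M rule: less_induct)
  case less
  note M = less.prems(1)
  have fin: "finite E" using matroid_finite[OF M] .
  obtain e where e: "e \<in> E" "\<forall>x\<in>E - {e}. ord x < ord e"
    using obtain_last[OF fin less.prems(4,2)] .
  show ?case
  proof (cases "E = {e}")
    case True
    have "M \<subseteq> Pow {e}" "M \<noteq> {}" using M True by (auto simp: matroid_def)
    moreover have "\<not> ({} \<in> M \<and> {e} \<in> M)" using matroid_card[OF M, of "{}" "{e}"] by auto
    ultimately have "M = {{e}}" using less.prems(5) by (auto simp: Pow_insert)
    then have "{e} \<in> beta_bases E ord M" using True by (auto simp: beta_bases_def)
    then show ?thesis by blast
  next
    case False
    obtain B1 B0 where B: "B1 \<in> M" "e \<in> B1" "B0 \<in> M" "e \<notin> B0"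
      using connected_no_loop[OF M less.prems(3) e(1) False] by blast
    have IH: "beta_bases (E - {e}) ord M' \<noteq> {}"
      if "matroid (E - {e}) M'" "connected_bases (E - {e}) M'" "M' \<noteq> {{}}" for M'
    proof (rule less.hyps)
      show "card (E - {e}) < card E" using e(1) fin
          by (simp add: card_Diff1_less del: card_Diff_insert)
      show "inj_on ord (E - {e})" using less.prems(2) by (auto simp: inj_on_def)
    qed (use that False e in auto)
    have card0: "card (beta_bases E ord M) \<noteq> 0"
        if "card (beta_bases (E - {e}) ord (deletion M e)) \<noteq> 0 \<or>
       card (beta_bases (E - {e}) ord (contraction M e)) \<noteq> 0"
      using card_beta_bases_last[OF M e B(3,4,1,2)] that by simp
    note md = matroid_deletion[OF M B(3,4)] and mc = matroid_contraction[OF M B(1,2)]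
    have find: "finite (beta_bases (E - {e}) ord (deletion M e))"
        "finite (beta_bases (E - {e}) ord (contraction M e))"
      using finite_beta_bases[OF md] finite_beta_bases[OF mc] by auto
    have card1: "card B = card B1" "finite B" if "B \<in> M" for B 
      using matroid_card[OF M that B(1)] matroid_finite_basis[OF M that] by auto
    have dne: "deletion M e \<noteq> {{}}"
    proof
      assume "deletion M e = {{}}"
      then have "{} \<in> M" by (auto simp: deletion_def)
      then show False using card1[of "{}"] card1(2)[OF B(1)] B(2) by auto
    qed
    show ?thesis
    proof (cases "connected_bases (E - {e}) (deletion M e)")
      case True
      then have "card (beta_bases (E - {e}) ord (deletion M e)) \<noteq> 0"
        using IH[OF md True dne] find(1) by (simp add: card_eq_0_iff)
      then show ?thesis using card0 by (metis card.empty)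
    next
      case nd: False
      then have conn: "connected_bases (E - {e}) (contraction M e)"
        using connected_deletion_or_contraction[OF M less.prems(3) e(1)] by blast
      \<comment> \<open>A disconnected deletion shows that at least two elements remain, and on
        these the rank-zero matroid would be disconnected.\<close>
      have "contraction M e \<noteq> {{}}"
      proof
        assume c: "contraction M e = {{}}"
        obtain A where A: "A \<noteq> {}" "A \<subset> E - {e}" using nd unfolding connected_bases_def by blast
        obtain I K where "I \<in> contraction M e" "K \<in> contraction M e" "card (I \<inter> A) \<noteq> card (K \<inter> A)"
          using conn[unfolded connected_bases_def, rule_format, OF A] by blast
        then show False using c by auto
      qed
      then have "beta_bases (E - {e}) ord (contraction M e) \<noteq> {}" by (rule IH[OF mc conn])
      then have "card (beta_bases (E - {e}) ord (contraction M e)) \<noteq> 0"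
        using find(2) by (metis card_0_eq)
      then show ?thesis using card0 by (metis card.empty)
    qed
  qed
qed

section \<open>The alternating rank sum under deletion, contraction and duality\<close>

lemma sum_Pow_split:
  fixes f :: "'a set \<Rightarrow> int"
  assumes "finite E" "e \<in> E"
  shows "(\<Sum>A\<in>Pow E. (- 1) ^ card A * f A) =
    (\<Sum>A\<in>Pow (E - {e}). (- 1) ^ card A * (f A - f (insert e A)))"
proof -
  let ?P = "Pow (E - {e})"
  have eq: "Pow E = ?P \<union> insert e ` ?P"
    using assms(2) Pow_insert[of e "E - {e}"] by (simp add: insert_absorb)
  have "inj_on (insert e) ?P" by (auto simp: inj_on_def insert_ident)
  then have "(\<Sum>A\<in>insert e ` ?P. (- 1) ^ card A * f A) =
     (\<Sum>A\<in>?P. (- 1) ^ card (insert e A) * f (insert e A))"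
    by (simp add: sum.reindex)
  also have "\<dots> = (\<Sum>A\<in>?P. - ((- 1) ^ card A * f (insert e A)))"
  proof (rule sum.cong[OF refl])
    fix A assume "A \<in> ?P"
    then have "finite A" "e \<notin> A" using assms by (auto intro: finite_subset)
    then show "(- 1) ^ card (insert e A) * f (insert e A) = - ((- 1) ^ card A * f (insert e A))"
        by simp
  qed
  finally have "(\<Sum>A\<in>insert e ` ?P. (- 1) ^ card A * f A)
      = (\<Sum>A\<in>?P. - ((- 1) ^ card A * f (insert e A)))" .
  moreover have "?P \<inter> insert e ` ?P = {}" by auto
  moreover have "finite ?P" using assms by simp
  ultimately have "(\<Sum>A\<in>Pow E. (- 1) ^ card A * f A) =
    (\<Sum>A\<in>?P. (- 1) ^ card A * f A) + (\<Sum>A\<in>?P. - ((- 1) ^ card A * f (insert e A)))"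
    unfolding eq by (simp add: sum.union_disjoint)
  also have "\<dots> = (\<Sum>A\<in>?P. (- 1) ^ card A * (f A - f (insert e A)))"
    by (simp add: right_diff_distrib sum_subtractf sum_negf)
  finally show ?thesis .
qed

lemma sum_signs_Pow:
  assumes "finite E" "E \<noteq> {}"
  shows "(\<Sum>A\<in>Pow E. (- 1 :: int) ^ card A) = 0"
proof -
  obtain e where "e \<in> E" using assms by blast
  then show ?thesis using sum_Pow_split[of E e "\<lambda>_. 1"] assms by simp
qed

lemma rank_insert_loop:
  assumes "\<forall>B\<in>M. e \<notin> B"
  shows "rank_of M (insert e A) = rank_of M A"
proof -
  have "(\<lambda>B. card (B \<inter> insert e A)) ` M = (\<lambda>B. card (B \<inter> A)) ` M"
    using assms by (intro image_cong) auto
  then show ?thesis by (simp add: rank_of_def)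
qed

lemma rank_insert_coloop:
  assumes M: "matroid E M" and "\<forall>B\<in>M. e \<in> B" "e \<notin> A"
  shows "rank_of M (insert e A) = Suc (rank_of M A)"
proof -
  have c: "card (B \<inter> insert e A) = Suc (card (B \<inter> A))" if "B \<in> M" for B
    using that assms matroid_finite_basis[OF M that] by simp
  obtain B where B: "B \<in> M" "card (B \<inter> A) = rank_of M A" using rank_attained[OF M] .
  show ?thesis
    by (rule rank_eqI[OF M B(1)]) (use c B rank_ge[OF M] in auto)
qed

lemma beta_loop:
  assumes M: "matroid E M" and "e \<in> E" "\<forall>B\<in>M. e \<notin> B"
  shows "beta E M = 0"
  unfolding beta_def sum_Pow_split[OF matroid_finite[OF M] assms(2)] rank_insert_loop[OF assms(3)]
  by simp

text \<open>The paired ranks differ by a constant one, and the signs over the subsets of a nonempty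
  set cancel. For \<open>E = {e}\<close> there is nothing to cancel and the value is one, cf.
  \<open>beta_singleton\<close>.\<close>

lemma beta_coloop:
  assumes M: "matroid E M" and "e \<in> E" "E \<noteq> {e}" "\<forall>B\<in>M. e \<in> B"
  shows "beta E M = 0"
proof -
  have "(\<Sum>A\<in>Pow (E - {e}). (- 1) ^ card A * (int (rank_of M A) - int (rank_of M (insert e A))))
     = (\<Sum>A\<in>Pow (E - {e}). - ((- 1) ^ card A))"
  proof (rule sum.cong[OF refl])
    fix A assume "A \<in> Pow (E - {e})"
    then have "e \<notin> A" by auto
    then show "(- 1) ^ card A * (int (rank_of M A) - int (rank_of M (insert e A)))
        = - ((- 1) ^ card A)"
      using rank_insert_coloop[OF M assms(4)] by simp
  qed
  also have "\<dots> = 0"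
    using sum_signs_Pow[of "E - {e}"] matroid_finite[OF M] assms(2,3) by (auto simp: sum_negf)
  finally show ?thesis unfolding beta_def sum_Pow_split[OF matroid_finite[OF M] assms(2)] by simp
qed

text \<open>Pairing \<open>A\<close> with \<open>insert e A\<close> gives the difference of the two
  rank sums, up to a constant killed by the vanishing sum of signs. The contraction has rank one
  less, so its prefactor turns the minus into a plus.\<close>

lemma beta_deletion_contraction:
  assumes M: "matroid E M" and e: "e \<in> E" "E \<noteq> {e}"
    and B: "B0 \<in> M" "e \<notin> B0" "B1 \<in> M" "e \<in> B1"
  shows "beta E M = beta (E - {e}) (deletion M e) + beta (E - {e}) (contraction M e)"
proof -
  note md = matroid_deletion[OF M B(1,2)] and mc = matroid_contraction[OF M B(3,4)]
  let ?P = "Pow (E - {e})" and ?d = "rank_of (deletion M e)" and ?c = "rank_of (contraction M e)"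
  have 0: "(\<Sum>A\<in>?P. (- 1 :: int) ^ card A) = 0"
    using sum_signs_Pow[of "E - {e}"] matroid_finite[OF M] e by auto
  have "(\<Sum>A\<in>?P. (- 1) ^ card A * (int (rank_of M A) - int (rank_of M (insert e A))))
     = (\<Sum>A\<in>?P. (- 1) ^ card A * (int (?d A) - int (?c A) - 1))"
  proof (rule sum.cong[OF refl])
    fix A assume "A \<in> ?P"
    then have "e \<notin> A" by auto
    then show "(- 1) ^ card A * (int (rank_of M A) - int (rank_of M (insert e A))) =
      (- 1) ^ card A * (int (?d A) - int (?c A) - 1)"
      using rank_deletion[OF M B(1,2)] rank_contraction[OF M B(3,4)] by simp
  qed
  also have "\<dots> = (\<Sum>A\<in>?P. (- 1) ^ card A * int (?d A)) - (\<Sum>A\<in>?P. (- 1) ^ card A * int (?c A))"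
    using 0 by (simp add: right_diff_distrib sum_subtractf)
  finally have *: "(\<Sum>A\<in>Pow E. (- 1) ^ card A * int (rank_of M A)) = \<dots>"
    unfolding sum_Pow_split[OF matroid_finite[OF M] e(1)] .
  have "B0 \<in> deletion M e" using B by (simp add: deletion_def)
  then have rd: "?d (E - {e}) = rank_of M E"
    using rank_ground[OF md] rank_ground[OF M B(1)] by auto
  have "insert e (E - {e}) = E" using e by auto
  then have rc: "rank_of M E = Suc (?c (E - {e}))"
    using rank_contraction[OF M B(3,4), of "E - {e}"] by simp
  show ?thesis unfolding beta_def * rd unfolding rc by (simp add: right_diff_distrib)
qed

lemma rank_dual:
  assumes M: "matroid E M" and A: "A \<subseteq> E"
  shows "int (rank_of (dual_bases E M) A)
      = int (card A) + int (rank_of M (E - A)) - int (rank_of M E)"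
proof -
  note md = matroid_dual[OF M]
  have fin: "finite A" using A matroid_finite[OF M] finite_subset by blast
  have c: "int (card ((E - B) \<inter> A)) = int (card A) + int (card (B \<inter> (E - A))) - int (rank_of M E)"
    if "B \<in> M" for B
  proof -
    have BE: "B \<subseteq> E" "finite B" using matroid_sub[OF M that] matroid_finite_basis[OF M that] by auto
    have "card A = card (A \<inter> B) + card (A - B)" using fin by (simp add: card_Int_Diff)
    moreover have "card B = card (B \<inter> A) + card (B - A)" using BE by (simp add: card_Int_Diff)
    moreover have "(E - B) \<inter> A = A - B" "B \<inter> (E - A) = B - A" using A BE by auto
    ultimately show ?thesis using rank_ground[OF M that] by (simp add: Int_commute)
  qed
  obtain B where B: "B \<in> M" "card (B \<inter> (E - A)) = rank_of M (E - A)" using rank_attained[OF M] .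
  have "rank_of (dual_bases E M) A = card ((E - B) \<inter> A)"
  proof (rule rank_eqI[OF md])
    show "E - B \<in> dual_bases E M"
      using B matroid_sub[OF M B(1)] by (simp add: dual_bases_def double_diff)
    fix X assume "X \<in> dual_bases E M"
    then have X: "E - X \<in> M" "E - (E - X) = X" by (auto simp: dual_bases_def)
    show "card (X \<inter> A) \<le> card ((E - B) \<inter> A)"
      using c[OF X(1)] c[OF B(1)] rank_ge[OF M X(1), of "E - A"] B(2) unfolding X(2) by linarith
  qed simp
  then show ?thesis using c[OF B(1)] B(2) by simp
qed

text \<open>Complementing \<open>A\<close> turns the dual rank sum into the original one, up to
  terms in \<open>card A\<close> and a constant, whose alternating sums vanish once \<open>E\<close>
  has two elements. A loop and a coloop on a single element are dual with values zero and
  one.\<close>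

lemma beta_dual:
  assumes M: "matroid E M" and two: "2 \<le> card E"
  shows "beta E (dual_bases E M) = beta E M"
proof -
  have fin: "finite E" using matroid_finite[OF M] .
  have z1: "(\<Sum>A\<in>Pow E. (- 1 :: int) ^ card A) = 0" 
    by (rule sum_signs_Pow[OF fin]) (use two in auto)
  obtain e where e: "e \<in> E" using two by fastforce
  have "(\<Sum>A\<in>Pow E. (- 1) ^ card A * int (card A)) =
     (\<Sum>A\<in>Pow (E - {e}). (- 1) ^ card A * (int (card A) - int (card (insert e A))))"
    using sum_Pow_split[OF fin e, of "\<lambda>A. int (card A)"] .
  also have "\<dots> = (\<Sum>A\<in>Pow (E - {e}). - ((- 1) ^ card A))"
  proof (rule sum.cong[OF refl])
    fix A assume "A \<in> Pow (E - {e})"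
    then have "finite A" "e \<notin> A" using fin by (auto intro: finite_subset)
    then show "(- 1) ^ card A * (int (card A) - int (card (insert e A))) = - ((- 1) ^ card A)"
        by simp
  qed
  also have "\<dots> = 0"
  proof -
    have "E \<noteq> {e}" using two by auto
    then have "E - {e} \<noteq> {}" using e by auto
    then show ?thesis using sum_signs_Pow[of "E - {e}"] fin by (simp add: sum_negf)
  qed
  finally have z2: "(\<Sum>A\<in>Pow E. (- 1) ^ card A * int (card A)) = 0" .
  have "(\<Sum>A\<in>Pow E. (- 1) ^ card A * int (rank_of (dual_bases E M) A)) =
    (\<Sum>A\<in>Pow E. (- 1) ^ card A * int (card A) + (- 1) ^ card A * int (rank_of M (E - A))
       - (- 1) ^ card A * int (rank_of M E))"
    by (rule sum.cong) (auto simp: rank_dual[OF M] algebra_simps)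
  also have "\<dots> = (\<Sum>A\<in>Pow E. (- 1) ^ card A * int (rank_of M (E - A)))"
    using z1 z2 by (simp add: sum.distrib sum_subtractf flip: sum_distrib_right)
  also have "\<dots> = (\<Sum>A\<in>Pow E. (- 1) ^ card (E - A) * int (rank_of M A))"
    by (rule sum.reindex_bij_witness[of _ "\<lambda>A. E - A" "\<lambda>A. E - A"]) (auto simp: double_diff)
  also have "\<dots> = (\<Sum>A\<in>Pow E. (- 1) ^ card E * ((- 1) ^ card A * int (rank_of M A)))"
  proof (rule sum.cong[OF refl])
    fix A assume A: "A \<in> Pow E"
    then have "card (E - A) + card A = card E"
      using fin by (metis PowD card_Diff_subset card_mono finite_subset le_add_diff_inverse2)
    then have "(- 1 :: int) ^ card E * (- 1) ^ card A
        = (- 1) ^ card (E - A) * ((- 1) ^ card A * (- 1) ^ card A)"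
      by (metis mult.assoc power_add)
    then show "(- 1) ^ card (E - A) * int (rank_of M A)
        = (- 1) ^ card E * ((- 1) ^ card A * int (rank_of M A))"
      by (simp flip: power_mult_distrib mult.assoc)
  qed
  also have "\<dots> = (- 1) ^ card E * (\<Sum>A\<in>Pow E. (- 1) ^ card A * int (rank_of M A))"
    by (simp add: sum_distrib_left)
  finally have *: "(\<Sum>A\<in>Pow E. (- 1) ^ card A * int (rank_of (dual_bases E M) A)) = \<dots>" .
  obtain B where B: "B \<in> M" using matroid_nonempty[OF M] by blast
  have "rank_of M E = card B" "card B \<le> card E"
    using rank_ground[OF M B] card_mono[OF fin matroid_sub[OF M B]] by auto
  moreover have "rank_of M {} = 0" by (rule rank_eqI[OF M B]) auto
  ultimately have "rank_of (dual_bases E M) E + rank_of M E = card E"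
      using rank_dual[OF M, of E] by simp
  then have "(- 1 :: int) ^ rank_of (dual_bases E M) E * (- 1) ^ card E =
     ((- 1) ^ rank_of (dual_bases E M) E * (- 1) ^ rank_of (dual_bases E M) E) * (- 1) ^ rank_of M E"
    by (metis mult.assoc power_add)
  then show ?thesis unfolding beta_def * by (simp flip: power_mult_distrib mult.assoc)
qed

text \<open>Both sides obey the same recursion at the last element, and both vanish if that element
  is a loop, or a coloop that is not alone.\<close>

lemma card_beta_bases:
  assumes "matroid E M" "inj_on ord E" "E \<noteq> {}"
  shows "int (card (beta_bases E ord M)) = beta E M"
  using assms
proof (induction "card E" arbitrary: E M rule: less_induct)
  case less
  note M = less.prems(1)
  have fin: "finite E" using matroid_finite[OF M] .
  obtain e where e: "e \<in> E" "\<forall>x\<in>E - {e}. ord x < ord e"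
    using obtain_last[OF fin less.prems(3,2)] .
  have nc: "beta_bases E ord M = {}" if "\<not> connected_bases E M"
    using beta_bases_imp_connected[OF M less.prems(2)] that by blast
  show ?case
  proof (cases "\<exists>B1\<in>M. e \<in> B1")
    case False
    then have "beta_bases E ord M = {}" using e(1) by (auto simp: beta_bases_def)
    then show ?thesis using beta_loop[OF M e(1)] False by simp
  next
    case True
    then obtain B1 where B1: "B1 \<in> M" "e \<in> B1" by blast
    show ?thesis
    proof (cases "E = {e}")
      case True
      have "M = {{e}}"
      proof -
        have "M \<subseteq> Pow {e}" "{e} \<in> M" using M B1 True matroid_sub[OF M B1(1)]
            by (auto simp: matroid_def subset_singleton_iff)
        moreover have "{} \<notin> M" using matroid_card[OF M, of "{}" "{e}"] calculation by auto
        ultimately show ?thesis by (auto simp: Pow_insert)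
      qed
      moreover from this have "beta_bases E ord M = {{e}}" using True by (auto simp: beta_bases_def)
      moreover have "Pow E = {{}, {e}}" using True by auto
      ultimately show ?thesis using True by (simp add: beta_def rank_of_def)
    next
      case ne: False
      show ?thesis
      proof (cases "\<exists>B0\<in>M. e \<notin> B0")
        case False
        then have "\<not> connected_bases E M" using connected_no_loop(2)[OF M _ e(1) ne] by blast
        then show ?thesis using nc beta_coloop[OF M e(1) ne] False by simp
      next
        case True
        then obtain B0 where B0: "B0 \<in> M" "e \<notin> B0" by blast
        have IH: "int (card (beta_bases (E - {e}) ord M')) = beta (E - {e}) M'"
          if "matroid (E - {e}) M'" for M'
        proof (rule less.hyps)
          show "card (E - {e}) < card E" using e(1) fin by (rule card_Diff1_less[rotated])
          show "inj_on ord (E - {e})" using less.prems(2) by (auto simp: inj_on_def)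
          show "E - {e} \<noteq> {}" using ne e by auto
        qed (use that in auto)
        show ?thesis
          using card_beta_bases_last[OF M e B0 B1] beta_deletion_contraction[OF M e(1) ne B0 B1]
            IH[OF matroid_deletion[OF M B0]] IH[OF matroid_contraction[OF M B1]] by simp
      qed
    qed
  qed
qed

lemma obtain_ord:
  assumes "finite E"
  obtains ord :: "'a \<Rightarrow> nat" where "inj_on ord E"
  using finite_imp_inj_to_nat_seg[OF assms] by blast

text \<open>Two elements are required because a single loop counts as connected although its
  invariant is zero.\<close>

lemma beta_pos_iff_connected:
  assumes M: "matroid E M" and E: "2 \<le> card E"
  shows "0 < beta E M \<longleftrightarrow> connected_bases E M" "0 \<le> beta E M"
proof -
  have ne: "E \<noteq> {}" using E by auto
  obtain ord :: "'a \<Rightarrow> nat" where ord: "inj_on ord E" using obtain_ord[OF matroid_finite[OF M]] .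
  note c = card_beta_bases[OF M ord ne]
  show "0 \<le> beta E M" using c by linarith
  have "M \<noteq> {{}}" if "connected_bases E M"
  proof
    assume "M = {{}}"
    obtain e where "e \<in> E" using ne by blast
    moreover have "E \<noteq> {e}" using E by auto
    ultimately show False using connected_no_loop(1)[OF M that] \<open>M = {{}}\<close> by blast
  qed
  then have "connected_bases E M \<longleftrightarrow> beta_bases E ord M \<noteq> {}"
    using connected_imp_beta_bases[OF M ord _ ne] beta_bases_imp_connected[OF M ord] by blast
  also have "\<dots> \<longleftrightarrow> 0 < card (beta_bases E ord M)"
    using finite_beta_bases[OF M] by (simp add: card_gt_0_iff)
  finally show "0 < beta E M \<longleftrightarrow> connected_bases E M" using c by linarith
qed

section \<open>Matroids with beta invariant one\<close>

text \<open>A loop is thus parallel to everything, and in \<open>series_pair\<close> a coloop is in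
  series with everything. The witness bases \<open>F\<close> and \<open>G\<close> of later lemmas
  exclude these degenerate pairs.\<close>

definition parallel_pair :: "'a set set \<Rightarrow> 'a \<Rightarrow> 'a \<Rightarrow> bool" where
  "parallel_pair M f g \<longleftrightarrow> (\<forall>B\<in>M. \<not> (f \<in> B \<and> g \<in> B))"

definition series_pair :: "'a set set \<Rightarrow> 'a \<Rightarrow> 'a \<Rightarrow> bool" where
  "series_pair M f g \<longleftrightarrow> (\<forall>B\<in>M. f \<in> B \<or> g \<in> B)"

text \<open>The elements of \<open>B'\<close> in \<open>A\<close> but not in \<open>B\<close> are
  traded one by one for elements of \<open>B\<close>. Constancy of the trace forces each replacement
  into \<open>A\<close>, so the part outside \<open>A\<close> never moves.\<close>

lemma separator_product:
  assumes M: "matroid E M" and const: "\<forall>I\<in>M. \<forall>K\<in>M. card (I \<inter> A) = card (K \<inter> A)"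
    and "B \<in> M" "B' \<in> M"
  shows "(B \<inter> A) \<union> (B' - A) \<in> M"
  using assms(4)
proof (induction "card (B \<inter> A - B')" arbitrary: B' rule: less_induct)
  case less
  note B = assms(3) and B' = less.prems
  have fin: "finite B" "finite B'"
      using matroid_finite_basis[OF M B] matroid_finite_basis[OF M B'] by auto
  have ceq: "card (B \<inter> A) = card (B' \<inter> A)" using const B B' by blast
  show ?case
  proof (cases "B' \<inter> A \<subseteq> B")
    case True
    then have "B' \<inter> A = B \<inter> A" using fin ceq by (intro card_subset_eq) auto
    then have "(B \<inter> A) \<union> (B' - A) = B'" by auto
    then show ?thesis using B' by simp
  next
    case False
    then obtain i where i: "i \<in> B'" "i \<in> A" "i \<notin> B" by blast
    obtain k where k: "k \<in> B" "k \<notin> B'" "insert k (B' - {i}) \<in> M"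
      using matroid_exchange[OF M B' B i(1,3)] by metis
    have "card (insert k (B' - {i}) \<inter> A) = card (B' \<inter> A)" using const B' k(3) by blast
    then have kA: "k \<in> A" using card_Int_exchange_eq[OF fin(2) i(1) k(2)] i(2) by blast
    have "B \<inter> A - insert k (B' - {i}) \<subset> B \<inter> A - B'" using i k kA by auto
    then have "card (B \<inter> A - insert k (B' - {i})) < card (B \<inter> A - B')"
      using fin by (intro psubset_card_mono) auto
    then have "(B \<inter> A) \<union> (insert k (B' - {i}) - A) \<in> M" using less.hyps k(3) by blast
    moreover have "insert k (B' - {i}) - A = B' - A" using kA i by auto
    ultimately show ?thesis by simp
  qed
qed

text \<open>If \<open>A\<close> separates \<open>M / e\<close>, then \<open>M\<close> is the parallel connection along \<open>e\<close> of its
  restrictions to \<open>A \<union> {e}\<close> and to the complement of \<open>A\<close>. The set \<open>M1\<close> below consists of the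
  bases of the first restriction; ordering \<open>e\<close> first shows that it has one beta basis as well.\<close>

lemma series_or_parallel_pair_contraction:
  assumes M: "matroid E M" and b: "beta E M = 1" and e: "e \<in> E"
    and A: "A \<subset> E - {e}" "2 \<le> card A"
    and sep: "\<forall>I\<in>contraction M e. \<forall>K\<in>contraction M e. card (I \<inter> A) = card (K \<inter> A)"
    and IH: "\<And>E' M'. card E' < card E \<Longrightarrow> matroid E' M' \<Longrightarrow> beta E' M' = 1 \<Longrightarrow> 3 \<le> card E'
       \<Longrightarrow> e \<in> E' \<Longrightarrow> \<exists>f\<in>E' - {e}. \<exists>g\<in>E' - {e}. f \<noteq> g \<and> (parallel_pair M' f g \<or> series_pair M' f g)"
  shows "\<exists>f\<in>E - {e}. \<exists>g\<in>E - {e}. f \<noteq> g \<and> (parallel_pair M f g \<or> series_pair M f g)"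
proof -
  have finE: "finite E" using matroid_finite[OF M] .
  have finM: "finite B" if "B \<in> M" for B using matroid_finite_basis[OF M that] .
  obtain ord0 :: "'a \<Rightarrow> nat" where ord0: "inj_on ord0 E" using obtain_ord[OF finE] .
  \<comment> \<open>With \<open>e\<close> first, every beta basis contains \<open>e\<close>, so its
    exchanges not moving \<open>e\<close> are exchanges in \<open>M / e\<close> and respect the
    separator.\<close>
  define ord where "ord x = (if x = e then 0 else Suc (ord0 x))" for x
  have ord: "inj_on ord E" using ord0 by (auto simp: inj_on_def ord_def)
  have ord_e: "ord e = 0" by (simp add: ord_def)
  have "int (card (beta_bases E ord M)) = 1" using card_beta_bases[OF M ord] e b by auto
  then have "card (beta_bases E ord M) = 1" by linarith
  then obtain B0 where B0: "beta_bases E ord M = {B0}" by (auto simp: card_1_singleton_iff)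
  then have B0b: "B0 \<in> beta_bases E ord M" by simp
  note D0 = beta_basesD[OF B0b]
  have B0M: "B0 \<in> M" using D0(1) .
  have eB0: "e \<in> B0" using D0(2)[OF e] ord_e by auto
  define F where "F = insert e A"
  \<comment> \<open>The part of the unique beta basis outside \<open>F\<close> serves as a fixed
    completion, turning bases on \<open>F\<close> into bases of \<open>M\<close>.\<close>
  define C0 where "C0 = B0 - F"
  have eA: "e \<notin> A" and AE: "A \<subseteq> E" using A by auto
  have FE: "F \<subseteq> E" using AE e by (simp add: F_def)
  have CF: "C0 \<inter> F = {}" by (auto simp: C0_def)
  have const: "card (I \<inter> A) = card (K \<inter> A)" if "I \<in> M" "K \<in> M" "e \<in> I" "e \<in> K" for I K
  proof -
    have "I - {e} \<in> contraction M e" "K - {e} \<in> contraction M e"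
      using that by (auto simp: contraction_def insert_absorb)
    then have "card ((I - {e}) \<inter> A) = card ((K - {e}) \<inter> A)" using sep by blast
    moreover have "(I - {e}) \<inter> A = I \<inter> A" "(K - {e}) \<inter> A = K \<inter> A" using eA by auto
    ultimately show ?thesis by simp
  qed
  have prod: "(I \<inter> A) \<union> (K - A) \<in> M" if "I \<in> M" "K \<in> M" "e \<in> I" "e \<in> K" for I K
  proof -
    have "I - {e} \<in> contraction M e" "K - {e} \<in> contraction M e"
      using that by (auto simp: contraction_def insert_absorb)
    then have "(I - {e}) \<inter> A \<union> (K - {e} - A) \<in> contraction M e"
      by (rule separator_product[OF matroid_contraction[OF M B0M eB0] sep])
    moreover have "insert e ((I - {e}) \<inter> A \<union> (K - {e} - A)) = (I \<inter> A) \<union> (K - A)"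
      using that eA by auto
    ultimately show ?thesis by (simp add: contraction_def)
  qed
  have prodF: "(I \<inter> F) \<union> C0 \<in> M" if "I \<in> M" "e \<in> I" for I
  proof -
    have "(I \<inter> A) \<union> (B0 - A) = (I \<inter> F) \<union> C0" using that eB0 eA by (auto simp: F_def C0_def)
    then show ?thesis using prod[OF that(1) B0M that(2) eB0] by simp
  qed
  have exch: "i \<in> A \<longleftrightarrow> j \<in> A"
      if "B \<in> M" "e \<in> B" "i \<in> B" "i \<noteq> e" "j \<notin> B" "insert j (B - {i}) \<in> M" for B i j
    using card_Int_exchange_eq[OF finM[OF that(1)] that(3,5), of A] const[OF that(6,1)] that(2,4) by simp
  define M1 where "M1 = {X. X \<subseteq> F \<and> X \<union> C0 \<in> M}"
  define X0 where "X0 = B0 \<inter> F"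
  have X0C: "X0 \<union> C0 = B0" by (auto simp: X0_def C0_def)
  have "X0 \<subseteq> F" by (simp add: X0_def)
  then have X0M: "X0 \<in> M1" using X0C B0M unfolding M1_def by simp
  have "e \<in> X0" using eB0 by (simp add: X0_def F_def)
  note X0 = X0C X0M this
  have M1: "matroid F M1"
    unfolding matroid_def
  proof (intro conjI ballI)
    show "finite F" using FE finE finite_subset by blast
    show "M1 \<noteq> {}" using X0 by blast
    show "M1 \<subseteq> Pow F" by (auto simp: M1_def)
    fix I K assume IK: "I \<in> M1" "K \<in> M1"
    then have *: "I \<subseteq> F" "K \<subseteq> F" "I \<union> C0 \<in> M" "K \<union> C0 \<in> M" by (auto simp: M1_def)
    have "card (I \<union> C0) = card I + card C0" "card (K \<union> C0) = card K + card C0"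
      using * CF finM[OF *(3)] finM[OF *(4)] by (auto intro!: card_Un_disjoint)
    then show "card I = card K" using matroid_card[OF M *(3,4)] by simp
    fix i assume i: "i \<in> I - K"
    then have "i \<in> I \<union> C0" "i \<notin> K \<union> C0" using * CF by auto
    then obtain k where k: "k \<in> K \<union> C0" "k \<notin> I \<union> C0" "insert k (I \<union> C0 - {i}) \<in> M"
        "insert i (K \<union> C0 - {k}) \<in> M"
      using matroid_exchange[OF M *(3,4)] by metis
    moreover have "insert k (I \<union> C0 - {i}) = insert k (I - {i}) \<union> C0" "insert i (K \<union> C0 - {k})
        = insert i (K - {k}) \<union> C0"
      using k \<open>i \<notin> K \<union> C0\<close> by auto
    ultimately show "\<exists>k\<in>K - I. insert k (I - {i}) \<in> M1 \<and> insert i (K - {k}) \<in> M1"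
      using * i by (intro bexI[of _ k]) (auto simp: M1_def)
  qed
  have "beta_bases F ord M1 = {X0}"
  proof (intro equalityI subsetI)
    fix X assume "X \<in> {X0}"
    moreover have "X0 \<in> beta_bases F ord M1"
    proof (rule beta_basesI)
      show "X0 \<in> M1" by (rule X0)
    next
      fix j assume j: "j \<in> F" "j \<notin> X0"
      then have jA: "j \<in> A" "j \<notin> B0" "j \<in> E" using X0 AE by (auto simp: F_def X0_def)
      then obtain i where i: "i \<in> B0" "ord i < ord j" "insert j (B0 - {i}) \<in> M"
          using D0(2)[of j] by blast
      then have "i \<in> F" using exch[OF B0M eB0 i(1) _ jA(2) i(3)] jA by (auto simp: F_def)
      moreover from this have "insert j (X0 - {i}) \<union> C0 = insert j (B0 - {i})" using X0 CF by auto
      ultimately show "\<exists>i\<in>X0. ord i < ord j \<and> insert j (X0 - {i}) \<in> M1"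
        using i j by (intro bexI[of _ i]) (auto simp: M1_def X0_def)
    next
      fix i k assume ik: "i \<in> X0" "k \<in> F" "ord k < ord i"
      then have iA: "i \<in> A" "i \<noteq> e" "i \<in> B0" "i \<in> F" using ord_e by (auto simp: X0_def F_def)
      obtain j where j: "j \<in> E - B0" "ord j < ord i" "insert j (B0 - {i}) \<in> M"
        using D0(3)[OF iA(3) _ ik(3)] ik(2) FE by blast
      then have "j \<in> F" using exch[OF B0M eB0 iA(3,2) _ j(3)] iA by (auto simp: F_def)
      moreover have "insert j (X0 - {i}) \<union> C0 = insert j (B0 - {i})" using X0 CF iA by auto
      ultimately show "\<exists>j\<in>F - X0. ord j < ord i \<and> insert j (X0 - {i}) \<in> M1"
        using j by (intro bexI[of _ j]) (auto simp: M1_def X0_def)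
    qed
    ultimately show "X \<in> beta_bases F ord M1" by simp
  next
    \<comment> \<open>Uniqueness passes from \<open>M\<close> to \<open>M1\<close>: completed by
      \<open>C0\<close>, a beta basis of \<open>M1\<close> becomes one of \<open>M\<close>, hence
      equals \<open>B0\<close>.\<close>
    fix X assume X: "X \<in> beta_bases F ord M1"
    note D = beta_basesD[OF X]
    let ?B = "X \<union> C0"
    have XF: "X \<subseteq> F" and BM: "?B \<in> M" using D(1) by (auto simp: M1_def)
    have eX: "e \<in> X" using D(2)[of e] ord_e by (auto simp: F_def)
    have "?B \<in> beta_bases E ord M"
    proof (rule beta_basesI)
      show "?B \<in> M" by (rule BM)
    next
      fix j assume j: "j \<in> E" "j \<notin> ?B"
      show "\<exists>i\<in>?B. ord i < ord j \<and> insert j (?B - {i}) \<in> M"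
      proof (cases "j \<in> F")
        case True
        then obtain i where i: "i \<in> X" "ord i < ord j" "insert j (X - {i}) \<union> C0 \<in> M"
          using D(2)[of j] j by (auto simp: M1_def)
        moreover have "insert j (X - {i}) \<union> C0 = insert j (?B - {i})" using i XF CF by auto
        ultimately show ?thesis by auto
      next
        case False
        then have jn: "j \<notin> A" "j \<noteq> e" "j \<notin> B0" using j by (auto simp: F_def C0_def)
        then obtain i where i: "i \<in> B0" "ord i < ord j" "insert j (B0 - {i}) \<in> M"
          using D0(2)[of j] j by blast
        let ?K = "insert j (B0 - {i})"
        show ?thesis
        proof (cases "i = e")
          case False
          then have "i \<notin> A" using exch[OF B0M eB0 i(1) _ jn(3) i(3)] jn by simp
          then have iC: "i \<in> C0" "i \<notin> F" using i False by (auto simp: C0_def F_def)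
          have "(?B \<inter> A) \<union> (?K - A) \<in> M" using prod[OF BM i(3)] eX eB0 False by auto
          moreover have "(?B \<inter> A) \<union> (?K - A) = insert j (?B - {i})"
            using XF iC jn eX eB0 by (auto simp: C0_def F_def)
          ultimately show ?thesis using i iC by auto
        next
          case True
          have "e \<notin> ?K" using jn True by auto
          then obtain k where k: "k \<in> ?K" "k \<notin> ?B" "insert k (?B - {e}) \<in> M"
              "insert e (?K - {k}) \<in> M"
            using matroid_exchange[OF M BM i(3)] eX by (metis UnI1)
          have "k = j"
          proof (rule ccontr)
            assume "k \<noteq> j"
            then have kB: "k \<in> B0" "k \<noteq> e" "k \<in> A" using k True by (auto simp: C0_def F_def)
            have "insert e (?K - {k}) = insert j (B0 - {k})" using True \<open>k \<noteq> j\<close> kB eB0 by auto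
            then show False using exch[OF B0M eB0 kB(1,2) jn(3)] k(4) jn kB by simp
          qed
          then show ?thesis using k i True eX by auto
        qed
      qed
    next
      fix i k assume ik: "i \<in> ?B" "k \<in> E" "ord k < ord i"
      then have ie: "i \<noteq> e" "ord e < ord i" using ord_e by auto
      show "\<exists>j\<in>E - ?B. ord j < ord i \<and> insert j (?B - {i}) \<in> M"
      proof (cases "i \<in> X")
        case True
        then obtain j where j: "j \<in> F - X" "ord j < ord i" "insert j (X - {i}) \<union> C0 \<in> M"
          using D(3)[OF True _ ie(2)] by (auto simp: M1_def F_def)
        moreover have "insert j (X - {i}) \<union> C0 = insert j (?B - {i})" using True XF CF by auto
        ultimately show ?thesis using FE CF by auto
      next
        case False
        then have iC: "i \<in> C0" "i \<in> B0" "i \<notin> A" "i \<notin> F" using ik by (auto simp: C0_def F_def)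
        obtain j where j: "j \<in> E - B0" "ord j < ord i" "insert j (B0 - {i}) \<in> M"
          using D0(3)[OF iC(2) e ie(2)] by blast
        let ?K = "insert j (B0 - {i})"
        have jn: "j \<notin> A" "j \<noteq> e" using exch[OF B0M eB0 iC(2) ie(1) _ j(3)] j iC eB0 by auto
        have "(?B \<inter> A) \<union> (?K - A) \<in> M" using prod[OF BM j(3)] eX eB0 ie by auto
        moreover have "(?B \<inter> A) \<union> (?K - A) = insert j (?B - {i})"
          using XF iC jn eX eB0 by (auto simp: C0_def F_def)
        moreover have "j \<notin> ?B" using j jn XF by (auto simp: C0_def F_def)
        ultimately show ?thesis using j by auto
      qed
    qed
    then have "?B = B0" using B0 by simp
    then have "X = X0" using XF CF by (auto simp: X0_def)
    then show "X \<in> {X0}" by simp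
  qed
  moreover have ordF: "inj_on ord F" using ord FE inj_on_subset by blast
  ultimately have "beta F M1 = 1" using card_beta_bases[OF M1 ordF] by (auto simp: F_def)
  moreover have "card F < card E"
    using finE A(1) e by (intro psubset_card_mono) (auto simp: F_def)
  moreover have "3 \<le> card F" using A(2) eA finite_subset[OF AE finE] by (simp add: F_def)
  ultimately obtain f g where fg: "f \<in> A" "g \<in> A" "f \<noteq> g"
      and pair: "parallel_pair M1 f g \<or> series_pair M1 f g"
    using IH[OF _ M1] by (auto simp: F_def)
  have fge: "f \<noteq> e" "g \<noteq> e" using fg eA by auto
  from pair have "parallel_pair M f g \<or> series_pair M f g"
  proof
    assume p: "series_pair M1 f g"
    have "f \<in> B \<or> g \<in> B" if B: "B \<in> M" for B
    proof (rule ccontr)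
      assume n: "\<not> (f \<in> B \<or> g \<in> B)"
      obtain B' where B': "B' \<in> M" "e \<in> B'" "f \<notin> B'" "g \<notin> B'"
      proof (cases "e \<in> B")
        case False
        obtain k where "insert e (B - {k}) \<in> M"
          using matroid_exchange[OF M B0M B eB0 False] by metis
        then show ?thesis using that[of "insert e (B - {k})"] n fge by auto
      qed (use B n that in auto)
      then have "B' \<inter> F \<in> M1" using prodF[OF B'(1,2)] by (auto simp: M1_def)
      then show False using p B' unfolding series_pair_def by blast
    qed
    then show ?thesis by (auto simp: series_pair_def)
  next
    assume p: "parallel_pair M1 f g"
    have "\<not> (f \<in> B \<and> g \<in> B)" if B: "B \<in> M" for B
    proof
      assume n: "f \<in> B \<and> g \<in> B"
      \<comment> \<open>The trace of \<open>B\<close> on \<open>F\<close> need not belong to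
        \<open>M1\<close>. Optimality on the nested sets \<open>{f, g}\<close> and \<open>F\<close>
        keeps both elements and makes the trace of \<open>B'\<close> completable by
        \<open>C0\<close>.\<close>
      obtain B' where B': "B' \<in> M" "card (B' \<inter> {f, g}) = rank_of M {f, g}" "card (B' \<inter> F)
          = rank_of M F"
        using rank_nested_attained[OF M, of "{f, g}" F] fg by (auto simp: F_def)
      have "B \<inter> {f, g} = {f, g}" using n by auto
      then have "2 \<le> card (B' \<inter> {f, g})" using rank_ge[OF M B, of "{f, g}"] B'(2) fg(3) by simp
      then have "B' \<inter> {f, g} = {f, g}" using fg(3) by (intro card_seteq) auto
      then have fgB': "f \<in> B'" "g \<in> B'" by auto
      have "(B' \<inter> F) \<union> C0 \<in> M"
      proof (cases "e \<in> B'")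
        case True
        then show ?thesis using prodF B' by blast
      next
        case False
        have "B0 \<inter> F = insert e (B0 \<inter> A)" using eB0 by (auto simp: F_def)
        then have "card (B0 \<inter> F) = Suc (card (B0 \<inter> A))" using eA finM[OF B0M] by simp
        moreover have "B' \<inter> F = B' \<inter> A" using False by (auto simp: F_def)
        ultimately have lt: "card (B0 \<inter> A) < card (B' \<inter> A)"
          using rank_ge[OF M B0M, of F] B'(3) by simp
        \<comment> \<open>All bases through \<open>e\<close> have the trace size of
          \<open>B0\<close> on \<open>A\<close>, and \<open>B'\<close> exceeds it; so
          \<open>e\<close> can enter only in place of an element of \<open>A\<close>.\<close>
        have inA: "l \<in> A" if l: "l \<in> B'" "insert e (B' - {l}) \<in> M" for l
        proof (rule ccontr)
          assume "l \<notin> A"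
          then have "insert e (B' - {l}) \<inter> A = B' \<inter> A" using eA by auto
          then show False using const[OF l(2) B0M _ eB0] lt by simp
        qed
        obtain k where k: "k \<in> B'" "insert e (B' - {k}) \<in> M"
          using matroid_exchange[OF M B0M B'(1) eB0 False] by metis
        let ?B2 = "(insert e (B' - {k}) \<inter> F) \<union> C0"
        have B2: "?B2 \<in> M" "e \<in> ?B2" using prodF[OF k(2)] by (auto simp: F_def)
        obtain l where l: "l \<in> B'" "l \<notin> ?B2" "insert l (?B2 - {e}) \<in> M" "insert e (B' - {l}) \<in> M"
          using matroid_exchange[OF M B2(1) B'(1) B2(2) False] by metis
        \<comment> \<open>Among the elements of \<open>B'\<close> in \<open>A\<close>, only
          \<open>k\<close> is missing from \<open>?B2\<close>. Hence the exchange undoes the entry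
          of \<open>e\<close> while keeping the completion \<open>C0\<close>.\<close>
        have "l = k" using inA[OF l(1,4)] l(1,2) by (auto simp: F_def)
        moreover have "insert k (?B2 - {e}) = (B' \<inter> F) \<union> C0"
          using inA[OF k] k False eB0 by (auto simp: F_def C0_def)
        ultimately show ?thesis using l(3) by simp
      qed
      then have "B' \<inter> F \<in> M1" by (auto simp: M1_def)
      with p[unfolded parallel_pair_def] have "\<not> (f \<in> B' \<inter> F \<and> g \<in> B' \<inter> F)" by (rule bspec)
      then show False using fgB' fg(1,2) by (simp add: F_def)
    qed
    then show ?thesis by (auto simp: parallel_pair_def)
  qed
  then show ?thesis using fg fge AE by blast
qed

lemma parallel_pair_dual:
  assumes M: "matroid E M" and "f \<in> E" "g \<in> E"
  shows "parallel_pair (dual_bases E M) f g \<longleftrightarrow> series_pair M f g"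
    and "series_pair (dual_bases E M) f g \<longleftrightarrow> parallel_pair M f g"
proof -
  have "E - B \<in> dual_bases E M" if "B \<in> M" for B
    using that matroid_sub[OF M that] by (simp add: dual_bases_def double_diff)
  then have dual: "dual_bases E M = (\<lambda>B. E - B) ` M"
    by (auto simp: dual_bases_def image_iff double_diff intro!: bexI[of _ "E - _"])
  show "parallel_pair (dual_bases E M) f g \<longleftrightarrow> series_pair M f g"
    "series_pair (dual_bases E M) f g \<longleftrightarrow> parallel_pair M f g"
    using assms(2,3) by (auto simp: dual parallel_pair_def series_pair_def)
qed

text \<open>Dual contraction is deletion followed by complementation, which replaces each trace on
  \<open>A\<close> by its difference from \<open>card A\<close>.\<close>

lemma contraction_dual_disconnected:
  assumes M: "matroid E M" and e: "e \<in> E" and nc: "\<not> connected_bases (E - {e}) (deletion M e)"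
  shows "\<not> connected_bases (E - {e}) (contraction (dual_bases E M) e)"
proof
  assume c: "connected_bases (E - {e}) (contraction (dual_bases E M) e)"
  obtain A where A: "A \<noteq> {}" "A \<subset> E - {e}"
    and const: "\<forall>I\<in>deletion M e. \<forall>K\<in>deletion M e. card (I \<inter> A) = card (K \<inter> A)"
    using disconnectedE[OF nc] .
  obtain I K where IK: "I \<in> contraction (dual_bases E M) e" "K \<in> contraction (dual_bases E M) e"
    "card (I \<inter> A) \<noteq> card (K \<inter> A)"
    using c[unfolded connected_bases_def, rule_format, OF A] by blast
  have fin: "finite A" using A matroid_finite[OF M]
      by (meson finite_Diff finite_subset psubset_imp_subset)
  have *: "E - insert e J \<in> deletion M e" "card (J \<inter> A) = card A - card ((E - insert e J) \<inter> A)"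
    if J: "J \<in> contraction (dual_bases E M) e" for J
  proof -
    show "E - insert e J \<in> deletion M e" using J
        by (auto simp: contraction_def dual_bases_def deletion_def)
    have "(E - insert e J) \<inter> A = A - J \<inter> A" using A by auto
    then have "card ((E - insert e J) \<inter> A) = card A - card (J \<inter> A)"
      using fin by (simp add: card_Diff_subset)
    moreover have "card (J \<inter> A) \<le> card A" using fin by (simp add: card_mono)
    ultimately show "card (J \<inter> A) = card A - card ((E - insert e J) \<inter> A)" by simp
  qed
  show False using IK(3) *[OF IK(1)] *[OF IK(2)] const by metis
qed

lemma series_or_parallel_pair:
  assumes "matroid E M" "beta E M = 1" "3 \<le> card E" "e \<in> E"
  shows "\<exists>f\<in>E - {e}. \<exists>g\<in>E - {e}. f \<noteq> g \<and> (parallel_pair M f g \<or> series_pair M f g)"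
  using assms
proof (induction "card E" arbitrary: E M rule: less_induct)
  case less
  note M = less.prems(1) and b = less.prems(2) and e = less.prems(4)
  have fin: "finite E" using matroid_finite[OF M] .
  have cE: "card (E - {e}) = card E - 1" using e by simp
  show ?case
  proof (cases "card E = 3")
    case True
    then have "card (E - {e}) = 2" using cE by simp
    then obtain f g where fg: "E - {e} = {f, g}" "f \<noteq> g" by (auto simp: card_2_iff)
    have "parallel_pair M f g \<or> series_pair M f g"
    proof (rule ccontr)
      assume "\<not> ?thesis"
      then obtain B B' where B: "B \<in> M" "f \<in> B" "g \<in> B" and B': "B' \<in> M" "f \<notin> B'" "g \<notin> B'"
        by (auto simp: parallel_pair_def series_pair_def)
      have "card {f, g} \<le> card B" using B matroid_finite_basis[OF M B(1)] by (intro card_mono) auto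
      moreover have "B' \<subseteq> {e}" using matroid_sub[OF M B'(1)] fg B' by auto
      then have "card B' \<le> 1" using card_mono[of "{e}" B'] by simp
      ultimately show False using matroid_card[OF M B(1) B'(1)] fg(2) by simp
    qed
    then show ?thesis using fg by blast
  next
    case False
    then have c4: "4 \<le> card E" using less.prems(3) by simp
    have ne: "E \<noteq> {e}" using c4 by auto
    have main: "\<exists>f\<in>E - {e}. \<exists>g\<in>E - {e}. f \<noteq> g \<and> (parallel_pair M' f g \<or> series_pair M' f g)"
      if M': "matroid E M'" "beta E M' = 1"
          and nc: "\<not> connected_bases (E - {e}) (contraction M' e)" for M'
    proof -
      have conn: "connected_bases E M'" using beta_pos_iff_connected(1)[OF M'(1)] M'(2) c4 by simp
      obtain B1 where B1: "B1 \<in> M'" "e \<in> B1" using connected_no_loop(1)[OF M'(1) conn e ne] by blast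
      note mc = matroid_contraction[OF M'(1) B1]
      obtain A where A: "A \<noteq> {}" "A \<subset> E - {e}"
        and const: "\<forall>I\<in>contraction M' e. \<forall>K\<in>contraction M' e. card (I \<inter> A) = card (K \<inter> A)"
        using disconnectedE[OF nc] .
      have IH: "\<exists>f\<in>E' - {e}. \<exists>g\<in>E' - {e}. f \<noteq> g \<and> (parallel_pair M'' f g \<or> series_pair M'' f g)"
        if "card E' < card E" "matroid E' M''" "beta E' M'' = 1" "3 \<le> card E'" "e \<in> E'" for E' M''
        using less.hyps[OF that] .
      \<comment> \<open>At least three elements remain, so one side of the separator has two of
        them, as \<open>series_or_parallel_pair_contraction\<close> demands; the complement of a
        separator is again a separator.\<close>
      have "card A + card (E - {e} - A) = card (E - {e})"
        using A fin by (metis card_Diff_subset card_mono finite_Diff finite_subset le_add_diff_inverse psubsetE)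
      then consider "2 \<le> card A" | "2 \<le> card (E - {e} - A)" using c4 cE by linarith
      then show ?thesis
      proof cases
        case 1
        show ?thesis by (rule series_or_parallel_pair_contraction[OF M' e A(2) 1 const IH])
      next
        case 2
        have split: "card (I \<inter> A) + card (I \<inter> (E - {e} - A)) = card I"
            if "I \<in> contraction M' e" for I
        proof -
          have "I \<inter> (E - {e} - A) = I - A" using matroid_sub[OF mc that] by auto
          then show ?thesis using card_Int_Diff[OF matroid_finite_basis[OF mc that], of A] by simp
        qed
        have const2: "\<forall>I\<in>contraction M' e. \<forall>K\<in>contraction M' e. card (I \<inter> (E - {e} - A))
            = card (K \<inter> (E - {e} - A))"
        proof (intro ballI)
          fix I K assume IK: "I \<in> contraction M' e" "K \<in> contraction M' e"
          have "card (I \<inter> A) = card (K \<inter> A)" using const IK by blast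
          then show "card (I \<inter> (E - {e} - A)) = card (K \<inter> (E - {e} - A))"
            using split[OF IK(1)] split[OF IK(2)] matroid_card[OF mc IK] by linarith
        qed
        have "E - {e} - A \<subset> E - {e}" using A by auto
        then show ?thesis by (rule series_or_parallel_pair_contraction[OF M' e _ 2 const2 IH])
      qed
    qed
    show ?thesis
    proof (cases "connected_bases (E - {e}) (contraction M e)")
      case False
      then show ?thesis using main[OF M b] by blast
    next
      case True
      have conn: "connected_bases E M" using beta_pos_iff_connected(1)[OF M] b c4 by simp
      obtain B1 B0 where B1: "B1 \<in> M" "e \<in> B1" and B0: "B0 \<in> M" "e \<notin> B0"
        using connected_no_loop[OF M conn e ne] by blast
      have two: "2 \<le> card (E - {e})" using cE c4 by simp
      have "beta E M = beta (E - {e}) (deletion M e) + beta (E - {e}) (contraction M e)"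
        by (rule beta_deletion_contraction[OF M e ne B0 B1])
      moreover have "0 < beta (E - {e}) (contraction M e)"
        using beta_pos_iff_connected(1)[OF matroid_contraction[OF M B1] two] True by simp
      ultimately have "\<not> 0 < beta (E - {e}) (deletion M e)" using b by linarith
      then have "\<not> connected_bases (E - {e}) (deletion M e)"
        using beta_pos_iff_connected(1)[OF matroid_deletion[OF M B0] two] by simp
      then have "\<not> connected_bases (E - {e}) (contraction (dual_bases E M) e)"
        by (rule contraction_dual_disconnected[OF M e])
      moreover have "beta E (dual_bases E M) = 1" using beta_dual[OF M] b c4 by simp
      ultimately obtain f g where fg: "f \<in> E - {e}" "g \<in> E - {e}" "f \<noteq> g"
        "parallel_pair (dual_bases E M) f g \<or> series_pair (dual_bases E M) f g"
        using main[OF matroid_dual[OF M]] by blast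
      then show ?thesis using parallel_pair_dual[OF M, of f g] by blast
    qed
  qed
qed

section \<open>Undoing series and parallel extensions on the level of bases\<close>

definition parallel_extension_bases :: "'a set set \<Rightarrow> 'a \<Rightarrow> 'a \<Rightarrow> 'a set set" where
  "parallel_extension_bases M f e = M \<union> {insert e (B - {f}) | B. B \<in> M \<and> f \<in> B}"

text \<open>Complementation in the ground set enlarged by a new \<open>e\<close> interchanges this
  with the parallel construction for the dual matroid.\<close>

definition series_extension_bases :: "'a set set \<Rightarrow> 'a \<Rightarrow> 'a \<Rightarrow> 'a set set" where
  "series_extension_bases M f e = {insert e B | B. B \<in> M} \<union> {insert f B | B. B \<in> M \<and> f \<notin> B}"

text \<open>No basis contains both elements, so bringing one into a basis that holds the other must
  expel that other: the two are interchangeable.\<close>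

lemma parallel_pair_decomposition:
  assumes M: "matroid E M" and p: "parallel_pair M f g" and "f \<noteq> g"
    and F: "F \<in> M" "f \<in> F" and G: "G \<in> M" "g \<in> G"
  shows "M = parallel_extension_bases (deletion M g) f g"
proof -
  have swap: "insert y (B - {x}) \<in> M"
    if B: "B \<in> M" "x \<in> B" "y \<notin> B" and Y: "Y \<in> M" "y \<in> Y" and pp: "\<forall>B\<in>M. \<not> (x \<in> B \<and> y \<in> B)"
        for B x y Y
  proof -
    obtain k where k: "k \<in> B" "insert y (B - {k}) \<in> M"
      using matroid_exchange[OF M Y(1) B(1) Y(2) B(3)] by metis
    have "\<not> (x \<in> insert y (B - {k}) \<and> y \<in> insert y (B - {k}))" using pp k(2) by (rule bspec)
    then have "k = x" using B(2) by blast
    then show ?thesis using k by simp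
  qed
  have pp: "\<forall>B\<in>M. \<not> (f \<in> B \<and> g \<in> B)" "\<forall>B\<in>M. \<not> (g \<in> B \<and> f \<in> B)"
    using p by (auto simp: parallel_pair_def)
  show ?thesis
  proof (intro set_eqI iffI)
    fix B assume B: "B \<in> M"
    show "B \<in> parallel_extension_bases (deletion M g) f g"
    proof (cases "g \<in> B")
      case False
      then show ?thesis using B by (simp add: parallel_extension_bases_def deletion_def)
    next
      case True
      then have fB: "f \<notin> B" using pp B by blast
      have "insert f (B - {g}) \<in> deletion M g"
        using swap[OF B True fB F pp(2)] assms(3) by (simp add: deletion_def)
      moreover have "B = insert g (insert f (B - {g}) - {f})" using True fB by auto
      ultimately show ?thesis unfolding parallel_extension_bases_def by blast
    qed
  next
    fix B assume "B \<in> parallel_extension_bases (deletion M g) f g"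
    then consider "B \<in> M" | B' where "B' \<in> M" "g \<notin> B'" "f \<in> B'" "B = insert g (B' - {f})"
      by (auto simp: parallel_extension_bases_def deletion_def)
    then show "B \<in> M" using swap[OF _ _ _ G pp(1)] by cases auto
  qed
qed

text \<open>Every basis meets the pair, so removing one element from a basis without the other can
  be repaired only by that other.\<close>

lemma series_pair_decomposition:
  assumes M: "matroid E M" and p: "series_pair M f g" and "f \<noteq> g"
    and F: "F \<in> M" "f \<notin> F" and G: "G \<in> M" "g \<notin> G"
  shows "M = series_extension_bases (contraction M g) f g"
proof -
  have swap: "insert y (B - {x}) \<in> M"
    if B: "B \<in> M" "x \<in> B" "y \<notin> B" and X: "X \<in> M" "x \<notin> X" and pp: "\<forall>B\<in>M. x \<in> B \<or> y \<in> B" for B x y X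
  proof -
    obtain k where k: "k \<notin> B" "insert k (B - {x}) \<in> M"
      using matroid_exchange[OF M B(1) X(1) B(2) X(2)] by metis
    have "x \<in> insert k (B - {x}) \<or> y \<in> insert k (B - {x})" using pp k(2) by (rule bspec)
    then have "k = y" using B(2,3) k(1) by blast
    then show ?thesis using k by simp
  qed
  have pp: "\<forall>B\<in>M. f \<in> B \<or> g \<in> B" "\<forall>B\<in>M. g \<in> B \<or> f \<in> B"
    using p by (auto simp: series_pair_def)
  show ?thesis
  proof (intro equalityI subsetI)
    fix B assume B: "B \<in> M"
    show "B \<in> series_extension_bases (contraction M g) f g"
    proof (cases "g \<in> B")
      case True
      then have "B - {g} \<in> contraction M g" "B = insert g (B - {g})"
        using B by (auto simp: contraction_def insert_absorb)
      then show ?thesis unfolding series_extension_bases_def by blast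
    next
      case False
      then have fB: "f \<in> B" using pp B by blast
      have "B - {f} \<in> contraction M g"
        using swap[OF B fB False F pp(1)] False by (simp add: contraction_def)
      moreover have "B = insert f (B - {f})" "f \<notin> B - {f}" using fB by auto
      ultimately show ?thesis unfolding series_extension_bases_def by blast
    qed
  next
    fix B assume "B \<in> series_extension_bases (contraction M g) f g"
    then consider "B \<in> M" | B' where "insert g B' \<in> M" "g \<notin> B'" "f \<notin> B'" "B = insert f B'"
      by (auto simp: series_extension_bases_def contraction_def)
    then show "B \<in> M"
    proof cases
      case 2
      have "insert f (insert g B' - {g}) \<in> M" using swap[OF 2(1) _ _ G pp(2)] 2 assms(3) by simp
      then show ?thesis using 2 by simp
    qed
  qed
qed

text \<open>Contracting \<open>g\<close> makes \<open>f\<close> a loop, so the contraction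
  contributes nothing.\<close>

lemma beta_parallel_pair:
  assumes M: "matroid E M" and p: "parallel_pair M f g" and fg: "f \<in> E" "g \<in> E" "f \<noteq> g"
    and F: "F \<in> M" "f \<in> F" and G: "G \<in> M" "g \<in> G"
  shows "beta E M = beta (E - {g}) (deletion M g)"
proof -
  have "g \<notin> F" using p F by (auto simp: parallel_pair_def)
  moreover have "E \<noteq> {g}" using fg by auto
  ultimately have "beta E M = beta (E - {g}) (deletion M g) + beta (E - {g}) (contraction M g)"
    using beta_deletion_contraction[OF M fg(2) _ F(1) _ G] by simp
  moreover have "\<forall>B\<in>contraction M g. f \<notin> B"
  proof
    fix B assume "B \<in> contraction M g"
    then have "insert g B \<in> M" by (simp add: contraction_def)
    then show "f \<notin> B" using p unfolding parallel_pair_def by blast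
  qed
  then have "beta (E - {g}) (contraction M g) = 0"
    using beta_loop[OF matroid_contraction[OF M G], of f] fg by simp
  ultimately show ?thesis by simp
qed

text \<open>Deleting \<open>g\<close> makes \<open>f\<close> a coloop, which kills the deletion term
  only if a further element remains. On two elements with bases \<open>{f}\<close> and
  \<open>{g}\<close> the formula fails: the left side is one, the right side zero.\<close>

lemma beta_series_pair:
  assumes M: "matroid E M" and p: "series_pair M f g" and fg: "f \<in> E" "g \<in> E" "f \<noteq> g"
    and F: "F \<in> M" "f \<notin> F" and G: "G \<in> M" "g \<notin> G" and E: "3 \<le> card E"
  shows "beta E M = beta (E - {g}) (contraction M g)"
proof -
  have "g \<in> F" using p F by (auto simp: series_pair_def)
  moreover have "E \<noteq> {g}" using fg by auto
  ultimately have "beta E M = beta (E - {g}) (deletion M g) + beta (E - {g}) (contraction M g)"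
    using beta_deletion_contraction[OF M fg(2) _ G F(1)] by simp
  moreover have "\<forall>B\<in>deletion M g. f \<in> B"
    using p by (auto simp: series_pair_def deletion_def)
  moreover have "E - {g} \<noteq> {f}"
  proof
    assume "E - {g} = {f}"
    then have "E = {f, g}" using fg by auto
    then show False using E fg by simp
  qed
  ultimately show ?thesis
    using beta_coloop[OF matroid_deletion[OF M G], of f] fg by simp
qed

section \<open>Cycle matroids of series-parallel graphs\<close>

text \<open>Only the edge set \<open>D\<close> is kept, as for cycles and forests. Unlike in
  \<open>is_cycle\<close>, the vertex list has one entry more than the edge list; the empty path
  joins a vertex to itself.\<close>

definition edge_path :: "('v, 'e) multigraph \<Rightarrow> 'v \<Rightarrow> 'v \<Rightarrow> 'e set \<Rightarrow> bool" where
  "edge_path G u v D \<longleftrightarrow>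
     (\<exists>w es. length w = Suc (length es) \<and> distinct w \<and> distinct es \<and> w ! 0 = u \<and> w ! length es = v \<and>
        set es = D \<and> D \<subseteq> edges G \<and> (\<forall>i<length es. ends G (es ! i) = {w ! i, w ! Suc i}))"

lemma edge_path_sym:
  assumes "edge_path G u v D"
  shows "edge_path G v u D"
proof -
  obtain w es where p: "length w = Suc (length es)" "distinct w" "distinct es" "w ! 0 = u"
    "w ! length es = v" "set es = D" "D \<subseteq> edges G"
    "\<forall>i<length es. ends G (es ! i) = {w ! i, w ! Suc i}"
    using assms(1) unfolding edge_path_def by blast
  have "ends G (rev es ! i) = {rev w ! i, rev w ! Suc i}" if i: "i < length es" for i
  proof -
    have "ends G (rev es ! i) = {w ! (length es - Suc i), w ! Suc (length es - Suc i)}"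
      using p(8) i by (simp add: rev_nth)
    moreover have "rev w ! i = w ! Suc (length es - Suc i)" "rev w ! Suc i
        = w ! (length es - Suc i)"
      using i p(1) by (simp_all add: rev_nth Suc_diff_Suc)
    ultimately show ?thesis by auto
  qed
  moreover have "rev w ! 0 = v" "rev w ! length es = u" using p by (simp_all add: rev_nth)
  ultimately show ?thesis
    unfolding edge_path_def using p by (intro exI[of _ "rev w"] exI[of _ "rev es"]) auto
qed

lemma edge_path_cong:
  assumes "D \<subseteq> edges G \<longleftrightarrow> D \<subseteq> edges G'" "\<And>e. e \<in> D \<Longrightarrow> ends G e = ends G' e"
  shows "edge_path G u v D \<longleftrightarrow> edge_path G' u v D"
  unfolding edge_path_def
  by (intro ex_cong1 conj_cong refl assms(1) all_cong1 imp_cong) (use assms(2) in auto)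

lemma is_cycle_cong:
  assumes "C \<subseteq> edges G \<longleftrightarrow> C \<subseteq> edges G'" "\<And>e. e \<in> C \<Longrightarrow> ends G e = ends G' e"
  shows "is_cycle G C \<longleftrightarrow> is_cycle G' C"
  unfolding is_cycle_def using assms by (metis nth_mem)

text \<open>Together with the converse \<open>edge_path_extend\<close> this moves an end of a path
  along one edge, which is how the subdividing vertex enters and leaves a path.\<close>

lemma edge_path_first_edge:
  assumes "edge_path G x y D" "x \<noteq> y"
  shows "\<exists>a z. a \<in> D \<and> ends G a = {x, z} \<and> edge_path G z y (D - {a}) \<and> (\<forall>b\<in>D - {a}. x \<notin> ends G b)"
proof -
  obtain w es where p: "length w = Suc (length es)" "distinct w" "distinct es" "w ! 0 = x"
    "w ! length es = y" "set es = D" "D \<subseteq> edges G"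
    "\<forall>i<length es. ends G (es ! i) = {w ! i, w ! Suc i}"
    using assms(1) unfolding edge_path_def by blast
  have "es \<noteq> []" using p assms(2) by auto
  then obtain a es' where es: "es = a # es'" by (cases es) auto
  obtain w' where w: "w = x # w'" using p(1,4) by (cases w) auto
  have len: "length w' = Suc (length es')" using p(1) es w by simp
  have ea: "ends G a = {x, w' ! 0}" using p(8)[rule_format, of 0] es w by simp
  have en: "ends G (es' ! i) = {w' ! i, w' ! Suc i}" if "i < length es'" for i
    using p(8)[rule_format, of "Suc i"] es w that by simp
  have D: "D - {a} = set es'" using p(3,6) es by auto
  have "x \<notin> ends G b" if b: "b \<in> D - {a}" for b
  proof -
    obtain i where "i < length es'" "b = es' ! i" using b D by (metis in_set_conv_nth)
    moreover have "x \<notin> set w'" using p(2) w by simp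
    ultimately show ?thesis using en len by (metis Suc_less_eq insertE less_SucI nth_mem singletonD)
  qed
  moreover have "edge_path G (w' ! 0) y (D - {a})"
    unfolding edge_path_def D
    by (rule exI[of _ w'], rule exI[of _ es']) (use p es w len en in auto)
  ultimately show ?thesis using ea p(6) es by auto
qed

lemma edge_path_extend:
  assumes p: "edge_path G z y D" and a: "a \<in> edges G" "ends G a = {x, z}" "x \<noteq> z" "a \<notin> D"
    and av: "\<forall>b\<in>D. x \<notin> ends G b"
  shows "edge_path G x y (insert a D)"
proof -
  obtain w es where p: "length w = Suc (length es)" "distinct w" "distinct es" "w ! 0 = z"
      "w ! length es = y"
    "set es = D" "D \<subseteq> edges G" "\<forall>i<length es. ends G (es ! i) = {w ! i, w ! Suc i}"
    using p unfolding edge_path_def by blast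
  have "x \<notin> set w"
  proof
    assume "x \<in> set w"
    then obtain j where j: "j < length w" "w ! j = x" by (metis in_set_conv_nth)
    then obtain i where i: "j = Suc i" using p(4) a(3) by (cases j) auto
    then have "x \<in> ends G (es ! i)" "es ! i \<in> D" using p j by auto
    then show False using av by blast
  qed
  moreover have "ends G ((a # es) ! i) = {(x # w) ! i, (x # w) ! Suc i}"
      if "i < length (a # es)" for i
    using that p(4,8) a(2) by (cases i) auto
  ultimately show ?thesis
    unfolding edge_path_def using p a by (intro exI[of _ "x # w"] exI[of _ "a # es"]) auto
qed

text \<open>Reduces cycles to paths between fixed ends, so that \<open>f\<close> may be replaced by
  another edge or by a subdivided one.\<close>

lemma cycle_through_edge_iff:
  assumes f: "f \<in> edges G" "ends G f = {u, v}" "u \<noteq> v" "f \<notin> D"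
  shows "is_cycle G (insert f D) \<longleftrightarrow> edge_path G u v D"
proof
  assume "edge_path G u v D"
  then obtain w es where p: "length w = Suc (length es)" "distinct w" "distinct es" "w ! 0 = u"
      "w ! length es = v"
    "set es = D" "D \<subseteq> edges G" "\<forall>i<length es. ends G (es ! i) = {w ! i, w ! Suc i}"
    unfolding edge_path_def by blast
  let ?es = "es @ [f]"
  have "ends G (?es ! i) = {w ! i, w ! (Suc i mod length ?es)}" if "i < length ?es" for i
  proof (cases "i < length es")
    case True
    then show ?thesis using p by (simp add: nth_append)
  next
    case False
    then have "i = length es" using that by simp
    then show ?thesis using p f by (auto simp: nth_append)
  qed
  then show "is_cycle G (insert f D)"
    unfolding is_cycle_def using p f by (intro exI[of _ ?es] exI[of _ w]) auto
next
  assume "is_cycle G (insert f D)"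
  then obtain es0 vs0 where c0: "es0 \<noteq> []" "length vs0 = length es0" "distinct es0" "distinct vs0"
     "set es0 = insert f D" "insert f D \<subseteq> edges G"
     "\<forall>i<length es0. ends G (es0 ! i) = {vs0 ! i, vs0 ! (Suc i mod length es0)}"
    unfolding is_cycle_def by blast
  obtain i0 where i0: "i0 < length es0" "es0 ! i0 = f" using c0(5)
      by (metis in_set_conv_nth insertI1)
  \<comment> \<open>Rotating the cycle brings \<open>f\<close> to the front; dropping it leaves the
    path.\<close>
  define es where "es = rotate i0 es0"
  define vs where "vs = rotate i0 vs0"
  have c: "es \<noteq> []" "length vs = length es" "distinct es" "distinct vs" "set es = insert f D"
      "es ! 0 = f"
    using c0 i0 by (auto simp: es_def vs_def nth_rotate)
  have en: "ends G (es ! i) = {vs ! i, vs ! (Suc i mod length es)}" if i: "i < length es" for i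
  proof -
    have l: "length es = length es0" by (simp add: es_def)
    have "es ! i = es0 ! ((i0 + i) mod length es0)" using i l by (simp add: es_def nth_rotate)
    moreover have "vs ! i = vs0 ! ((i0 + i) mod length es0)" using i l c0(2)
        by (simp add: vs_def nth_rotate)
    moreover have "vs ! (Suc i mod length es) = vs0 ! ((i0 + Suc i mod length es) mod length es0)"
      using i l c0(1,2) by (simp add: vs_def nth_rotate)
    moreover have "(i0 + Suc i mod length es) mod length es0
        = Suc ((i0 + i) mod length es0) mod length es0"
      unfolding l by (metis add_Suc_right mod_Suc_eq mod_add_right_eq)
    moreover have "(i0 + i) mod length es0 < length es0" using c0(1) by simp
    ultimately show ?thesis using c0(7) by simp
  qed
  obtain es' where es': "es = f # es'" using c(1,6) by (cases es) auto
  obtain x vs' where vs': "vs = x # vs'" using c(1,2) by (cases vs) auto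
  have len: "length vs' = length es'" using c(2) es' vs' by simp
  have f0: "{u, v} = {x, vs ! (1 mod length es)}" using en[of 0] c(1,6) f(2) vs' by simp
  have "es' \<noteq> []"
  proof
    assume "es' = []"
    then have "{u, v} = {x}" using f0 es' vs' by simp
    then show False using f(3) by (metis doubleton_eq_iff insert_absorb2)
  qed
  then have n1: "0 < length es'" by simp
  then have f1: "{u, v} = {x, vs' ! 0}" using f0 es' vs' by simp
  have D: "set es' = D" using c(3,5) es' f(4) by auto
  have "edge_path G (vs' ! 0) x D"
    unfolding edge_path_def
  proof (intro exI conjI)
    show "length (vs' @ [x]) = Suc (length es')" using len by simp
    show "distinct (vs' @ [x])" using c(4) vs' by auto
    show "distinct es'" using c(3) es' by simp
    show "(vs' @ [x]) ! 0 = vs' ! 0" using len n1 by (simp add: nth_append)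
    show "(vs' @ [x]) ! length es' = x" using len by (simp add: nth_append)
    show "set es' = D" by fact
    show "D \<subseteq> edges G" using c0(6) by blast
    show "\<forall>i<length es'. ends G (es' ! i) = {(vs' @ [x]) ! i, (vs' @ [x]) ! Suc i}"
    proof (intro allI impI)
      fix i assume i: "i < length es'"
      have e: "ends G (es' ! i) = {vs' ! i, vs ! (Suc (Suc i) mod Suc (length es'))}"
        using en[of "Suc i"] i es' vs' by simp
      show "ends G (es' ! i) = {(vs' @ [x]) ! i, (vs' @ [x]) ! Suc i}"
      proof (cases "Suc i = length es'")
        case True
        then show ?thesis using e i len vs' by (simp add: nth_append)
      next
        case False
        then have "Suc i < length es'" using i by simp
        then show ?thesis using e i len vs' by (simp add: nth_append)
      qed
    qed
  qed
  then show "edge_path G u v D" using f1 edge_path_sym f(3) by (metis doubleton_eq_iff)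
qed

text \<open>Loops are excluded so that \<open>cycle_through_edge_iff\<close> applies; finiteness of
  the vertex set leaves room for the fresh vertex of a subdivision.\<close>

definition proper_multigraph :: "('v, 'e) multigraph \<Rightarrow> bool" where
  "proper_multigraph G \<longleftrightarrow> finite (verts G) \<and>
     (\<forall>e\<in>edges G. \<exists>u\<in>verts G. \<exists>v\<in>verts G. u \<noteq> v \<and> ends G e = {u, v})"

section \<open>Forests and bases under series and parallel extension\<close>

lemma series_parallel_proper: "series_parallel_graph G \<Longrightarrow> proper_multigraph G"
proof (induction rule: series_parallel_graph.induct)
  case (series_extension G f u v w e)
  then obtain u' v' where uv: "u' \<in> verts G" "v' \<in> verts G" "u' \<noteq> v'" "ends G f = {u', v'}"
    unfolding proper_multigraph_def by blast
  then have "u \<noteq> v" "u \<in> verts G" "v \<in> verts G"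
    using series_extension.hyps(3) by (auto simp: doubleton_eq_iff)
  then show ?case using series_extension unfolding proper_multigraph_def by (auto; metis)
qed (auto simp: proper_multigraph_def)

text \<open>The edges \<open>e\<close> and \<open>f\<close> have the same ends, so \<open>e\<close>
  may stand in for \<open>f\<close> in any cycle, and both together form a cycle of length
  two.\<close>

lemma forest_parallel_extension:
  assumes G: "proper_multigraph G" and f: "f \<in> edges G" and e: "e \<notin> edges G"
    and G': "G' = \<lparr>verts = verts G, edges = insert e (edges G), ends = (ends G)(e := ends G f)\<rparr>"
  shows "is_forest G' F \<longleftrightarrow>
    (e \<notin> F \<and> is_forest G F) \<or> (e \<in> F \<and> f \<notin> F \<and> is_forest G (insert f (F - {e})))"
proof -
  obtain u v where uv: "u \<noteq> v" "ends G f = {u, v}" using G f unfolding proper_multigraph_def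
      by blast
  have fe: "f \<noteq> e" using e f by auto
  have cyc: "is_cycle G' C \<longleftrightarrow> is_cycle G C" if "e \<notin> C" for C
    by (rule is_cycle_cong) (use that G' in auto)
  have pth: "edge_path G' u v D \<longleftrightarrow> edge_path G u v D" if "e \<notin> D" for D
    by (rule edge_path_cong) (use that G' in auto)
  have cyce: "is_cycle G' (insert e D) \<longleftrightarrow> edge_path G u v D" if "e \<notin> D" for D
    using cycle_through_edge_iff[of e G' u v D] pth[OF that] that uv G' by simp
  have cycf: "is_cycle G (insert f D) \<longleftrightarrow> edge_path G u v D" if "f \<notin> D" for D
    using cycle_through_edge_iff[OF f uv(2,1) that] .
  show ?thesis
  proof (cases "e \<in> F")
    case False
    then have "F \<subseteq> edges G' \<longleftrightarrow> F \<subseteq> edges G" using G' by auto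
    then show ?thesis using False cyc unfolding is_forest_def by blast
  next
    case eF: True
    show ?thesis
    proof (cases "f \<in> F")
      case True
      have "edge_path G u v {f}"
        unfolding edge_path_def
        by (rule exI[of _ "[u, v]"], rule exI[of _ "[f]"]) (use uv f in auto)
      then have "is_cycle G' {e, f}" using cyce[of "{f}"] fe by simp
      then have "\<not> is_forest G' F" using eF True unfolding is_forest_def by blast
      then show ?thesis using eF True by blast
    next
      case fF: False
      have sub: "F \<subseteq> edges G' \<longleftrightarrow> insert f (F - {e}) \<subseteq> edges G" using G' f eF by auto
      have "(\<exists>C. is_cycle G' C \<and> C \<subseteq> F) \<longleftrightarrow> (\<exists>C. is_cycle G C \<and> C \<subseteq> insert f (F - {e}))"
      proof
        assume "\<exists>C. is_cycle G' C \<and> C \<subseteq> F"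
        then obtain C where C: "is_cycle G' C" "C \<subseteq> F" by blast
        show "\<exists>C. is_cycle G C \<and> C \<subseteq> insert f (F - {e})"
        proof (cases "e \<in> C")
          case False
          then show ?thesis using C cyc by blast
        next
          case True
          then have "is_cycle G (insert f (C - {e}))"
            using cyce[of "C - {e}"] cycf[of "C - {e}"] C fF by (auto simp: insert_absorb)
          then show ?thesis using C by blast
        qed
      next
        assume "\<exists>C. is_cycle G C \<and> C \<subseteq> insert f (F - {e})"
        then obtain C where C: "is_cycle G C" "C \<subseteq> insert f (F - {e})" by blast
        then have eC: "e \<notin> C" using fe by auto
        show "\<exists>C. is_cycle G' C \<and> C \<subseteq> F"
        proof (cases "f \<in> C")
          case False
          then show ?thesis using C cyc[OF eC] by blast
        next
          case True
          then have "is_cycle G' (insert e (C - {f}))"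
            using cyce[of "C - {f}"] cycf[of "C - {f}"] C eC by (simp add: insert_absorb)
          then show ?thesis using C eF by blast
        qed
      qed
      then show ?thesis using eF fF sub unfolding is_forest_def by blast
    qed
  qed
qed

text \<open>Only \<open>e\<close> and \<open>f\<close> meet \<open>w\<close>, so a cycle contains
  both or neither, and suppressing \<open>w\<close> turns the former into a cycle through
  \<open>f\<close> alone. If \<open>e\<close> is absent, \<open>f\<close> is a dangling edge and
  lies on no cycle.\<close>

lemma forest_series_extension:
  assumes G: "proper_multigraph G" and f: "f \<in> edges G" "ends G f = {u, v}"
    and w: "w \<notin> verts G" and e: "e \<notin> edges G"
    and G': "G' = \<lparr>verts = insert w (verts G), edges = insert e (edges G),
        ends = (ends G)(f := {u, w}, e := {w, v})\<rparr>"
  shows "is_forest G' F \<longleftrightarrow>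
    (e \<in> F \<and> is_forest G (F - {e})) \<or> (e \<notin> F \<and> is_forest G (F - {f}))"
proof -
  have uv: "u \<noteq> v" "u \<in> verts G" "v \<in> verts G"
    using G f unfolding proper_multigraph_def by (auto simp: doubleton_eq_iff)
  have fe: "f \<noteq> e" using e f by auto
  have wn: "w \<notin> ends G a" if "a \<in> edges G" for a using G that w unfolding proper_multigraph_def
      by force
  have ends': "ends G' f = {u, w}" "ends G' e = {w, v}" "\<And>a. a \<noteq> e \<Longrightarrow> a \<noteq> f \<Longrightarrow> ends G' a = ends G a"
    and edges': "edges G' = insert e (edges G)" using G' fe by auto
  have uwv: "u \<noteq> w" "v \<noteq> w" using uv w by auto
  have cyc: "is_cycle G' C \<longleftrightarrow> is_cycle G C" if "e \<notin> C" "f \<notin> C" for C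
  proof (rule is_cycle_cong)
    show "C \<subseteq> edges G' \<longleftrightarrow> C \<subseteq> edges G" using that edges' by auto
    show "ends G' a = ends G a" if "a \<in> C" for a
      using that \<open>e \<notin> C\<close> \<open>f \<notin> C\<close> ends'(3)[of a] by metis
  qed
  have pth: "edge_path G' x y D \<longleftrightarrow> edge_path G x y D" if "e \<notin> D" "f \<notin> D" for x y D
  proof (rule edge_path_cong)
    show "D \<subseteq> edges G' \<longleftrightarrow> D \<subseteq> edges G" using that edges' by auto
    show "ends G' a = ends G a" if "a \<in> D" for a
      using that \<open>e \<notin> D\<close> \<open>f \<notin> D\<close> ends'(3)[of a] by metis
  qed
  have at_w: "a = e \<or> a = f" if "a \<in> edges G'" "w \<in> ends G' a" for a
    using that wn[of a] ends'(3)[of a] edges' by (metis insertE)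
  have path_edges: "D \<subseteq> edges G''" if "edge_path G'' x y D" for G'' :: "('a, 'b) multigraph"
      and x y D
    using that unfolding edge_path_def by blast
  have only_e: False if c: "is_cycle G' C" "e \<in> C" "f \<notin> C" for C
  proof -
    have "is_cycle G' (insert e (C - {e}))" using c by (simp add: insert_absorb)
    then have p: "edge_path G' w v (C - {e})"
      using cycle_through_edge_iff[of e G' w v "C - {e}"] ends' edges' uwv by simp
    obtain a z where "a \<in> C - {e}" "ends G' a = {w, z}"
      using edge_path_first_edge[OF p] uwv by blast
    then show False using at_w[of a] path_edges[OF p] c(3) by auto
  qed
  have only_f: False if c: "is_cycle G' C" "f \<in> C" "e \<notin> C" for C
  proof -
    have "is_cycle G' (insert f (C - {f}))" using c by (simp add: insert_absorb)
    then have p: "edge_path G' w u (C - {f})"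
      using cycle_through_edge_iff[of f G' w u "C - {f}"] ends' edges' uwv f
          by (simp add: insert_commute)
    obtain a z where "a \<in> C - {f}" "ends G' a = {w, z}"
      using edge_path_first_edge[OF p] uwv by blast
    then show False using at_w[of a] path_edges[OF p] c(3) by auto
  qed
  have both: "is_cycle G' (insert e (insert f D)) \<longleftrightarrow> is_cycle G (insert f D)"
      if D: "e \<notin> D" "f \<notin> D" for D
  proof -
    have "is_cycle G' (insert f (insert e D)) \<longleftrightarrow> edge_path G' w u (insert e D)"
      using cycle_through_edge_iff[of f G' w u "insert e D"] ends' edges' uwv f D fe
          by (simp add: insert_commute)
    also have "\<dots> \<longleftrightarrow> edge_path G v u D"
    proof
      assume p: "edge_path G' w u (insert e D)"
      obtain a z where a: "a \<in> insert e D" "ends G' a = {w, z}"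
          "edge_path G' z u (insert e D - {a})"
        using edge_path_first_edge[OF p] uwv by blast
      have "a = e" using at_w[of a] a path_edges[OF p] D fe by auto
      moreover from this have "z = v" using a ends' by (auto simp: doubleton_eq_iff)
      moreover have "insert e D - {e} = D" using D by auto
      ultimately show "edge_path G v u D" using a(3) pth[OF D] by simp
    next
      assume p: "edge_path G v u D"
      have "\<forall>b\<in>D. w \<notin> ends G' b" 
      proof
        fix b assume b: "b \<in> D"
        then have "b \<noteq> e" "b \<noteq> f" "b \<in> edges G" using D path_edges[OF p] by auto
        then show "w \<notin> ends G' b" using wn ends'(3) by metis
      qed
      then show "edge_path G' w u (insert e D)"
        using edge_path_extend[of G' v u D e w] pth[OF D] p ends' edges' uwv D by auto
    qed
    also have "\<dots> \<longleftrightarrow> is_cycle G (insert f D)"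
      using cycle_through_edge_iff[OF f(1) f(2) uv(1) D(2)] edge_path_sym[of G u v D] edge_path_sym[of G v u D] by blast
    finally show ?thesis by (simp add: insert_commute)
  qed
  have cyce: "is_cycle G' (insert e C) \<longleftrightarrow> is_cycle G C" if "e \<notin> C" "f \<in> C" for C
    using both[of "C - {f}"] that by (simp add: insert_absorb)
  show ?thesis
  proof (cases "e \<in> F")
    case eF: True
    have "(\<exists>C. is_cycle G' C \<and> C \<subseteq> F) \<longleftrightarrow> (\<exists>C. is_cycle G C \<and> C \<subseteq> F - {e})"
    proof
      assume "\<exists>C. is_cycle G' C \<and> C \<subseteq> F"
      then obtain C where C: "is_cycle G' C" "C \<subseteq> F" by blast
      consider "e \<notin> C" "f \<notin> C" | "e \<in> C" "f \<in> C" using only_e[OF C(1)] only_f[OF C(1)] by blast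
      then show "\<exists>C. is_cycle G C \<and> C \<subseteq> F - {e}"
      proof cases
        case 1
        then show ?thesis using C cyc by blast
      next
        case 2
        then have "is_cycle G (C - {e})" using cyce[of "C - {e}"] C fe by (simp add: insert_absorb)
        then show ?thesis using C by blast
      qed
    next
      assume "\<exists>C. is_cycle G C \<and> C \<subseteq> F - {e}"
      then obtain C where C: "is_cycle G C" "C \<subseteq> F - {e}" by blast
      show "\<exists>C. is_cycle G' C \<and> C \<subseteq> F"
      proof (cases "f \<in> C")
        case True
        then have "is_cycle G' (insert e C)" using cyce C by blast
        then show ?thesis using C eF by blast
      next
        case False
        then show ?thesis using C cyc[of C] by blast
      qed
    qed
    moreover have "F \<subseteq> edges G' \<longleftrightarrow> F - {e} \<subseteq> edges G" using edges' by auto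
    ultimately show ?thesis using eF unfolding is_forest_def by blast
  next
    case eF: False
    have "(\<exists>C. is_cycle G' C \<and> C \<subseteq> F) \<longleftrightarrow> (\<exists>C. is_cycle G C \<and> C \<subseteq> F - {f})"
      using only_f cyc eF by blast
    moreover have "F \<subseteq> edges G' \<longleftrightarrow> F - {f} \<subseteq> edges G" using edges' eF f by auto
    ultimately show ?thesis using eF unfolding is_forest_def by blast
  qed
qed

lemma cycle_matroid_basesD:
  assumes "B \<in> cycle_matroid_bases G"
  shows "is_forest G B" "\<And>F. is_forest G F \<Longrightarrow> B \<subseteq> F \<Longrightarrow> F = B"
  using assms unfolding cycle_matroid_bases_def by auto

lemma cycle_matroid_basesI:
  assumes "is_forest G B" "\<And>F. is_forest G F \<Longrightarrow> B \<subseteq> F \<Longrightarrow> F = B"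
  shows "B \<in> cycle_matroid_bases G"
  using assms unfolding cycle_matroid_bases_def by auto

lemma forest_edges: "is_forest G F \<Longrightarrow> F \<subseteq> edges G"
  by (simp add: is_forest_def)

lemma cycle_matroid_parallel_extension:
  assumes G: "proper_multigraph G" and f: "f \<in> edges G" and e: "e \<notin> edges G"
    and G': "G' = \<lparr>verts = verts G, edges = insert e (edges G), ends = (ends G)(e := ends G f)\<rparr>"
  shows "cycle_matroid_bases G' = parallel_extension_bases (cycle_matroid_bases G) f e"
proof -
  note fo = forest_parallel_extension[OF G f e G']
  have fe: "f \<noteq> e" using e f by auto
  show ?thesis
  proof (intro set_eqI iffI)
    fix B assume B: "B \<in> cycle_matroid_bases G'"
    note D = cycle_matroid_basesD[OF B]
    show "B \<in> parallel_extension_bases (cycle_matroid_bases G) f e"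
    proof (cases "e \<in> B")
      case False
      have "B \<in> cycle_matroid_bases G"
      proof (rule cycle_matroid_basesI)
        show "is_forest G B" using D(1) fo False by blast
        fix F assume F: "is_forest G F" "B \<subseteq> F"
        then have "e \<notin> F" using forest_edges[OF F(1)] e by blast
        then show "F = B" using D(2)[of F] F fo by blast
      qed
      then show ?thesis by (simp add: parallel_extension_bases_def)
    next
      case True
      let ?B = "insert f (B - {e})"
      have fB: "f \<notin> B" and forB: "is_forest G ?B" using D(1) fo True by blast+
      have "?B \<in> cycle_matroid_bases G"
      proof (rule cycle_matroid_basesI[OF forB])
        fix F assume F: "is_forest G F" "?B \<subseteq> F"
        have eF: "e \<notin> F" using forest_edges[OF F(1)] e by blast
        have "insert f (insert e (F - {f}) - {e}) = F" using F eF fe by auto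
        then have "is_forest G' (insert e (F - {f}))" using fo[of "insert e (F - {f})"] F fe by simp
        moreover have "B \<subseteq> insert e (F - {f})" using F fB by auto
        ultimately have "insert e (F - {f}) = B" using D(2) by blast
        then show "F = ?B" using F eF by auto
      qed
      moreover have "B = insert e (?B - {f})" using True fB by auto
      ultimately show ?thesis unfolding parallel_extension_bases_def by blast
    qed
  next
    fix B assume "B \<in> parallel_extension_bases (cycle_matroid_bases G) f e"
    then consider "B \<in> cycle_matroid_bases G"
      | B1 where "B1 \<in> cycle_matroid_bases G" "f \<in> B1" "B = insert e (B1 - {f})"
      unfolding parallel_extension_bases_def by blast
    then show "B \<in> cycle_matroid_bases G'"
    proof cases
      case 1
      note D = cycle_matroid_basesD[OF 1]
      have eB: "e \<notin> B" using forest_edges[OF D(1)] e by blast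
      show ?thesis
      proof (rule cycle_matroid_basesI)
        show "is_forest G' B" using D(1) fo eB by blast
        fix F assume F: "is_forest G' F" "B \<subseteq> F"
        show "F = B"
        proof (cases "e \<in> F")
          case False
          then show ?thesis using F D(2) fo by blast
        next
          case True
          then have "f \<notin> F" "is_forest G (insert f (F - {e}))" using F fo by blast+
          moreover from this have "insert f (F - {e}) = B" using D(2) F eB by blast
          ultimately show ?thesis using F by blast
        qed
      qed
    next
      case 2
      note D = cycle_matroid_basesD[OF 2(1)]
      have eB: "e \<notin> B1" using forest_edges[OF D(1)] e by blast
      show ?thesis
      proof (rule cycle_matroid_basesI)
        have "insert f (B - {e}) = B1" using 2 eB by auto
        then show "is_forest G' B" using fo[of B] D(1) 2 fe by simp
        fix F assume F: "is_forest G' F" "B \<subseteq> F"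
        have eF: "e \<in> F" using F 2 by auto
        then have fF: "f \<notin> F" "is_forest G (insert f (F - {e}))" using F fo by blast+
        have "B1 \<subseteq> insert f (F - {e})" using F 2 eB by auto
        then have "insert f (F - {e}) = B1" using D(2) fF by blast
        then show "F = B" using 2 eF fF by auto
      qed
    qed
  qed
qed

lemma cycle_matroid_series_extension:
  assumes G: "proper_multigraph G" and f: "f \<in> edges G" "ends G f = {u, v}"
    and w: "w \<notin> verts G" and e: "e \<notin> edges G"
    and G': "G' = \<lparr>verts = insert w (verts G), edges = insert e (edges G),
        ends = (ends G)(f := {u, w}, e := {w, v})\<rparr>"
  shows "cycle_matroid_bases G' = series_extension_bases (cycle_matroid_bases G) f e"
proof -
  note fo = forest_series_extension[OF G f w e G']
  have fe: "f \<noteq> e" using e f by auto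
  have nof: "e \<notin> F" if "is_forest G F" for F using forest_edges[OF that] e by blast
  show ?thesis
  proof (intro set_eqI iffI)
    fix B assume B: "B \<in> cycle_matroid_bases G'"
    note D = cycle_matroid_basesD[OF B]
    show "B \<in> series_extension_bases (cycle_matroid_bases G) f e"
    proof (cases "e \<in> B")
      case True
      have "B - {e} \<in> cycle_matroid_bases G"
      proof (rule cycle_matroid_basesI)
        show "is_forest G (B - {e})" using D(1) fo True by blast
        fix F assume F: "is_forest G F" "B - {e} \<subseteq> F"
        have "insert e F - {e} = F" using nof[OF F(1)] by auto
        then have "is_forest G' (insert e F)" using fo[of "insert e F"] F by simp
        moreover have "B \<subseteq> insert e F" using F by auto
        ultimately have "insert e F = B" using D(2) by blast
        then show "F = B - {e}" using nof[OF F(1)] by auto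
      qed
      moreover have "B = insert e (B - {e})" using True by auto
      ultimately show ?thesis unfolding series_extension_bases_def by blast
    next
      case False
      have forB: "is_forest G (B - {f})" using D(1) fo False by blast
      \<comment> \<open>Without \<open>e\<close>, adding \<open>f\<close> creates no cycle, so
        maximality forces \<open>f\<close> into \<open>B\<close>.\<close>
      then have "is_forest G' (insert f B)" using fo[of "insert f B"] False fe by simp
      then have "insert f B = B" using D(2) by blast
      then have fB: "f \<in> B" by auto
      have "B - {f} \<in> cycle_matroid_bases G"
      proof (rule cycle_matroid_basesI[OF forB])
        fix F assume F: "is_forest G F" "B - {f} \<subseteq> F"
        note eF = nof[OF F(1)]
        \<comment> \<open>Otherwise \<open>insert e F\<close> would be a forest above
          \<open>B\<close>, although the maximal forest \<open>B\<close> lacks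
          \<open>e\<close>.\<close>
        have "f \<notin> F"
        proof
          assume fF: "f \<in> F"
          have "insert e F - {e} = F" using eF by auto
          then have "is_forest G' (insert e F)" using fo[of "insert e F"] F by simp
          moreover have "B \<subseteq> insert e F" using F fF by auto
          ultimately have "insert e F = B" using D(2) by blast
          then show False using False by blast
        qed
        moreover from this have "insert f F - {f} = F" by auto
        then have "is_forest G' (insert f F)" using fo[of "insert f F"] F eF fe by simp
        moreover have "B \<subseteq> insert f F" using F by auto
        ultimately show "F = B - {f}" using D(2)[of "insert f F"] by auto
      qed
      moreover have "B = insert f (B - {f})" "f \<notin> B - {f}" using fB by auto
      ultimately show ?thesis unfolding series_extension_bases_def by blast
    qed
  next
    fix B assume "B \<in> series_extension_bases (cycle_matroid_bases G) f e"
    then consider B1 where "B1 \<in> cycle_matroid_bases G" "B = insert e B1"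
      | B1 where "B1 \<in> cycle_matroid_bases G" "f \<notin> B1" "B = insert f B1"
      unfolding series_extension_bases_def by blast
    then show "B \<in> cycle_matroid_bases G'"
    proof cases
      case 1
      note D = cycle_matroid_basesD[OF 1(1)]
      have BB: "B - {e} = B1" using 1 nof[OF D(1)] by auto
      show ?thesis
      proof (rule cycle_matroid_basesI)
        show "is_forest G' B" using fo[of B] BB D(1) 1 by simp
        fix F assume F: "is_forest G' F" "B \<subseteq> F"
        then have eF: "e \<in> F" using 1 by auto
        then have "is_forest G (F - {e})" "B1 \<subseteq> F - {e}" using F fo 1 nof[OF D(1)] by blast+
        then have "F - {e} = B1" using D(2) by blast
        then show "F = B" using 1 eF by auto
      qed
    next
      case 2
      note D = cycle_matroid_basesD[OF 2(1)]
      have BB: "B - {f} = B1" "e \<notin> B" using 2 nof[OF D(1)] fe by auto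
      show ?thesis
      proof (rule cycle_matroid_basesI)
        show "is_forest G' B" using fo[of B] BB D(1) by simp
        fix F assume F: "is_forest G' F" "B \<subseteq> F"
        show "F = B"
        proof (cases "e \<in> F")
          case True
          then have "is_forest G (F - {e})" "B1 \<subseteq> F - {e}" using F fo 2 nof[OF D(1)] by blast+
          then have "F - {e} = B1" using D(2) by blast
          then show ?thesis using 2 F fe by blast
        next
          case False
          then have "is_forest G (F - {f})" "B1 \<subseteq> F - {f}" using F fo 2 by blast+
          then have "F - {f} = B1" using D(2) by blast
          then show ?thesis using 2 F by blast
        qed
      qed
    qed
  qed
qed

lemma cycle_matroid_single_edge:
  assumes "u \<noteq> v" "\<epsilon> e = {u, v}"
  shows "cycle_matroid_bases \<lparr>verts = {u, v}, edges = {e}, ends = \<epsilon>\<rparr> = {{e}}"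
proof -
  let ?G = "\<lparr>verts = {u, v}, edges = {e}, ends = \<epsilon>\<rparr>"
  have "\<not> is_cycle ?G C" for C
  proof
    assume "is_cycle ?G C"
    then obtain es vs where c: "es \<noteq> []" "distinct es" "set es = C" "C \<subseteq> {e}"
      "\<forall>i<length es. \<epsilon> (es ! i) = {vs ! i, vs ! (Suc i mod length es)}"
      unfolding is_cycle_def by auto
    have "length es = card C" using c(2,3) distinct_card by metis
    also have "\<dots> \<le> 1" using card_mono[OF _ c(4)] by simp
    finally have "length es = 1" using c(1) by (cases es) auto
    then have "\<epsilon> (es ! 0) = {vs ! 0}" "es ! 0 \<in> C" using c by auto
    then show False using c(4) assms by (auto simp: doubleton_eq_iff)
  qed
  then have "is_forest ?G F \<longleftrightarrow> F \<subseteq> {e}" for F by (simp add: is_forest_def)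
  then show ?thesis unfolding cycle_matroid_bases_def by (auto simp: subset_singleton_iff)
qed

section \<open>Series-parallel matroids and the value one of the invariant\<close>

lemma beta_singleton: "beta {e} {{e}} = 1"
proof -
  have "Pow {e} = {{}, {e}}" by auto
  then show ?thesis by (simp add: beta_def rank_of_def)
qed

text \<open>Serves to exclude a connected series extension on only two elements, whose contraction
  would have the empty basis; \<open>beta_series_pair\<close> starts at three elements.\<close>

lemma series_parallel_basis_nonempty:
  "series_parallel_graph G \<Longrightarrow> {} \<notin> cycle_matroid_bases G"
proof (induction rule: series_parallel_graph.induct)
  case (single_edge u v \<epsilon> e)
  then show ?case by (simp add: cycle_matroid_single_edge)
next
  case (series_extension G f u v w e)
  show ?case
    unfolding cycle_matroid_series_extension[OF series_parallel_proper[OF series_extension.hyps(1)]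
        series_extension.hyps(2-5) refl]
    by (auto simp: series_extension_bases_def)
next
  case (parallel_extension G f e)
  show ?case
    unfolding cycle_matroid_parallel_extension[OF series_parallel_proper[OF parallel_extension.hyps(1)]
        parallel_extension.hyps(2,3) refl]
    using parallel_extension.IH by (auto simp: parallel_extension_bases_def)
qed

lemma cycle_matroid_bases_edges: "B \<in> cycle_matroid_bases G \<Longrightarrow> B \<subseteq> edges G"
  by (simp add: cycle_matroid_bases_def is_forest_def)

lemma card_ge_2I: "finite E \<Longrightarrow> e \<in> E \<Longrightarrow> f \<in> E \<Longrightarrow> f \<noteq> e \<Longrightarrow> 2 \<le> card E"
  using card_mono[of E "{e, f}"] by auto

text \<open>The cycle matroid of a series extension of a single edge is disconnected, so its beta
  invariant vanishes; this is why the bound is not an equality.\<close>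

lemma series_parallel_beta_le:
  "series_parallel_graph G \<Longrightarrow> matroid (edges G) (cycle_matroid_bases G) \<Longrightarrow>
     beta (edges G) (cycle_matroid_bases G) \<le> 1"
proof (induction rule: series_parallel_graph.induct)
  case (single_edge u v \<epsilon> e)
  then show ?case by (simp add: cycle_matroid_single_edge beta_singleton)
next
  case (series_extension G f u v w e)
  let ?G' = "\<lparr>verts = insert w (verts G), edges = insert e (edges G),
        ends = (ends G)(f := {u, w}, e := {w, v})\<rparr>"
  define M where "M = cycle_matroid_bases G"
  define M' where "M' = cycle_matroid_bases ?G'"
  define E' where "E' = insert e (edges G)"
  have eq: "M' = series_extension_bases M f e"
    unfolding M_def M'_def
    by (rule cycle_matroid_series_extension[OF series_parallel_proper[OF series_extension.hyps(1)]
        series_extension.hyps(2-5) refl])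
  have mat: "matroid E' M'" using series_extension.prems by (simp add: M'_def E'_def)
  have e: "e \<in> E'" "f \<in> E'" "f \<noteq> e" "E' - {e} = edges G" using series_extension.hyps
      by (auto simp: E'_def)
  have noe: "e \<notin> B" if "B \<in> M" for B
    using that cycle_matroid_bases_edges series_extension.hyps(5) unfolding M_def by blast
  have con: "contraction M' e = M"
  proof (intro set_eqI iffI)
    fix B assume "B \<in> contraction M' e"
    then have B: "e \<notin> B" "insert e B \<in> M'" by (auto simp: contraction_def)
    from B(2) consider B1 where "B1 \<in> M" "insert e B = insert e B1" | B1
        where "B1 \<in> M" "insert e B = insert f B1"
      unfolding eq series_extension_bases_def by blast
    then show "B \<in> M"
    proof cases
      case 1
      then show ?thesis using B(1) noe[of B1] by (simp add: insert_ident)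
    next
      case 2
      then have "e \<in> insert f B1" by blast
      then show ?thesis using noe[OF 2(1)] e(3) by blast
    qed
  next
    fix B assume "B \<in> M"
    then show "B \<in> contraction M' e"
      using noe[of B] unfolding contraction_def eq series_extension_bases_def by blast
  qed
  have two: "2 \<le> card E'" using card_ge_2I[OF matroid_finite[OF mat] e(1,2,3)] .
  have "beta E' M' \<le> 1"
  proof (cases "connected_bases E' M'")
    case False
    then show ?thesis using beta_pos_iff_connected(1)[OF mat two] by simp
  next
    case True
    have ne: "E' \<noteq> {e}" "E' \<noteq> {f}" using e by auto
    obtain F where F: "F \<in> M'" "f \<notin> F" using connected_no_loop(2)[OF mat True e(2) ne(2)] by blast
    obtain H where H: "H \<in> M'" "e \<notin> H" using connected_no_loop(2)[OF mat True e(1) ne(1)] by blast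
    have sp: "series_pair M' f e"
      unfolding series_pair_def eq series_extension_bases_def by blast
    have "e \<in> F" using sp F unfolding series_pair_def by blast
    have "3 \<le> card E'"
    proof (rule ccontr)
      assume "\<not> 3 \<le> card E'"
      then have "card E' = card {e, f}" using two e(3) by simp
      then have "E' = {e, f}" using e matroid_finite[OF mat]
          by (metis card_subset_eq empty_subsetI insert_subset)
      moreover have "F \<subseteq> E'" using matroid_sub[OF mat F(1)] .
      ultimately have "F = {e}" using \<open>e \<in> F\<close> F(2) by auto
      then have "{} \<in> contraction M' e" using F(1) by (simp add: contraction_def)
      then show False using con series_parallel_basis_nonempty[OF series_extension.hyps(1)]
          by (simp add: M_def)
    qed
    then have "beta E' M' = beta (E' - {e}) (contraction M' e)"
      by (rule beta_series_pair[OF mat sp e(2,1,3) F H])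
    \<comment> \<open>The matroid property required by the induction hypothesis is inherited from
      the larger graph, since \<open>M\<close> is a minor of \<open>M'\<close>.\<close>
    moreover have "matroid (edges G) M"
      using matroid_contraction[OF mat F(1) \<open>e \<in> F\<close>] con e(4) by simp
    ultimately show ?thesis using series_extension.IH con e(4) by (simp add: M_def)
  qed
  then show ?case by (simp add: E'_def M'_def)
next
  case (parallel_extension G f e)
  let ?G' = "\<lparr>verts = verts G, edges = insert e (edges G), ends = (ends G)(e := ends G f)\<rparr>"
  define M where "M = cycle_matroid_bases G"
  define M' where "M' = cycle_matroid_bases ?G'"
  define E' where "E' = insert e (edges G)"
  have eq: "M' = parallel_extension_bases M f e"
    unfolding M_def M'_def
    by (rule cycle_matroid_parallel_extension[OF series_parallel_proper[OF parallel_extension.hyps(1)]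
        parallel_extension.hyps(2,3) refl])
  have mat: "matroid E' M'" using parallel_extension.prems by (simp add: M'_def E'_def)
  have e: "e \<in> E'" "f \<in> E'" "f \<noteq> e" "E' - {e} = edges G" using parallel_extension.hyps
      by (auto simp: E'_def)
  have noe: "e \<notin> B" if "B \<in> M" for B
    using that cycle_matroid_bases_edges parallel_extension.hyps(3) unfolding M_def by blast
  have del: "deletion M' e = M"
    using noe unfolding deletion_def eq parallel_extension_bases_def by blast
  have two: "2 \<le> card E'" using card_ge_2I[OF matroid_finite[OF mat] e(1,2,3)] .
  have "beta E' M' \<le> 1"
  proof (cases "connected_bases E' M'")
    case False
    then show ?thesis using beta_pos_iff_connected(1)[OF mat two] by simp
  next
    case True
    have ne: "E' \<noteq> {e}" "E' \<noteq> {f}" using e by auto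
    obtain F where F: "F \<in> M'" "f \<in> F" using connected_no_loop(1)[OF mat True e(2) ne(2)] by blast
    obtain H where H: "H \<in> M'" "e \<in> H" using connected_no_loop(1)[OF mat True e(1) ne(1)] by blast
    have sp: "parallel_pair M' f e"
      using noe e(3) unfolding parallel_pair_def eq parallel_extension_bases_def by blast
    then have "e \<notin> F" using F unfolding parallel_pair_def by blast
    have "beta E' M' = beta (E' - {e}) (deletion M' e)"
      by (rule beta_parallel_pair[OF mat sp e(2,1,3) F H])
    moreover have "matroid (edges G) M"
      using matroid_deletion[OF mat F(1) \<open>e \<notin> F\<close>] del e(4) by simp
    ultimately show ?thesis using parallel_extension.IH del e(4) by (simp add: M_def)
  qed
  then show ?case by (simp add: E'_def M'_def)
qed

text \<open>A parallel pair is undone by deletion, a series pair by contraction. Both keep the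
  invariant at one, and the graph of the minor is then extended back.\<close>

lemma beta_one_imp_series_parallel:
  assumes "matroid E M" "beta E M = 1" "E \<noteq> {}"
  shows "series_parallel_matroid E M"
  using assms
proof (induction "card E" arbitrary: E M rule: less_induct)
  case less
  note mat = less.prems(1) and b = less.prems(2)
  have fin: "finite E" using matroid_finite[OF mat] .
  obtain e where e: "e \<in> E" using less.prems(3) by blast
  show ?case
  proof (cases "E = {e}")
    case True
    have "\<exists>B\<in>M. e \<in> B" using beta_loop[OF mat e] b by fastforce
    then have "{e} \<in> M" using matroid_sub[OF mat] True by (metis subset_singletonD empty_iff)
    moreover have "M \<subseteq> {{}, {e}}" using matroid_sub[OF mat] True by blast
    moreover have "{} \<notin> M" using matroid_card[OF mat \<open>{e} \<in> M\<close>] by fastforce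
    ultimately have M: "M = {{e}}" by blast
    let ?G = "\<lparr>verts = {0, 1 :: nat}, edges = {e}, ends = (\<lambda>_. {0, 1})\<rparr>"
    have "series_parallel_graph ?G" by (rule series_parallel_graph.single_edge) auto
    moreover have "cycle_matroid_bases ?G = {{e}}" by (rule cycle_matroid_single_edge) auto
    ultimately show ?thesis unfolding series_parallel_matroid_def
      using True M by (intro exI[of _ ?G]) auto
  next
    case False
    then obtain e' where e': "e' \<in> E" "e' \<noteq> e" using e by blast
    have two: "2 \<le> card E" using card_ge_2I[OF fin e e'] .
    have conn: "connected_bases E M" using beta_pos_iff_connected(1)[OF mat two] b by simp
    have nsing: "E \<noteq> {x}" for x using two by auto
    have nl: "\<exists>B\<in>M. x \<in> B" "\<exists>B\<in>M. x \<notin> B" if "x \<in> E" for x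
      using connected_no_loop[OF mat conn that nsing] by auto
    have IH: "series_parallel_matroid (E - {g}) M'"
        if "g \<in> E" "matroid (E - {g}) M'" "beta (E - {g}) M' = 1" for g M'
    proof (rule less.hyps[OF _ that(2,3)])
      show "card (E - {g}) < card E" using fin that(1) by (rule card_Diff1_less)
      show "E - {g} \<noteq> {}" using nsing[of g] that(1) by auto
    qed
    \<comment> \<open>On two elements the pair is both series and parallel and has to be treated as
      parallel, since contraction would leave a loop.\<close>
    have "\<exists>f\<in>E. \<exists>g\<in>E. f \<noteq> g \<and> (parallel_pair M f g \<or> (series_pair M f g \<and> 3 \<le> card E))"
    proof (cases "3 \<le> card E")
      case True
      then show ?thesis using series_or_parallel_pair[OF mat b True e] by blast
    next
      case c: False
      then have "card E = card {e, e'}" using two e' by simp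
      then have E: "E = {e, e'}" using e e' fin
          by (metis card_subset_eq empty_subsetI insert_subset)
      have "parallel_pair M e e'"
        unfolding parallel_pair_def
      proof (intro ballI notI)
        fix B assume B: "B \<in> M" "e \<in> B \<and> e' \<in> B"
        obtain B' where B': "B' \<in> M" "e \<notin> B'" using nl(2)[OF e] by blast
        have "B' \<subseteq> {e'}" using matroid_sub[OF mat B'(1)] E B'(2) by auto
        then have "card B' \<le> 1" using card_mono[of "{e'}" B'] by simp
        moreover have "card {e, e'} \<le> card B" using B matroid_finite_basis[OF mat B(1)]
            by (intro card_mono) auto
        ultimately show False using matroid_card[OF mat B(1) B'(1)] e' by simp
      qed
      then show ?thesis using e e' by (intro bexI[of _ e] bexI[of _ e']) auto
    qed
    then obtain f g where fg: "f \<in> E" "g \<in> E" "f \<noteq> g"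
        and "parallel_pair M f g \<or> (series_pair M f g \<and> 3 \<le> card E)" by blast
    then consider "parallel_pair M f g" | "series_pair M f g" "3 \<le> card E" by blast
    then show ?thesis
    proof cases
      case 1
      obtain F where F: "F \<in> M" "f \<in> F" using nl(1)[OF fg(1)] by blast
      obtain H where H: "H \<in> M" "g \<in> H" using nl(1)[OF fg(2)] by blast
      have "g \<notin> F" using 1 F unfolding parallel_pair_def by blast
      then have "series_parallel_matroid (E - {g}) (deletion M g)"
        using IH[OF fg(2) matroid_deletion[OF mat F(1)]] beta_parallel_pair[OF mat 1 fg F H] b
            by metis
      then obtain G :: "(nat, 'a) multigraph" where G: "series_parallel_graph G" "edges G = E - {g}"
        "cycle_matroid_bases G = deletion M g" unfolding series_parallel_matroid_def by blast
      let ?G = "\<lparr>verts = verts G, edges = insert g (edges G), ends = (ends G)(g := ends G f)\<rparr>"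
      have ed: "f \<in> edges G" "g \<notin> edges G" using G fg by auto
      have "series_parallel_graph ?G" by (rule series_parallel_graph.parallel_extension[OF G(1) ed])
      moreover have "cycle_matroid_bases ?G = M"
        unfolding cycle_matroid_parallel_extension[OF series_parallel_proper[OF G(1)] ed refl] G(3)
        by (rule parallel_pair_decomposition[OF mat 1 fg(3) F H, symmetric])
      moreover have "edges ?G = E" using G fg by auto
      ultimately show ?thesis unfolding series_parallel_matroid_def by blast
    next
      case 2
      obtain F where F: "F \<in> M" "f \<notin> F" using nl(2)[OF fg(1)] by blast
      obtain H where H: "H \<in> M" "g \<notin> H" using nl(2)[OF fg(2)] by blast
      have "g \<in> F" using 2 F unfolding series_pair_def by blast
      then have "series_parallel_matroid (E - {g}) (contraction M g)"
        using IH[OF fg(2) matroid_contraction[OF mat F(1)]] beta_series_pair[OF mat 2(1) fg F H 2(2)] b by metis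
      then obtain G :: "(nat, 'a) multigraph" where G: "series_parallel_graph G" "edges G = E - {g}"
        "cycle_matroid_bases G = contraction M g" unfolding series_parallel_matroid_def by blast
      have ed: "f \<in> edges G" "g \<notin> edges G" using G fg by auto
      have proper: "proper_multigraph G" using series_parallel_proper[OF G(1)] .
      then obtain u v where uv: "ends G f = {u, v}" using ed unfolding proper_multigraph_def
          by blast
      have "finite (verts G)" using proper by (simp add: proper_multigraph_def)
      then obtain w where w: "w \<notin> verts G" using ex_new_if_finite[OF infinite_UNIV_nat] by metis
      let ?G = "\<lparr>verts = insert w (verts G), edges = insert g (edges G), ends
          = (ends G)(f := {u, w}, g := {w, v})\<rparr>"
      have "series_parallel_graph ?G"
          by (rule series_parallel_graph.series_extension[OF G(1) ed(1) uv w ed(2)])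
      moreover have "cycle_matroid_bases ?G = M"
        unfolding cycle_matroid_series_extension[OF proper ed(1) uv w ed(2) refl] G(3)
        by (rule series_pair_decomposition[OF mat 2(1) fg(3) F H, symmetric])
      moreover have "edges ?G = E" using G fg by auto
      ultimately show ?thesis unfolding series_parallel_matroid_def by blast
    qed
  qed
qed

lemma series_parallel_matroid_iff_beta:
  assumes mat: "matroid E M" and conn: "connected_bases E M" and two: "2 \<le> card E"
  shows "series_parallel_matroid E M \<longleftrightarrow> beta E M = 1"
proof
  assume "series_parallel_matroid E M"
  then have "beta E M \<le> 1" using series_parallel_beta_le mat
      unfolding series_parallel_matroid_def by blast
  moreover have "0 < beta E M" using beta_pos_iff_connected(1)[OF mat two] conn by simp
  ultimately show "beta E M = 1" by simp
next
  assume "beta E M = 1"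
  moreover have "E \<noteq> {}" using two by auto
  ultimately show "series_parallel_matroid E M" using beta_one_imp_series_parallel[OF mat] by blast
qed

section \<open>Valuated exchange and initial matroids\<close>

lemma finite_argmin:
  fixes f :: "'a \<Rightarrow> real"
  assumes "finite S" "S \<noteq> {}"
  obtains x where "x \<in> S" "\<forall>y\<in>S. f x \<le> f y"
proof -
  have "Min (f ` S) \<in> f ` S" using assms by simp
  then obtain x where x: "x \<in> S" "f x = Min (f ` S)" by auto
  then show ?thesis using that assms by simp
qed

lemma card_exchange:
  assumes "finite B" "i \<in> B" "j \<notin> B"
  shows "card (insert j (B - {i})) = card B"
proof -
  have "card (insert j (B - {i})) = Suc (card (B - {i}))" using assms
      by (intro card_insert_disjoint) auto
  then show ?thesis using card_Suc_Diff1[OF assms(1,2)] by simp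
qed

text \<open>If the first entry were strictly below the other two, the minimum would be attained only
  once.\<close>

lemma min_attained_twice_three:
  assumes "min_attained_twice (nth [a, b, c]) {..<3}"
  shows "min b c \<le> a"
proof -
  have "{..<3} = {0, 1, 2 :: nat}" by auto
  with assms show ?thesis
    unfolding min_attained_twice_def by (simp add: numeral_2_eq_2) linarith
qed

lemma three_term_min:
  assumes "tropical_plucker d p" "card S + 2 = d" "distinct [i, j, k, l]" "{i, j, k, l} \<inter> S = {}"
  shows "min (p (S \<union> {i, k}) + p (S \<union> {j, l})) (p (S \<union> {i, l}) + p (S \<union> {j, k}))
    \<le> p (S \<union> {i, j}) + p (S \<union> {k, l})"
proof -
  have "min_attained_twice
          (nth [p (S \<union> {i, j}) + p (S \<union> {k, l}),
                p (S \<union> {i, k}) + p (S \<union> {j, l}),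
                p (S \<union> {i, l}) + p (S \<union> {j, k})]) {..<3}"
    by (rule assms(1)[unfolded tropical_plucker_def, rule_format]) (intro conjI assms(2-4))
  then show ?thesis by (rule min_attained_twice_three)
qed

lemma sum_Un_pair:
  fixes g :: "'a::finite \<Rightarrow> real"
  assumes "i \<noteq> j" "i \<notin> S" "j \<notin> S"
  shows "sum g (S \<union> {i, j}) = sum g S + g i + g j"
proof -
  have "S \<union> {i, j} = insert i (insert j S)" by auto
  then show ?thesis using assms by simp
qed

text \<open>After adding a linear function to \<open>p\<close>, all the values \<open>p (I - i + k)\<close> agree with \<open>p I\<close>,
  and it remains to find an exchange that does not increase the value at \<open>K\<close>. This is done by
  induction on the distance from \<open>K\<close> to \<open>I\<close>, moving \<open>K\<close> closer by a cheapest exchange.\<close>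

lemma valuated_exchange:
  fixes p :: "'n::finite set \<Rightarrow> real"
  assumes pl: "tropical_plucker d p" and "card I = d" "card K = d" "i \<in> I" "i \<notin> K"
  shows "\<exists>k\<in>K - I. p (insert k (I - {i})) + p (insert i (K - {k})) \<le> p I + p K"
proof -
  define g where "g j = (if j \<in> I then 0 else p I - p (insert j (I - {i})))" for j
  define q where "q J = p J + sum g J" for J
  have qI: "q I = p I" by (simp add: q_def g_def)
  have qk: "q (insert k (I - {i})) = p I" if "k \<notin> I" for k
    using that by (simp add: q_def g_def)
  have three: "min (q (S \<union> {a, c}) + q (S \<union> {b, e})) (q (S \<union> {a, e}) + q (S \<union> {b, c}))
    \<le> q (S \<union> {a, b}) + q (S \<union> {c, e})"
    if "card S + 2 = d" "distinct [a, b, c, e]" "{a, b, c, e} \<inter> S = {}" for S a b c e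
    using three_term_min[OF pl that] that by (auto simp: q_def sum_Un_pair)
  have "\<exists>k\<in>K - I. q (insert i (K - {k})) \<le> q K" if "card K = d" "i \<notin> K" for K
    using that
  proof (induction "card (K - I)" arbitrary: K rule: less_induct)
    case less
    have "card (I - K) = card (K - I)"
      using assms(2) less.prems(1) card_Int_Diff[of I K] card_Int_Diff[of K I]
          by (simp add: Int_commute)
    show ?case
    proof (cases "I - K = {i}")
      case True
      then have "card (K - I) = 1" using \<open>card (I - K) = card (K - I)\<close> by simp
      then obtain k where k: "K - I = {k}" by (auto simp: card_1_singleton_iff)
      then have kK: "k \<in> K - I" "k \<notin> I" by auto
      have "insert i (K - {k}) = I" "insert k (I - {i}) = K" using True k by auto
      then have "q (insert i (K - {k})) = q K" using qk[OF kK(2)] qI by simp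
      then show ?thesis using kK(1) by (intro bexI[of _ k]) auto
    next
      case False
      moreover have "i \<in> I - K" using assms(4) less.prems(2) by simp
      ultimately obtain i0 where i0: "i0 \<in> I" "i0 \<notin> K" "i0 \<noteq> i"
        by (metis Diff_iff insert_absorb insert_not_empty is_singletonI' is_singleton_the_elem singletonD)
      have "card (I - K) \<noteq> 0" using i0 by auto
      then have "K - I \<noteq> {}" using \<open>card (I - K) = card (K - I)\<close> by auto
      then obtain k0 where k0: "k0 \<in> K - I"
          "\<forall>k\<in>K - I. q (insert i0 (K - {k0})) \<le> q (insert i0 (K - {k}))"
        using finite_argmin[of "K - I" "\<lambda>k. q (insert i0 (K - {k}))"] by auto
      let ?K = "insert i0 (K - {k0})"
      show ?thesis
      proof (rule ccontr)
        assume "\<not> ?thesis"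
        then have bad: "q K < q (insert i (K - {k}))" if "k \<in> K - I" for k using that by force
        have "?K - I = (K - I) - {k0}" using i0 by auto
        then have "card (?K - I) < card (K - I)" using k0(1) card_Diff1_less[of "K - I" k0] by simp
        moreover have "card ?K = d" using less.prems(1) k0(1) i0 card_exchange[of K k0 i0] by simp
        moreover have "i \<notin> ?K" using i0 less.prems(2) by auto
        ultimately obtain k where k: "k \<in> ?K - I" "q (insert i (?K - {k})) \<le> q ?K"
          using less.hyps by blast
        then have kK: "k \<in> K - I" "k \<noteq> k0" using i0 by auto
        \<comment> \<open>In the three-term relation on \<open>i0\<close>, \<open>i\<close>,
          \<open>k0\<close>, \<open>k\<close>, the induction hypothesis bounds the term on the right
          by \<open>q ?K + q K\<close>, whereas failure at \<open>K\<close> and the choice of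
          \<open>k0\<close> put both alternatives strictly above that value.\<close>
        let ?S = "K - {k0, k}"
        have cS: "card ?S + 2 = d"
        proof -
          have "card ?S = card K - card {k0, k}" using kK k0 by (intro card_Diff_subset) auto
          moreover have "card {k0, k} \<le> card K" using kK k0 by (intro card_mono) auto
          ultimately show ?thesis using less.prems(1) kK by simp
        qed
        have "distinct [i0, i, k0, k]" "{i0, i, k0, k} \<inter> ?S = {}"
          using i0 kK k0 assms(4) less.prems(2) by auto
        from three[OF cS this]
        have "min (q (?S \<union> {i0, k0}) + q (?S \<union> {i, k})) (q (?S \<union> {i0, k}) + q (?S \<union> {i, k0}))
          \<le> q (?S \<union> {i0, i}) + q (?S \<union> {k0, k})" .
        moreover have "?S \<union> {i0, k0} = insert i0 (K - {k})" "?S \<union> {i, k} = insert i (K - {k0})"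
          "?S \<union> {i0, k} = ?K" "?S \<union> {i, k0} = insert i (K - {k})"
          "?S \<union> {i0, i} = insert i (?K - {k})" "?S \<union> {k0, k} = K"
          using i0 kK k0 less.prems(2) assms(4) by auto
        ultimately have "min (q (insert i0 (K - {k})) + q (insert i (K - {k0}))) (q ?K + q (insert i (K - {k})))
          \<le> q (insert i (?K - {k})) + q K" by simp
        moreover have "q ?K \<le> q (insert i0 (K - {k}))" using k0(2) kK by blast
        moreover have "q K < q (insert i (K - {k0}))" "q K < q (insert i (K - {k}))"
          using bad k0(1) kK(1) by blast+
        ultimately show False using k(2) by linarith
      qed
    qed
  qed
  then obtain k where k: "k \<in> K - I" "q (insert i (K - {k})) \<le> q K" using assms by blast
  have "sum g (insert i (K - {k})) = sum g K - g k"
  proof -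
    have "sum g (insert i (K - {k})) = g i + sum g (K - {k})" using assms by simp
    moreover have "sum g (K - {k}) = sum g K - g k" using k by (simp add: sum_diff1)
    moreover have "g i = 0" using assms by (simp add: g_def)
    ultimately show ?thesis by simp
  qed
  then have "p (insert i (K - {k})) \<le> p K + g k" using k by (simp add: q_def)
  then show ?thesis using k by (intro bexI[of _ k]) (auto simp: g_def)
qed

section \<open>Initial matroids and local optimality\<close>

definition reduced_value :: "('n::finite set \<Rightarrow> real) \<Rightarrow> real ^ 'n \<Rightarrow> 'n set \<Rightarrow> real" where
  "reduced_value p w I = p I - (\<Sum>i\<in>I. w $ i)"

lemma initial_bases_iff:
  "I \<in> initial_bases d p w \<longleftrightarrow>
     card I = d \<and> (\<forall>J. card J = d \<longrightarrow> reduced_value p w I \<le> reduced_value p w J)"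
  by (simp add: initial_bases_def reduced_value_def)

lemma initial_bases_eq_value:
  assumes "I \<in> initial_bases d p w"
  shows "J \<in> initial_bases d p w \<longleftrightarrow> card J = d \<and> reduced_value p w J = reduced_value p w I"
proof
  assume "J \<in> initial_bases d p w"
  then show "card J = d \<and> reduced_value p w J = reduced_value p w I"
    using assms unfolding initial_bases_iff by (simp add: order_antisym)
next
  assume "card J = d \<and> reduced_value p w J = reduced_value p w I"
  then show "J \<in> initial_bases d p w" using assms unfolding initial_bases_iff by simp
qed

lemma reduced_value_exchange:
  assumes "i \<in> B" "j \<notin> B"
  shows "reduced_value p w (insert j (B - {i})) =
    p (insert j (B - {i})) - p B + reduced_value p w B + w $ i - w $ j"
  using assms by (simp add: reduced_value_def sum_diff1)

lemma reduced_value_valuated_exchange: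
  fixes p :: "'n::finite set \<Rightarrow> real"
  assumes "tropical_plucker d p" "card I = d" "card K = d" "i \<in> I" "i \<notin> K"
  obtains k where "k \<in> K" "k \<notin> I"
    "reduced_value p w (insert k (I - {i})) + reduced_value p w (insert i (K - {k}))
      \<le> reduced_value p w I + reduced_value p w K"
proof -
  obtain k where "k \<in> K - I" "p (insert k (I - {i})) + p (insert i (K - {k})) \<le> p I + p K"
    using valuated_exchange[OF assms] by blast
  then show ?thesis
    using that[of k] reduced_value_exchange[of i I k p w] reduced_value_exchange[of k K i p w] assms by simp
qed

lemma initial_bases_nonempty:
  fixes p :: "'n::finite set \<Rightarrow> real"
  assumes "d \<le> CARD('n)"
  obtains I where "I \<in> initial_bases d p w"
proof -
  obtain I0 :: "'n set" where "card I0 = d" using obtain_subset_with_card_n[OF assms] by metis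
  then have "{J :: 'n set. card J = d} \<noteq> {}" by blast
  then obtain I where "I \<in> {J. card J = d}"
      "\<forall>J\<in>{J. card J = d}. reduced_value p w I \<le> reduced_value p w J"
    by (rule finite_argmin[of "{J :: 'n set. card J = d}" "reduced_value p w", rotated]) auto
  then have "I \<in> initial_bases d p w" by (simp add: initial_bases_iff)
  then show ?thesis by (rule that)
qed

text \<open>Two minimisers exchange into two sets of no larger total value, so both of these are
  minimisers again.\<close>

lemma initial_bases_matroid:
  fixes p :: "'n::finite set \<Rightarrow> real"
  assumes pl: "tropical_plucker d p" and d: "d \<le> CARD('n)"
  shows "matroid UNIV (initial_bases d p w)"
  unfolding matroid_def
proof (intro conjI ballI)
  show "initial_bases d p w \<noteq> {}" using initial_bases_nonempty[OF d, of p w] by blast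
next
  fix I K assume IK: "I \<in> initial_bases d p w" "K \<in> initial_bases d p w"
  then have c: "card I = d" "card K = d" by (auto simp: initial_bases_iff)
  then show "card I = card K" by simp
  fix i assume i: "i \<in> I - K"
  then obtain k where k: "k \<in> K" "k \<notin> I"
    "reduced_value p w (insert k (I - {i})) + reduced_value p w (insert i (K - {k}))
      \<le> reduced_value p w I + reduced_value p w K"
    using reduced_value_valuated_exchange[OF pl c] by blast
  have c': "card (insert k (I - {i})) = d" "card (insert i (K - {k})) = d"
    using card_exchange[of I i k] card_exchange[of K k i] i k c by auto
  then have "reduced_value p w I \<le> reduced_value p w (insert k (I - {i}))"
    "reduced_value p w K \<le> reduced_value p w (insert i (K - {k}))"
    using IK by (auto simp: initial_bases_iff)
  moreover have "reduced_value p w I = reduced_value p w K"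
    using initial_bases_eq_value[OF IK(2)] IK(1) by blast
  ultimately have "insert k (I - {i}) \<in> initial_bases d p w"
      "insert i (K - {k}) \<in> initial_bases d p w"
    using initial_bases_eq_value[OF IK(1)] c' k(3) by auto
  then show "\<exists>k\<in>K - I. insert k (I - {i}) \<in> initial_bases d p w
      \<and> insert i (K - {k}) \<in> initial_bases d p w"
    using k by blast
qed auto

text \<open>Valuated exchange moves any \<open>K\<close> one step towards \<open>B\<close>. The
  exchanged neighbour of \<open>B\<close> is no cheaper than \<open>B\<close>, so the set replacing
  \<open>K\<close> is no dearer than \<open>K\<close>.\<close>

lemma initial_bases_local:
  fixes p :: "'n::finite set \<Rightarrow> real"
  assumes pl: "tropical_plucker d p" and B: "card B = d"
    and loc: "\<And>i j. i \<in> B \<Longrightarrow> j \<notin> B \<Longrightarrow> w $ j - w $ i \<le> p (insert j (B - {i})) - p B"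
  shows "B \<in> initial_bases d p w"
proof -
  have "reduced_value p w B \<le> reduced_value p w K" if "card K = d" for K
    using that
  proof (induction "card (B - K)" arbitrary: K rule: less_induct)
    case less
    show ?case
    proof (cases "B \<subseteq> K")
      case True
      then have "B = K" using B less.prems by (intro card_subset_eq) auto
      then show ?thesis by simp
    next
      case False
      then obtain i where i: "i \<in> B" "i \<notin> K" by blast
      obtain k where k: "k \<in> K" "k \<notin> B"
        "reduced_value p w (insert k (B - {i})) + reduced_value p w (insert i (K - {k}))
          \<le> reduced_value p w B + reduced_value p w K"
        using reduced_value_valuated_exchange[OF pl B less.prems i] by blast
      have "card (insert i (K - {k})) = d" using card_exchange[of K k i] k i less.prems by simp
      moreover have "B - insert i (K - {k}) \<subset> B - K" using i k by auto
      then have "card (B - insert i (K - {k})) < card (B - K)" by (intro psubset_card_mono) auto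
      ultimately have "reduced_value p w B \<le> reduced_value p w (insert i (K - {k}))"
          using less.hyps by blast
      moreover have "reduced_value p w B \<le> reduced_value p w (insert k (B - {i}))"
        using loc[OF i(1) k(2)] reduced_value_exchange[OF i(1) k(2), of p w] by simp
      ultimately show ?thesis using k(3) by simp
    qed
  qed
  then show ?thesis using B by (simp add: initial_bases_iff)
qed

lemma initial_bases_exchange_iff:
  assumes B: "B \<in> initial_bases d p w" and ij: "i \<in> B" "j \<notin> B"
  shows "insert j (B - {i}) \<in> initial_bases d p w \<longleftrightarrow> w $ j - w $ i = p (insert j (B - {i})) - p B"
    and "w $ j - w $ i \<le> p (insert j (B - {i})) - p B"
proof -
  have c: "card (insert j (B - {i})) = d" using B card_exchange[of B i j] ij
      by (simp add: initial_bases_iff)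
  show "insert j (B - {i}) \<in> initial_bases d p w \<longleftrightarrow> w $ j - w $ i = p (insert j (B - {i})) - p B"
    using initial_bases_eq_value[OF B, of
        "insert j (B - {i})"] c reduced_value_exchange[OF ij, of p w] by auto
  have "reduced_value p w B \<le> reduced_value p w (insert j (B - {i}))" using B c
      by (simp add: initial_bases_iff)
  then show "w $ j - w $ i \<le> p (insert j (B - {i})) - p B"
      using reduced_value_exchange[OF ij, of p w] by simp
qed

lemma initial_bases_shift:
  assumes "\<And>i. w' $ i - w $ i = t"
  shows "initial_bases d p w' = initial_bases d p w"
proof -
  have "reduced_value p w' I = reduced_value p w I - t * real (card I)" for I
  proof -
    have "(\<Sum>i\<in>I. w' $ i) = (\<Sum>i\<in>I. w $ i + t)" using assms
        by (intro sum.cong) (auto simp: algebra_simps)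
    then show ?thesis by (simp add: reduced_value_def sum.distrib)
  qed
  then show ?thesis unfolding set_eq_iff initial_bases_iff by auto
qed

text \<open>The coordinates of \<open>w\<close> are determined one after the other, in increasing order.\<close>

lemma ex_initial_bases_with_beta_basis:
  fixes p :: "'n::finite set \<Rightarrow> real"
  assumes pl: "tropical_plucker d p" and B: "card B = d" and inj: "inj ord"
    and m: "m \<in> B" "ord m = 0" and m2: "m2 \<notin> B" "ord m2 = Suc 0"
  shows "\<exists>w. B \<in> beta_bases UNIV ord (initial_bases d p w)"
proof -
  define c where "c i j = p (insert j (B - {i})) - p B" for i j
  have step: "\<exists>w :: 'n \<Rightarrow> real.
     (\<forall>i j. i \<in> B \<longrightarrow> j \<notin> B \<longrightarrow> ord i < k \<longrightarrow> ord j < k \<longrightarrow> w j - w i \<le> c i j) \<and>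
     (\<forall>j. j \<notin> B \<longrightarrow> ord j < k \<longrightarrow> (\<exists>i. i \<in> B \<and> ord i < ord j \<and> w j - w i = c i j)) \<and>
     (\<forall>i. i \<in> B \<longrightarrow> ord i < k \<longrightarrow> 0 < ord i \<longrightarrow> (\<exists>j. j \<notin> B \<and> ord j < ord i \<and> w j - w i = c i j))" for k
  proof (induction k)
    case (Suc k)
    then obtain w :: "'n \<Rightarrow> real" where
      w1: "\<And>i j. i \<in> B \<Longrightarrow> j \<notin> B \<Longrightarrow> ord i < k \<Longrightarrow> ord j < k \<Longrightarrow> w j - w i \<le> c i j"
      and w2: "\<And>j. j \<notin> B \<Longrightarrow> ord j < k \<Longrightarrow> \<exists>i. i \<in> B \<and> ord i < ord j \<and> w j - w i = c i j"
      and w3: "\<And>i. i \<in> B \<Longrightarrow> ord i < k \<Longrightarrow> 0 < ord i \<Longrightarrow> \<exists>j. j \<notin> B \<and> ord j < ord i \<and> w j - w i = c i j"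
      by blast
    show ?case
    proof (cases "\<exists>x. ord x = k")
      case False
      then have "ord x < Suc k \<longleftrightarrow> ord x < k" for x by (metis less_SucE less_SucI)
      then show ?thesis using w1 w2 w3 by (intro exI[of _ w]) auto
    next
      case True
      then obtain x where x: "ord x = k" by blast
      have lt: "ord y < Suc k \<longleftrightarrow> y = x \<or> ord y < k" for y
        using inj x by (metis injD less_Suc_eq)
      \<comment> \<open>The least upper bound value if \<open>x\<close> is outside \<open>B\<close>,
        the greatest lower bound value if it is inside. At \<open>k = 0\<close> there is no bound
        and \<open>v\<close> is arbitrary, which is the free common shift.\<close>
      obtain v where v1: "x \<notin> B \<Longrightarrow> (\<forall>i\<in>B. ord i < k \<longrightarrow> v - w i \<le> c i x) \<and> (\<exists>i\<in>B. ord i < k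
          \<and> v - w i = c i x)"
        and v2: "x \<in> B \<Longrightarrow> 0 < k \<Longrightarrow> (\<forall>j. j \<notin> B \<longrightarrow> ord j < k \<longrightarrow> w j - v \<le> c x j) \<and> (\<exists>j. j \<notin> B
            \<and> ord j < k \<and> w j - v = c x j)"
      proof (cases "x \<in> B")
        case False
        then have "0 < k" using m x by (metis gr0I inj injD)
        then have "{i \<in> B. ord i < k} \<noteq> {}" using m by auto
        then obtain i0 where "i0 \<in> {i \<in> B. ord i < k}"
            "\<forall>i\<in>{i \<in> B. ord i < k}. w i0 + c i0 x \<le> w i + c i x"
          by (rule finite_argmin[of "{i \<in> B. ord i < k}" "\<lambda>i. w i + c i x", rotated]) auto
        then show ?thesis using that[of "w i0 + c i0 x"] False by force
      next
        case xB: True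
        show ?thesis
        proof (cases "k = 0")
          case True
          then show ?thesis using that xB by blast
        next
          case False
          \<comment> \<open>Position one is taken by \<open>m2\<close>, which lies outside
            \<open>B\<close>; so a later element of \<open>B\<close> always has an earlier partner
            outside \<open>B\<close>.\<close>
          then have "1 < k" using m2 x xB inj by (metis One_nat_def injD less_one linorder_neqE_nat)
          then have "{j. j \<notin> B \<and> ord j < k} \<noteq> {}" using m2 by auto
          then obtain j0 where "j0 \<in> {j. j \<notin> B \<and> ord j < k}"
            "\<forall>j\<in>{j. j \<notin> B \<and> ord j < k}. c x j0 - w j0 \<le> c x j - w j"
            by (rule finite_argmin[of "{j. j \<notin> B \<and> ord j < k}" "\<lambda>j. c x j - w j", rotated]) auto
          then show ?thesis using that[of "w j0 - c x j0"] xB by force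
        qed
      qed
      define u where "u = w(x := v)"
      have ux: "u x = v" and uy: "\<And>y. ord y < k \<Longrightarrow> u y = w y" using x by (auto simp: u_def)
      have nx: "\<not> ord x < k" using x by simp
      show ?thesis
      proof (intro exI[of _ u] conjI allI impI)
        fix i j assume "i \<in> B" "j \<notin> B" "ord i < Suc k" "ord j < Suc k"
        moreover have "0 < k" if "i = x" "ord j < k" using that by simp
        ultimately show "u j - u i \<le> c i j"
          using w1[of i j] v1 v2 ux uy[of i] uy[of j] unfolding lt by auto
      next
        fix j assume j: "j \<notin> B" "ord j < Suc k"
        show "\<exists>i. i \<in> B \<and> ord i < ord j \<and> u j - u i = c i j"
        proof (cases "j = x")
          case True
          then show ?thesis using v1 j ux uy x by metis
        next
          case False
          then have "ord j < k" using j lt by blast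
          moreover obtain i where "i \<in> B" "ord i < ord j" "w j - w i = c i j"
              using w2[OF j(1)] \<open>ord j < k\<close> by blast
          ultimately show ?thesis using uy[of i] uy[of j] by (intro exI[of _ i]) auto
        qed
      next
        fix i assume i: "i \<in> B" "ord i < Suc k" "0 < ord i"
        show "\<exists>j. j \<notin> B \<and> ord j < ord i \<and> u j - u i = c i j"
        proof (cases "i = x")
          case True
          then show ?thesis using v2 i ux uy x by metis
        next
          case False
          then have "ord i < k" using i lt by blast
          moreover obtain j where "j \<notin> B" "ord j < ord i" "w j - w i = c i j"
              using w3[OF i(1)] \<open>ord i < k\<close> i(3) by blast
          ultimately show ?thesis using uy[of i] uy[of j] by (intro exI[of _ j]) auto
        qed
      qed
    qed
  qed simp
  have all: "ord x < Suc (Max (range ord))" for x by (simp add: le_imp_less_Suc)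
  obtain w :: "'n \<Rightarrow> real" where
    w: "\<forall>i j. i \<in> B \<longrightarrow> j \<notin> B \<longrightarrow> w j - w i \<le> c i j"
       "\<forall>j. j \<notin> B \<longrightarrow> (\<exists>i. i \<in> B \<and> ord i < ord j \<and> w j - w i = c i j)"
       "\<forall>i. i \<in> B \<longrightarrow> 0 < ord i \<longrightarrow> (\<exists>j. j \<notin> B \<and> ord j < ord i \<and> w j - w i = c i j)"
    using step[of "Suc (Max (range ord))"] all by auto
  define W where "W = (\<chi> i. w i)"
  have W: "W $ i = w i" for i by (simp add: W_def)
  have BM: "B \<in> initial_bases d p W"
    by (rule initial_bases_local[OF pl B]) (use w(1) W in \<open>auto simp: c_def\<close>)
  have "B \<in> beta_bases UNIV ord (initial_bases d p W)"
  proof (rule beta_basesI[OF BM])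
    fix j assume "j \<notin> B"
    then obtain i where "i \<in> B" "ord i < ord j" "w j - w i = c i j" using w(2) by blast
    then show "\<exists>i\<in>B. ord i < ord j \<and> insert j (B - {i}) \<in> initial_bases d p W"
      using initial_bases_exchange_iff(1)[OF BM _ \<open>j \<notin> B\<close>, of i] W by (auto simp: c_def)
  next
    fix i k assume i: "i \<in> B" "ord k < ord i"
    then have "0 < ord i" by simp
    then obtain j where "j \<notin> B" "ord j < ord i" "w j - w i = c i j" using w(3) i by blast
    then show "\<exists>j\<in>UNIV - B. ord j < ord i \<and> insert j (B - {i}) \<in> initial_bases d p W"
      using initial_bases_exchange_iff(1)[OF BM i(1), of j] W by (auto simp: c_def)
  qed
  then show ?thesis by blast
qed

text \<open>Where an exchange is tight for \<open>w\<close>, it gives an inequality for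
  \<open>w'\<close>, and conversely. As \<open>w - w'\<close> is already constant on smaller
  elements, the two opposite inequalities extend this to the next element.\<close>

lemma initial_bases_with_beta_basis_unique:
  fixes p :: "'n::finite set \<Rightarrow> real"
  assumes inj: "inj ord" and B: "B \<in> beta_bases UNIV ord (initial_bases d p w)"
    and B': "B \<in> beta_bases UNIV ord (initial_bases d p w')"
  shows "initial_bases d p w = initial_bases d p w'"
proof -
  note D = beta_basesD[OF B] and D' = beta_basesD[OF B']
  obtain m :: 'n where m: "\<forall>x. ord m \<le> ord x" using obtain_first[of "UNIV :: 'n set" ord] by auto
  have low: "w $ x - w' $ x = w $ m - w' $ m" for x
  proof (induction "ord x" arbitrary: x rule: less_induct)
    case less
    show ?case
    proof (cases "x = m")
      case False
      then have lt: "ord m < ord x" using m inj by (metis injD le_neq_implies_less)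
      show ?thesis
      proof (cases "x \<in> B")
        case True
        obtain j where j: "j \<notin> B" "ord j < ord x" "insert j (B - {x}) \<in> initial_bases d p w"
          using D(3)[OF True _ lt] by blast
        obtain j' where j': "j' \<notin> B" "ord j' < ord x" "insert j' (B - {x}) \<in> initial_bases d p w'"
          using D'(3)[OF True _ lt] by blast
        show ?thesis
          using less.hyps[OF j(2)] less.hyps[OF j'(2)]
            initial_bases_exchange_iff[OF D(1) True j(1)] initial_bases_exchange_iff[OF D(1) True j'(1)]
            initial_bases_exchange_iff[OF D'(1) True j(1)] initial_bases_exchange_iff[OF D'(1) True j'(1)]
            j(3) j'(3) by auto
      next
        case False
        obtain i where i: "i \<in> B" "ord i < ord x" "insert x (B - {i}) \<in> initial_bases d p w"
          using D(2)[OF _ False] by blast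
        obtain i' where i': "i' \<in> B" "ord i' < ord x" "insert x (B - {i'}) \<in> initial_bases d p w'"
          using D'(2)[OF _ False] by blast
        show ?thesis
          using less.hyps[OF i(2)] less.hyps[OF i'(2)]
            initial_bases_exchange_iff[OF D(1) i(1) False] initial_bases_exchange_iff[OF D(1) i'(1) False]
            initial_bases_exchange_iff[OF D'(1) i(1) False] initial_bases_exchange_iff[OF D'(1) i'(1) False]
            i(3) i'(3) by auto
      qed
    qed simp
  qed
  show ?thesis by (rule initial_bases_shift[OF low])
qed

text \<open>An element outside \<open>B\<close> needs a smaller partner, which the first element
  lacks. The second has only the first below it, so inside \<open>B\<close> it would have no partner
  outside.\<close>

lemma beta_basis_first_two:
  assumes inj: "inj ord" and B: "B \<in> beta_bases UNIV ord M" and m: "ord m = 0"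
      and m2: "ord m2 = Suc 0"
  shows "m \<in> B" "m2 \<notin> B"
proof -
  note D = beta_basesD[OF B]
  show mB: "m \<in> B" using D(2)[of m] m by auto
  show "m2 \<notin> B"
  proof
    assume "m2 \<in> B"
    then obtain j where "j \<notin> B" "ord j < ord m2" using D(3)[of m2 m] m m2 by auto
    then show False using mB m m2 inj by (metis injD less_Suc0)
  qed
qed

text \<open>Any two bases are joined by a chain of single exchanges, so invariance along each of
  them suffices.\<close>

lemma constant_card_of_exchange:
  assumes M: "matroid E M"
    and ex: "\<And>B i j. B \<in> M \<Longrightarrow> i \<in> B \<Longrightarrow> j \<notin> B \<Longrightarrow> insert j (B - {i}) \<in> M \<Longrightarrow> i \<in> A \<longleftrightarrow> j \<in> A"
    and IK: "I \<in> M" "K \<in> M"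
  shows "card (I \<inter> A) = card (K \<inter> A)"
  using IK(1)
proof (induction "card (I - K)" arbitrary: I rule: less_induct)
  case less
  have fin: "finite I" "finite K" using matroid_finite_basis[OF M] less.prems IK by auto
  show ?case
  proof (cases "I \<subseteq> K")
    case True
    then have "I = K" using fin matroid_card[OF M less.prems IK(2)] by (intro card_subset_eq) auto
    then show ?thesis by simp
  next
    case False
    then obtain i where i: "i \<in> I" "i \<notin> K" by blast
    obtain k where k: "k \<in> K" "k \<notin> I" "insert k (I - {i}) \<in> M"
      using matroid_exchange[OF M less.prems IK(2) i] by metis
    have "insert k (I - {i}) - K \<subset> I - K" using i k by auto
    then have "card (insert k (I - {i}) - K) < card (I - K)" using fin
        by (intro psubset_card_mono) auto
    then have "card (insert k (I - {i}) \<inter> A) = card (K \<inter> A)" using less.hyps k(3) by blast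
    moreover have "card (insert k (I - {i}) \<inter> A) = card (I \<inter> A)"
    proof (cases "i \<in> A")
      case True
      then have "k \<in> A" using ex[OF less.prems i(1) k(2,3)] by blast
      then have "insert k (I - {i}) \<inter> A = insert k ((I \<inter> A) - {i})" by auto
      then show ?thesis using card_exchange[of "I \<inter> A" i k] fin True i k by simp
    next
      case False
      then have "k \<notin> A" using ex[OF less.prems i(1) k(2,3)] by blast
      then have "insert k (I - {i}) \<inter> A = I \<inter> A" using False by auto
      then show ?thesis by simp
    qed
    ultimately show ?thesis by simp
  qed
qed

text \<open>Exchanges available in both matroids are tight for both weights, so they stay within a
  level set of \<open>w' - w\<close>; such a level set is a separator unless it is everything. This
  yields maximality of connected cells as well as their fibres.\<close>

lemma connected_initial_bases_rigid:
  fixes p :: "'n::finite set \<Rightarrow> real"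
  assumes pl: "tropical_plucker d p" and d: "d \<le> CARD('n)"
    and conn: "connected_bases UNIV (initial_bases d p w)"
    and sub: "initial_bases d p w \<subseteq> initial_bases d p w'"
  shows "\<exists>t. \<forall>i. w' $ i - w $ i = t"
proof -
  let ?M = "initial_bases d p w"
  note mat = initial_bases_matroid[OF pl d, of w]
  obtain a :: 'n where True by simp
  define A where "A = {i. w' $ i - w $ i = w' $ a - w $ a}"
  have "i \<in> A \<longleftrightarrow> j \<in> A" if B: "B \<in> ?M" "i \<in> B" "j \<notin> B" "insert j (B - {i}) \<in> ?M" for B i j
  proof -
    have B': "B \<in> initial_bases d p w'" "insert j (B - {i}) \<in> initial_bases d p w'" using B sub
        by auto
    have "w $ j - w $ i = w' $ j - w' $ i"
      using initial_bases_exchange_iff(1)[OF B(1-3)] initial_bases_exchange_iff(1)[OF B'(1) B(2,3)] B(4) B'(2)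
      by simp
    then show ?thesis by (auto simp: A_def)
  qed
  then have "card (I \<inter> A) = card (K \<inter> A)" if "I \<in> ?M" "K \<in> ?M" for I K
    using constant_card_of_exchange[OF mat _ that] by metis
  then have "\<not> (A \<noteq> {} \<and> A \<subset> UNIV)" using conn unfolding connected_bases_def by metis
  moreover have "a \<in> A" by (simp add: A_def)
  ultimately have "A = UNIV" by blast
  then show ?thesis by (auto simp: A_def)
qed

text \<open>Connectedness enters through the absence of loops. A minimising index \<open>j0\<close>
  lies in some initial basis \<open>I\<close>; exchanging \<open>j0\<close> between \<open>I\<close>
  and \<open>J - {j0}\<close> costs nothing on the side of \<open>J\<close>, and the incoming
  \<open>k\<close> is a second minimising index.\<close>

lemma connected_imp_tropical_linear_space:
  fixes p :: "'n::finite set \<Rightarrow> real"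
  assumes pl: "tropical_plucker d p"
    and loopfree: "\<And>j. \<exists>I\<in>initial_bases d p w. j \<in> I"
  shows "w \<in> tropical_linear_space d p"
  unfolding tropical_linear_space_def min_attained_twice_def
proof (intro CollectI allI impI)
  fix J :: "'n set" assume J: "card J = d + 1"
  let ?f = "\<lambda>j. p (J - {j}) + w $ j"
  have "J \<noteq> {}" using J by auto
  then obtain j0 where j0: "j0 \<in> J" "\<forall>j\<in>J. ?f j0 \<le> ?f j" using finite_argmin[of J ?f] by auto
  have f: "?f j = reduced_value p w (J - {j}) + (\<Sum>i\<in>J. w $ i)" if "j \<in> J" for j
    using that by (simp add: reduced_value_def sum_diff1)
  obtain I where I: "I \<in> initial_bases d p w" "j0 \<in> I" using loopfree by blast
  let ?K = "J - {j0}"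
  have c: "card I = d" "card ?K = d" using I J j0 by (auto simp: initial_bases_iff)
  obtain k where k: "k \<in> ?K" "k \<notin> I"
    "reduced_value p w (insert k (I - {j0})) + reduced_value p w (insert j0 (?K - {k}))
      \<le> reduced_value p w I + reduced_value p w ?K"
    using reduced_value_valuated_exchange[OF pl c I(2)] by blast
  have "card (insert k (I - {j0})) = d" using card_exchange[of I j0 k] I k c by simp
  then have "reduced_value p w I \<le> reduced_value p w (insert k (I - {j0}))"
    using I by (simp add: initial_bases_iff)
  moreover have "insert j0 (?K - {k}) = J - {k}" using j0 k by auto
  ultimately have "reduced_value p w (J - {k}) \<le> reduced_value p w (J - {j0})" using k(3) by simp
  then have "?f k \<le> ?f j0" using f[of k] f[of j0] j0 k by simp
  then have "?f j0 = ?f k" using j0 k by force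
  then show "\<exists>i\<in>J. \<exists>j\<in>J. i \<noteq> j \<and> ?f i = ?f j \<and> (\<forall>k\<in>J. ?f i \<le> ?f k)"
    using j0 k by (intro bexI[of _ j0] bexI[of _ k]) auto
qed

section \<open>Regular subdivisions and vertices\<close>

lemma indicator_vec_nth: "indicator_vec I $ i = (if i \<in> I then 1 else 0)"
  by (simp add: indicator_vec_def axis_def sum.delta' eq_commute)

lemma inner_indicator_vec: "w \<bullet> indicator_vec I = (\<Sum>i\<in>I. w $ i)"
  by (simp add: indicator_vec_def inner_sum_right inner_axis)

text \<open>Each indicator vector is a vertex of the cube: the functional with entries
  \<open>1\<close> on \<open>I\<close> and \<open>- 1\<close> off \<open>I\<close> attains its
  maximum over indicator vectors at \<open>I\<close> alone.\<close>

lemma matroid_polytope_subset_iff: "matroid_polytope \<A> \<subseteq> matroid_polytope \<B> \<longleftrightarrow> \<A> \<subseteq> \<B>"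
proof
  assume sub: "matroid_polytope \<A> \<subseteq> matroid_polytope \<B>"
  show "\<A> \<subseteq> \<B>"
  proof
    fix I assume "I \<in> \<A>"
    then have "indicator_vec I \<in> matroid_polytope \<B>"
      using sub hull_inc[of "indicator_vec I" "indicator_vec ` \<A>" convex]
          unfolding matroid_polytope_def by blast
    show "I \<in> \<B>"
    proof (rule ccontr)
      assume "I \<notin> \<B>"
      define v :: "real ^ 'a" where "v = (\<chi> i. if i \<in> I then 1 else - 1)"
      have v: "v \<bullet> indicator_vec J = real (card (J \<inter> I)) - real (card (J - I))" for J
      proof -
        have "v \<bullet> indicator_vec J = (\<Sum>i\<in>J. if i \<in> I then 1 else - 1)"
          by (simp add: inner_indicator_vec v_def)
        also have "\<dots> = (\<Sum>i\<in>J \<inter> I. 1) + (\<Sum>i\<in>J \<inter> - I. - 1)"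
          by (simp add: sum.If_cases Collect_neg_eq)
        finally show ?thesis by (simp add: Diff_eq)
      qed
      have "v \<bullet> indicator_vec J < real (card I)" if "J \<in> \<B>" for J
      proof (cases "J \<subseteq> I")
        case True
        then have "J \<subset> I" using that \<open>I \<notin> \<B>\<close> by blast
        then have "card J < card I" by (intro psubset_card_mono) auto
        moreover have "J \<inter> I = J" "J - I = {}" using True by auto
        ultimately show ?thesis using v[of J] by simp
      next
        case False
        then have "0 < card (J - I)" by (simp add: card_gt_0_iff)
        moreover have "card (J \<inter> I) \<le> card I" by (intro card_mono) auto
        ultimately show ?thesis using v[of J] by simp
      qed
      then have "matroid_polytope \<B> \<subseteq> {x. v \<bullet> x < real (card I)}"
        unfolding matroid_polytope_def by (intro hull_minimal convex_halfspace_lt) auto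
      then show False using \<open>indicator_vec I \<in> matroid_polytope \<B>\<close> v[of I] by auto
    qed
  qed
next
  assume "\<A> \<subseteq> \<B>"
  then show "matroid_polytope \<A> \<subseteq> matroid_polytope \<B>"
    unfolding matroid_polytope_def by (intro hull_mono image_mono)
qed

lemma matroid_polytope_inject: "matroid_polytope \<A> = matroid_polytope \<B> \<longleftrightarrow> \<A> = \<B>"
  using matroid_polytope_subset_iff by (metis order_antisym order_refl)

text \<open>Scaling the inner normal to last coordinate one and changing the sign of the rest gives
  a weight \<open>u\<close> for which the functional is \<open>s\<close> times
  \<open>reduced_value p u\<close>; the lifted points on the face are therefore the
  minimisers.\<close>

lemma lower_face_projection:
  fixes p :: "'n::finite set \<Rightarrow> real"
  assumes s: "s > 0" and c: "\<forall>z\<in>lifted_polytope d p. c \<le> (w, s) \<bullet> z"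
    and F: "F = {z \<in> lifted_polytope d p. (w, s) \<bullet> z = c}" "F \<noteq> {}"
  shows "fst ` F = matroid_polytope (initial_bases d p (- (1 / s) *\<^sub>R w))"
proof -
  define u where "u = - (1 / s) *\<^sub>R w"
  define h where "h I = (indicator_vec I, p I)" for I
  define S where "S = h ` {I. card I = d}"
  have Q: "lifted_polytope d p = convex hull S"
    unfolding lifted_polytope_def S_def h_def by (rule arg_cong[where f = "\<lambda>S. convex hull S"]) auto
  have "finite S" by (simp add: S_def)
  then have "compact S" by (rule finite_imp_compact)
  have "F = convex hull S \<inter> {z. (w, s) \<bullet> z = c}" using F Q by auto
  moreover have "\<dots> face_of convex hull S"
    by (rule face_of_Int_supporting_hyperplane_ge) (use c Q in auto)
  ultimately have "F face_of convex hull S" by simp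
  then obtain S' where S': "S' \<subseteq> S" "F = convex hull S'"
    using face_of_convex_hull_subset[OF \<open>compact S\<close>] by metis
  define T where "T = {z \<in> S. (w, s) \<bullet> z = c}"
  have "S' \<subseteq> T" using S' F hull_subset[of S' convex] unfolding T_def by blast
  then have "F \<subseteq> convex hull T" using S' hull_mono by metis
  moreover have "T \<subseteq> F" using F Q hull_subset[of S convex] unfolding T_def by blast
  then have "convex hull T \<subseteq> F" using S' by (metis hull_minimal convex_convex_hull)
  ultimately have FT: "F = convex hull T" by blast
  have "T \<noteq> {}" using FT F(2) by auto
  have val: "(w, s) \<bullet> h I = s * reduced_value p u I" for I
    using s by (simp add: h_def u_def inner_indicator_vec reduced_value_def sum_negf sum_divide_distrib[symmetric] algebra_simps)
  have T_image: "T = h ` {I. card I = d \<and> s * reduced_value p u I = c}"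
    by (auto simp: T_def S_def val)
  obtain I0 where I0: "card I0 = d" "s * reduced_value p u I0 = c"
    using \<open>T \<noteq> {}\<close> unfolding T_image by blast
  have ge: "c \<le> s * reduced_value p u I" if "card I = d" for I
  proof -
    have "h I \<in> lifted_polytope d p"
      unfolding Q by (rule hull_inc) (use that in \<open>auto simp: S_def\<close>)
    then show ?thesis using c val by metis
  qed
  have I0M: "I0 \<in> initial_bases d p u"
    unfolding initial_bases_iff using I0 ge s by (metis mult_le_cancel_left_pos)
  have "fst ` T = indicator_vec ` initial_bases d p u"
  proof -
    have "fst ` T = indicator_vec ` {I. card I = d \<and> s * reduced_value p u I = c}"
      unfolding T_image by (simp add: image_image h_def)
    also have "{I. card I = d \<and> s * reduced_value p u I = c} = initial_bases d p u"
    proof (rule set_eqI)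
      fix I
      have "s * reduced_value p u I = c \<longleftrightarrow> reduced_value p u I = reduced_value p u I0"
        using I0(2) s by auto
      then show "I \<in> {I. card I = d \<and> s * reduced_value p u I = c} \<longleftrightarrow> I \<in> initial_bases d p u"
        using initial_bases_eq_value[OF I0M, of I] by simp
    qed
    finally show ?thesis .
  qed
  then show ?thesis
    unfolding FT matroid_polytope_def u_def[symmetric]
        using convex_hull_linear_image[OF linear_fst, of T] by simp
qed

lemma regular_subdivision_eq:
  fixes p :: "'n::finite set \<Rightarrow> real"
  assumes d: "d \<le> CARD('n)"
  shows "regular_subdivision d p = range (\<lambda>w. matroid_polytope (initial_bases d p w))"
proof (intro set_eqI iffI)
  fix C assume "C \<in> regular_subdivision d p"
  then show "C \<in> range (\<lambda>w. matroid_polytope (initial_bases d p w))"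
    unfolding regular_subdivision_def lower_face_def using lower_face_projection by blast
next
  fix C assume "C \<in> range (\<lambda>w. matroid_polytope (initial_bases d p w))"
  then obtain w where C: "C = matroid_polytope (initial_bases d p w)" by blast
  obtain I where "I \<in> initial_bases d p w" using initial_bases_nonempty[OF d] .
  then have I: "card I = d" "\<forall>J. card J = d \<longrightarrow> reduced_value p w I \<le> reduced_value p w J"
    by (auto simp: initial_bases_iff)
  define c where "c = reduced_value p w I"
  define F where "F = {z \<in> lifted_polytope d p. (- w, 1) \<bullet> z = c}"
  have val: "(- w, 1) \<bullet> (indicator_vec J, p J) = reduced_value p w J" for J
    by (simp add: inner_indicator_vec reduced_value_def sum_negf)
  have "lifted_polytope d p \<subseteq> {z. (- w, 1) \<bullet> z \<ge> c}"
    unfolding lifted_polytope_def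
    by (intro hull_minimal convex_halfspace_ge) (use I val in \<open>auto simp: c_def\<close>)
  then have c: "\<forall>z\<in>lifted_polytope d p. c \<le> (- w, 1) \<bullet> z" by auto
  have "(indicator_vec I, p I) \<in> lifted_polytope d p"
    unfolding lifted_polytope_def by (rule hull_inc) (use I in auto)
  then have "(indicator_vec I, p I) \<in> F" unfolding F_def using val[of I] c_def by simp
  then have ne: "F \<noteq> {}" by blast
  have "fst ` F = matroid_polytope (initial_bases d p (- (1 / 1) *\<^sub>R (- w)))"
    by (rule lower_face_projection[OF _ c F_def ne]) simp
  then have "fst ` F = C" using C by simp
  moreover have "lower_face (lifted_polytope d p) F"
    unfolding lower_face_def using ne c F_def
        by (intro conjI exI[of _ "- w"] exI[of _ "1::real"] exI[of _ c]) auto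
  ultimately show "C \<in> regular_subdivision d p" unfolding regular_subdivision_def by blast
qed

section \<open>Moving the weight along a separator\<close>

lemma reduced_value_shift:
  "reduced_value p (w + t *\<^sub>R indicator_vec A) I = reduced_value p w I - t * real (card (I \<inter> A))"
proof -
  have "(\<Sum>i\<in>I. (w + t *\<^sub>R indicator_vec A) $ i) = (\<Sum>i\<in>I. w $ i) + (\<Sum>i\<in>I. if i \<in> A then t else 0)"
    by (auto simp: indicator_vec_nth sum.distrib[symmetric] intro!: sum.cong)
  also have "(\<Sum>i\<in>I. if i \<in> A then t else 0) = t * real (card (I \<inter> A))"
    by (simp add: sum.If_cases)
  finally show ?thesis by (simp add: reduced_value_def)
qed

text \<open>Moving along a separator changes all minimisers equally, and a small move does not
  bridge the gap to the other sets. So such a cell contains more than one line.\<close>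

lemma disconnected_perturbation:
  fixes p :: "'n::finite set \<Rightarrow> real"
  assumes I: "I \<in> initial_bases d p w"
    and const: "\<forall>I\<in>initial_bases d p w. \<forall>K\<in>initial_bases d p w. card (I \<inter> A) = card (K \<inter> A)"
  shows "\<exists>t>0. initial_bases d p (w + t *\<^sub>R indicator_vec A) = initial_bases d p w"
proof -
  let ?r = "reduced_value p w" and ?n = "real CARD('n)"
  define S where "S = {J. card J = d \<and> J \<notin> initial_bases d p w}"
  have gap: "0 < ?r J - ?r I" if "J \<in> S" for J
    using that I initial_bases_eq_value[OF I, of J] unfolding S_def initial_bases_iff by force
  \<comment> \<open>The inserted \<open>1\<close> keeps the minimum meaningful when every
    \<open>d\<close>-set is a minimiser.\<close>
  define \<delta> where "\<delta> = Min (insert 1 ((\<lambda>J. ?r J - ?r I) ` S))"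
  have "0 < \<delta>" using gap unfolding \<delta>_def by (subst Min_gr_iff) auto
  have le: "\<delta> \<le> ?r J - ?r I" if "J \<in> S" for J using that unfolding \<delta>_def by (intro Min_le) auto
  \<comment> \<open>No trace exceeds \<open>?n\<close>, so the move changes values by at most half
    the gap.\<close>
  define t where "t = \<delta> / (2 * ?n)"
  have n: "0 < ?n" by simp
  have t: "0 < t" "t * ?n < \<delta>" using \<open>0 < \<delta>\<close> n by (auto simp: t_def field_simps)
  let ?w = "w + t *\<^sub>R indicator_vec A"
  have in_val: "reduced_value p ?w J = reduced_value p ?w I" if "J \<in> initial_bases d p w" for J
    using that const[rule_format, OF that I] initial_bases_eq_value[OF I, of J]
    by (simp add: reduced_value_shift)
  have out_val: "reduced_value p ?w I < reduced_value p ?w J" if "J \<in> S" for J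
  proof -
    have "t * real (card (J \<inter> A)) \<le> t * ?n" using t(1)
        by (intro mult_left_mono) (auto intro: card_mono)
    moreover have "0 \<le> t * real (card (I \<inter> A))" using t(1) by simp
    ultimately show ?thesis using le[OF that] t(2) unfolding reduced_value_shift by linarith
  qed
  have cI: "card I = d" using I by (simp add: initial_bases_iff)
  have dich: "J \<in> initial_bases d p w \<or> J \<in> S" if "card J = d" for J using that
      by (auto simp: S_def)
  have I': "I \<in> initial_bases d p ?w"
    unfolding initial_bases_iff using cI dich in_val out_val by (metis less_eq_real_def)
  have "initial_bases d p ?w = initial_bases d p w"
  proof (intro set_eqI iffI)
    fix J assume "J \<in> initial_bases d p ?w"
    then have "card J = d" "reduced_value p ?w J = reduced_value p ?w I"
      using initial_bases_eq_value[OF I'] by blast+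
    then show "J \<in> initial_bases d p w" using dich out_val by force
  next
    fix J assume J: "J \<in> initial_bases d p w"
    then show "J \<in> initial_bases d p ?w"
      using initial_bases_eq_value[OF I', of J] in_val[OF J] by (simp add: initial_bases_iff)
  qed
  then show ?thesis using t(1) by blast
qed

text \<open>A ratio test: \<open>w\<close> moves along \<open>A\<close> until the first set with
  larger trace ties with the minimisers. Sets of no larger trace cannot overtake them.\<close>

lemma larger_cell_of_separator:
  fixes p :: "'n::finite set \<Rightarrow> real"
  assumes I: "I \<in> initial_bases d p w"
    and const: "\<forall>I\<in>initial_bases d p w. \<forall>K\<in>initial_bases d p w. card (I \<inter> A) = card (K \<inter> A)"
    and J: "card J = d" "card (I \<inter> A) < card (J \<inter> A)"
  shows "\<exists>w'. initial_bases d p w \<subset> initial_bases d p w'"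
proof -
  let ?r = "reduced_value p w" and ?a = "card (I \<inter> A)"
  define S where "S = {J. card J = d \<and> ?a < card (J \<inter> A)}"
  define g where "g K = (?r K - ?r I) / (real (card (K \<inter> A)) - real ?a)" for K
  have "S \<noteq> {}" using J by (auto simp: S_def)
  then obtain K where K: "K \<in> S" "\<forall>L\<in>S. g K \<le> g L" using finite_argmin[of S g] by auto
  define t where "t = g K"
  have cI: "card I = d" and min: "\<And>L. card L = d \<Longrightarrow> ?r I \<le> ?r L" using I
      by (auto simp: initial_bases_iff)
  have t0: "0 \<le> t" using K(1) min[of K] by (auto simp: t_def g_def S_def intro!: divide_nonneg_pos)
  let ?w = "w + t *\<^sub>R indicator_vec A"
  have I': "I \<in> initial_bases d p ?w"
    unfolding initial_bases_iff
  proof (intro conjI allI impI)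
    fix L :: "'n set" assume L: "card L = d"
    have "t * (real (card (L \<inter> A)) - real ?a) \<le> ?r L - ?r I"
    proof (cases "?a < card (L \<inter> A)")
      case True
      then have "t \<le> g L" using K(2) L by (simp add: t_def S_def)
      then show ?thesis using True by (simp add: g_def pos_le_divide_eq)
    next
      case False
      then have "t * (real (card (L \<inter> A)) - real ?a) \<le> 0" using t0 by (simp add: mult_nonneg_nonpos)
      then show ?thesis using min[OF L] by simp
    qed
    then show "reduced_value p ?w I \<le> reduced_value p ?w L"
      by (simp add: reduced_value_shift algebra_simps)
  qed (rule cI)
  have "initial_bases d p w \<subseteq> initial_bases d p ?w"
  proof
    fix L assume L: "L \<in> initial_bases d p w"
    then have "card L = d" "?r L = ?r I" "card (L \<inter> A) = ?a"
      using initial_bases_eq_value[OF I, of L] const[rule_format, OF L I] by auto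
    then show "L \<in> initial_bases d p ?w"
      using initial_bases_eq_value[OF I', of L] by (simp add: reduced_value_shift)
  qed
  moreover have "K \<in> initial_bases d p ?w"
  proof -
    have "0 < real (card (K \<inter> A)) - real ?a" using K(1) by (simp add: S_def)
    then have "t * (real (card (K \<inter> A)) - real ?a) = ?r K - ?r I" by (simp add: t_def g_def)
    then have "reduced_value p ?w K = reduced_value p ?w I"
        by (simp add: reduced_value_shift algebra_simps)
    then show ?thesis using initial_bases_eq_value[OF I'] K(1) by (simp add: S_def)
  qed
  moreover have "K \<notin> initial_bases d p w"
  proof
    assume "K \<in> initial_bases d p w"
    then have "card (K \<inter> A) = ?a" using const[rule_format, OF _ I] by simp
    then show False using K(1) by (simp add: S_def)
  qed
  ultimately show ?thesis by blast
qed

lemma disconnected_not_maximal: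
  fixes p :: "'n::finite set \<Rightarrow> real"
  assumes pl: "tropical_plucker d p" and d: "0 < d" "d < CARD('n)"
    and nc: "\<not> connected_bases UNIV (initial_bases d p w)"
  shows "\<exists>w'. initial_bases d p w \<subset> initial_bases d p w'"
proof -
  note mat = initial_bases_matroid[OF pl less_imp_le[OF d(2)], of w]
  obtain A where A: "A \<noteq> {}" "A \<subset> UNIV"
    and const: "\<forall>I\<in>initial_bases d p w. \<forall>K\<in>initial_bases d p w. card (I \<inter> A) = card (K \<inter> A)"
    using disconnectedE[OF nc] .
  obtain I where I: "I \<in> initial_bases d p w" using matroid_nonempty[OF mat] by blast
  have cI: "card I = d" using I by (simp add: initial_bases_iff)
  have compl: "card (J \<inter> - A) = d - card (J \<inter> A)" "card (J \<inter> A) \<le> d" if "card J = d"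
      for J :: "'n set"
  proof -
    have "card J = card (J \<inter> A) + card (J - A)" by (simp add: card_Int_Diff)
    then show "card (J \<inter> - A) = d - card (J \<inter> A)" "card (J \<inter> A) \<le> d" using that
        by (auto simp: Diff_eq)
  qed
  \<comment> \<open>Two \<open>d\<close>-sets that differ by swapping \<open>x\<close> in
    \<open>A\<close> for \<open>y\<close> outside have different traces, so one of them differs from
    \<open>I\<close>. Room for the swap comes from \<open>0 < d\<close> and
    \<open>d < CARD('n)\<close>.\<close>
  obtain J where J: "card J = d" "card (J \<inter> A) \<noteq> card (I \<inter> A)"
  proof -
    obtain x y where xy: "x \<in> A" "y \<notin> A" using A by blast
    have "x \<noteq> y" using xy by blast
    then have "card (- {x, y}) = CARD('n) - 2" by (simp add: Compl_eq_Diff_UNIV card_Diff_subset)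
    then have "d - 1 \<le> card (- {x, y})" using d by simp
    then obtain S where S: "S \<subseteq> - {x, y}" "card S = d - 1" using obtain_subset_with_card_n by metis
    have c: "card (insert x S) = d" "card (insert y S) = d" using S d by (auto simp: card_insert_if)
    have "insert x S \<inter> A = insert x (S \<inter> A)" "insert y S \<inter> A = S \<inter> A" "x \<notin> S" using xy S by auto
    then have "card (insert x S \<inter> A) \<noteq> card (insert y S \<inter> A)" by simp
    then show ?thesis using that[OF c(1)] that[OF c(2)] by metis
  qed
  show ?thesis
  proof (cases "card (I \<inter> A) < card (J \<inter> A)")
    case True
    then show ?thesis using larger_cell_of_separator[OF I const J(1)] by blast
  next
    case False
    then have "card (I \<inter> - A) < card (J \<inter> - A)" using compl[OF J(1)] compl[OF cI] J(2) by linarith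
    moreover have "\<forall>I\<in>initial_bases d p w. \<forall>K\<in>initial_bases d p w. card (I \<inter> - A) = card (K \<inter> - A)"
    proof (intro ballI)
      fix K L assume KL: "K \<in> initial_bases d p w" "L \<in> initial_bases d p w"
      then show "card (K \<inter> - A) = card (L \<inter> - A)"
        using const[rule_format, OF KL] compl(1)[of K] compl(1)[of L]
            by (simp add: initial_bases_iff)
    qed
    ultimately show ?thesis using larger_cell_of_separator[OF I _ J(1)] by blast
  qed
qed

section \<open>Connected initial matroids as maximal cells and as vertices\<close>

definition connected_cells :: "nat \<Rightarrow> ('n::finite set \<Rightarrow> real) \<Rightarrow> 'n set set set" where
  "connected_cells d p = {M \<in> range (initial_bases d p). connected_bases UNIV M}"

lemma maximal_in_range:
  "{C \<in> range g. \<forall>C'\<in>range g. C \<subseteq> C' \<longrightarrow> C' = C} = {g w | w. \<forall>w'. g w \<subseteq> g w' \<longrightarrow> g w' = g w}"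
  by auto

lemma maximal_cells_eq:
  fixes p :: "'n::finite set \<Rightarrow> real"
  assumes pl: "tropical_plucker d p" and d: "0 < d" "d < CARD('n)"
  shows "maximal_cells d p = matroid_polytope ` connected_cells d p"
proof -
  have d': "d \<le> CARD('n)" using d by simp
  let ?g = "\<lambda>w. matroid_polytope (initial_bases d p w)"
  have "maximal_cells d p = {?g w | w. \<forall>w'. ?g w \<subseteq> ?g w' \<longrightarrow> ?g w' = ?g w}"
    unfolding maximal_cells_def regular_subdivision_eq[OF d'] by (rule maximal_in_range)
  also have "\<dots> =
    {matroid_polytope (initial_bases d p w) | w. \<forall>w'. initial_bases d p w \<subseteq> initial_bases d p w'
        \<longrightarrow> initial_bases d p w' = initial_bases d p w}"
    by (simp only: matroid_polytope_subset_iff matroid_polytope_inject)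
  also have "\<dots> = {matroid_polytope (initial_bases d p w) | w. connected_bases UNIV (initial_bases d p w)}"
  proof -
    have "(\<forall>w'. initial_bases d p w \<subseteq> initial_bases d p w' \<longrightarrow> initial_bases d p w'
        = initial_bases d p w) \<longleftrightarrow>
      connected_bases UNIV (initial_bases d p w)" for w
    proof
      assume "\<forall>w'. initial_bases d p w \<subseteq> initial_bases d p w' \<longrightarrow> initial_bases d p w'
          = initial_bases d p w"
      then show "connected_bases UNIV (initial_bases d p w)"
          using disconnected_not_maximal[OF pl d] by blast
    next
      assume "connected_bases UNIV (initial_bases d p w)"
      then show "\<forall>w'. initial_bases d p w \<subseteq> initial_bases d p w' \<longrightarrow> initial_bases d p w'
          = initial_bases d p w"
        using connected_initial_bases_rigid[OF pl d'] initial_bases_shift by metis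
    qed
    then show ?thesis by simp
  qed
  also have "\<dots> = matroid_polytope ` connected_cells d p" by (auto simp: connected_cells_def)
  finally show ?thesis .
qed

lemma connected_cell_fiber:
  fixes p :: "'n::finite set \<Rightarrow> real"
  assumes pl: "tropical_plucker d p" and d: "d \<le> CARD('n)"
    and conn: "connected_bases UNIV (initial_bases d p w)"
  shows "{w'. initial_bases d p w' = initial_bases d p w} = ones_rel `` {w}"
proof (intro set_eqI iffI)
  fix w' assume "w' \<in> {w'. initial_bases d p w' = initial_bases d p w}"
  then obtain t where "\<forall>i. w' $ i - w $ i = t"
    using connected_initial_bases_rigid[OF pl d conn, of w'] by auto
  then have "w' = w + t *\<^sub>R (\<chi> i. 1)" by (auto simp: vec_eq_iff algebra_simps)
  then show "w' \<in> ones_rel `` {w}" by (auto simp: ones_rel_def)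
next
  fix w' assume "w' \<in> ones_rel `` {w}"
  then obtain t where "w' = w + t *\<^sub>R (\<chi> i. 1)" by (auto simp: ones_rel_def)
  then have "\<And>i. w' $ i - w $ i = t" by simp
  then show "w' \<in> {w'. initial_bases d p w' = initial_bases d p w}" using initial_bases_shift
      by blast
qed

lemma ones_rel_class_eq:
  assumes "x \<in> ones_rel `` {w}"
  shows "ones_rel `` {x} = ones_rel `` {w}"
proof -
  obtain t where x: "x = w + t *\<^sub>R (\<chi> i. 1)" using assms by (auto simp: ones_rel_def)
  have "y = x + s *\<^sub>R (\<chi> i. 1) \<longleftrightarrow> y = w + (t + s) *\<^sub>R (\<chi> i. 1)" for y s
    by (simp add: x scaleR_add_left add.assoc)
  then have "(\<exists>s. y = x + s *\<^sub>R (\<chi> i. 1)) \<longleftrightarrow> (\<exists>s. y = w + s *\<^sub>R (\<chi> i. 1))" for y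
    by (metis add_diff_cancel_left' add.commute diff_add_cancel)
  then show ?thesis by (auto simp: ones_rel_def)
qed

text \<open>Faces are closures, so this identifies the face of a connected cell with the cell
  itself.\<close>

lemma closed_ones_rel_class: "closed (ones_rel `` {w :: real ^ 'n::finite})"
proof -
  have "ones_rel `` {w} = {x. \<forall>i j. x $ i - w $ i = x $ j - w $ j}"
  proof (intro set_eqI iffI)
    fix x assume x: "x \<in> {x. \<forall>i j. x $ i - w $ i = x $ j - w $ j}"
    obtain a :: 'n where True by simp
    have "x = w + (x $ a - w $ a) *\<^sub>R (\<chi> i. 1)" using x by (auto simp: vec_eq_iff algebra_simps)
    then show "x \<in> ones_rel `` {w}" by (auto simp: ones_rel_def)
  qed (auto simp: ones_rel_def)
  moreover have "closed {x :: real ^ 'n. \<forall>i j. x $ i - w $ i = x $ j - w $ j}"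
    by (intro closed_Collect_all closed_Collect_eq continuous_intros)
  ultimately show ?thesis by simp
qed

text \<open>A separator would let \<open>w\<close> move inside its cell off the line spanned by the
  all-ones vector. Conversely, a connected cell is a single closed line by rigidity, and it lies in
  the tropical linear space because its matroid has no loops.\<close>

lemma tls_vertices_eq:
  fixes p :: "'n::finite set \<Rightarrow> real"
  assumes pl: "tropical_plucker d p" and d: "0 < d" "d < CARD('n)"
  shows "tls_vertices d p = (\<lambda>M. {w. initial_bases d p w = M}) ` connected_cells d p"
proof (intro set_eqI iffI)
  have d': "d \<le> CARD('n)" using d by simp
  fix F
  {
    assume "F \<in> tls_vertices d p"
    then obtain \<M> where F: "F = closure {w. initial_bases d p w = \<M>}" "{w. initial_bases d p w
        = \<M>} \<noteq> {}"
      and sing: "is_singleton (F // ones_rel)"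
      unfolding tls_vertices_def tls_faces_def by auto
    obtain w where w: "initial_bases d p w = \<M>" using F(2) by blast
    have conn: "connected_bases UNIV (initial_bases d p w)"
    proof (rule ccontr)
      assume nc: "\<not> ?thesis"
      obtain A where A: "A \<noteq> {}" "A \<subset> UNIV"
        and const: "\<forall>I\<in>initial_bases d p w. \<forall>K\<in>initial_bases d p w. card (I \<inter> A) = card (K \<inter> A)"
        using disconnectedE[OF nc] .
      obtain I where "I \<in> initial_bases d p w"
          using matroid_nonempty[OF initial_bases_matroid[OF pl d']] by blast
      then obtain t where t: "t > 0" "initial_bases d p (w + t *\<^sub>R indicator_vec A)
          = initial_bases d p w"
        using disconnected_perturbation[OF _ const] by blast
      let ?w = "w + t *\<^sub>R indicator_vec A"
      have "w \<in> F" "?w \<in> F" 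
        unfolding F(1) using w t(2) by (auto intro!: subsetD[OF closure_subset])
      then have "ones_rel `` {w} \<in> F // ones_rel" "ones_rel `` {?w} \<in> F // ones_rel"
          by (auto intro: quotientI)
      then have "ones_rel `` {w} = ones_rel `` {?w}" using sing by (auto simp: is_singleton_def)
      moreover have "?w \<in> ones_rel `` {?w}" by (auto simp: ones_rel_def intro: exI[of _ 0])
      ultimately have "?w \<in> ones_rel `` {w}" by simp
      then obtain s where s: "?w = w + s *\<^sub>R (\<chi> i. 1)" by (auto simp: ones_rel_def)
      obtain x y where xy: "x \<in> A" "y \<notin> A" using A by blast
      have "?w $ x = w $ x + s" "?w $ y = w $ y + s" unfolding s by simp_all
      then show False using xy t(1) by (simp add: indicator_vec_nth)
    qed
    have "{w'. initial_bases d p w' = \<M>} = ones_rel `` {w}"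
      using connected_cell_fiber[OF pl d' conn] w by simp
    then have "F = {w. initial_bases d p w = \<M>}"
        using F(1) closure_closed[OF closed_ones_rel_class[of w]] by simp
    moreover have "\<M> \<in> connected_cells d p" using conn w by (auto simp: connected_cells_def)
    ultimately show "F \<in> (\<lambda>M. {w. initial_bases d p w = M}) ` connected_cells d p" by blast
  next
    assume "F \<in> (\<lambda>M. {w. initial_bases d p w = M}) ` connected_cells d p"
    then obtain w where conn: "connected_bases UNIV (initial_bases d p w)"
      and F: "F = {w'. initial_bases d p w' = initial_bases d p w}"
          by (auto simp: connected_cells_def)
    have FL: "F = ones_rel `` {w}" using connected_cell_fiber[OF pl d' conn] F by simp
    have cl: "closure F = F" using closure_closed[OF closed_ones_rel_class[of w]] FL by simp
    have "UNIV \<noteq> {j :: 'n}" for j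
    proof
      assume "UNIV = {j}"
      then have "CARD('n) = card {j}" by (rule arg_cong)
      then show False using d by simp
    qed
    then have loopfree: "\<exists>I\<in>initial_bases d p w. j \<in> I" for j
      using connected_no_loop(1)[OF initial_bases_matroid[OF pl d'] conn] by blast
    have sub: "F \<subseteq> tropical_linear_space d p"
    proof
      fix w' assume "w' \<in> F"
      then have "initial_bases d p w' = initial_bases d p w" using F by simp
      then show "w' \<in> tropical_linear_space d p"
        using connected_imp_tropical_linear_space[OF pl, of w'] loopfree by simp
    qed
    have "w \<in> F" using F by simp
    have "F // ones_rel = {ones_rel `` {w}}"
      unfolding quotient_def using FL ones_rel_class_eq \<open>w \<in> F\<close> by blast
    then have "is_singleton (F // ones_rel)" by (simp add: is_singleton_def)
    moreover have "F \<in> tls_faces d p"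
      unfolding tls_faces_def
    proof (intro CollectI exI[of _ F] conjI)
      show "F = closure F" using cl by simp
      show "\<exists>\<M>. F = {w. initial_bases d p w = \<M>}" using F by blast
      show "F \<noteq> {}" using \<open>w \<in> F\<close> by blast
    qed (rule sub)
    ultimately show "F \<in> tls_vertices d p" by (simp add: tls_vertices_def)
  }
qed

lemma card_tls_vertices:
  fixes p :: "'n::finite set \<Rightarrow> real"
  assumes pl: "tropical_plucker d p" and d: "0 < d" "d < CARD('n)"
  shows "card (tls_vertices d p) = card (connected_cells d p)" "finite (tls_vertices d p)"
proof -
  have "inj_on (\<lambda>M. {w. initial_bases d p w = M}) (connected_cells d p)"
  proof (rule inj_onI)
    fix M M' assume "M \<in> connected_cells d p" "{w. initial_bases d p w = M}
        = {w. initial_bases d p w = M'}"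
    moreover from this obtain w where "initial_bases d p w = M" by (auto simp: connected_cells_def)
    ultimately show "M = M'" by blast
  qed
  then show "card (tls_vertices d p) = card (connected_cells d p)" "finite (tls_vertices d p)"
    unfolding tls_vertices_eq[OF assms] by (auto simp: card_image)
qed

section \<open>Counting beta bases over all cells\<close>

lemma card_sets_in_out:
  assumes "a \<noteq> (b :: 'n::finite)" "0 < d"
  shows "card {B :: 'n set. card B = d \<and> a \<in> B \<and> b \<notin> B} = (CARD('n) - 2) choose (d - 1)"
proof -
  let ?E = "- {a, b}"
  have cE: "card ?E = CARD('n) - 2" using assms(1)
      by (simp add: Compl_eq_Diff_UNIV card_Diff_subset)
  have "{B :: 'n set. card B = d \<and> a \<in> B \<and> b \<notin> B} = insert a ` {S. S \<subseteq> ?E \<and> card S = d - 1}"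
  proof (intro set_eqI iffI)
    fix B :: "'n set" assume "B \<in> {B. card B = d \<and> a \<in> B \<and> b \<notin> B}"
    then have "B = insert a (B - {a})" "B - {a} \<subseteq> ?E" "card (B - {a}) = d - 1" by auto
    then show "B \<in> insert a ` {S. S \<subseteq> ?E \<and> card S = d - 1}" by blast
  next
    fix B assume "B \<in> insert a ` {S. S \<subseteq> ?E \<and> card S = d - 1}"
    then obtain S where "B = insert a S" "S \<subseteq> ?E" "card S = d - 1" by blast
    then show "B \<in> {B. card B = d \<and> a \<in> B \<and> b \<notin> B}" using assms by (auto simp: card_insert_if)
  qed
  moreover have "inj_on (insert a) {S. S \<subseteq> ?E \<and> card S = d - 1}"
    by (rule inj_onI) (auto simp: insert_ident)
  ultimately show ?thesis using n_subsets[of ?E "d - 1"] cE by (simp add: card_image)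
qed

text \<open>Crapo's beta invariant is additive over the maximal cells: the beta bases of the maximal
  cells partition the beta bases of the uniform matroid.\<close>

lemma sum_card_beta_bases:
  fixes p :: "'n::finite set \<Rightarrow> real"
  assumes pl: "tropical_plucker d p" and d: "0 < d" "d < CARD('n)"
      and ord: "bij_betw ord (UNIV :: 'n set) {0..<CARD('n)}"
  shows "(\<Sum>M\<in>connected_cells d p. card (beta_bases UNIV ord M)) = (CARD('n) - 2) choose (d - 1)"
proof -
  have d': "d \<le> CARD('n)" using d by simp
  have inj: "inj ord" using ord by (simp add: bij_betw_def)
  have img: "range ord = {0..<CARD('n)}" using ord by (simp add: bij_betw_def)
  have "0 \<in> range ord" "Suc 0 \<in> range ord" using img d by auto
  then obtain m m2 where m: "ord m = 0" and m2: "ord m2 = Suc 0" by force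
  have mm: "m \<noteq> m2" using m m2 by auto
  have "(\<Sum>M\<in>connected_cells d p. card (beta_bases UNIV ord M)) =
    card (\<Union>M\<in>connected_cells d p. beta_bases UNIV ord M)"
  proof (rule card_UN_disjoint[symmetric])
    show "\<forall>M\<in>connected_cells d p. \<forall>M'\<in>connected_cells d p. M \<noteq> M' \<longrightarrow>
      beta_bases UNIV ord M \<inter> beta_bases UNIV ord M' = {}"
      using initial_bases_with_beta_basis_unique[OF inj] unfolding connected_cells_def by blast
  qed auto
  also have "(\<Union>M\<in>connected_cells d p. beta_bases UNIV ord M) = {B. card B = d \<and> m \<in> B \<and> m2 \<notin> B}"
  proof (intro set_eqI iffI)
    fix B assume "B \<in> (\<Union>M\<in>connected_cells d p. beta_bases UNIV ord M)"
    then obtain w where B: "B \<in> beta_bases UNIV ord (initial_bases d p w)"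
        by (auto simp: connected_cells_def)
    then have "card B = d" using beta_basesD(1)[OF B] by (simp add: initial_bases_iff)
    then show "B \<in> {B. card B = d \<and> m \<in> B \<and> m2 \<notin> B}" using beta_basis_first_two[OF inj B m m2]
        by simp
  next
    fix B assume "B \<in> {B. card B = d \<and> m \<in> B \<and> m2 \<notin> B}"
    then obtain w where B: "B \<in> beta_bases UNIV ord (initial_bases d p w)"
      using ex_initial_bases_with_beta_basis[OF pl _ inj _ m _ m2] by blast
    then have "initial_bases d p w \<in> connected_cells d p"
      using beta_bases_imp_connected[OF initial_bases_matroid[OF pl d'] inj B]
          by (auto simp: connected_cells_def)
    then show "B \<in> (\<Union>M\<in>connected_cells d p. beta_bases UNIV ord M)" using B by blast
  qed
  also have "card \<dots> = (CARD('n) - 2) choose (d - 1)" using card_sets_in_out[OF mm d(1)] .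
  finally show ?thesis .
qed

lemma sum_eq_card_iff:
  fixes f :: "'a \<Rightarrow> nat"
  assumes "finite S" "\<And>x. x \<in> S \<Longrightarrow> 1 \<le> f x"
  shows "card S \<le> sum f S" "card S = sum f S \<longleftrightarrow> (\<forall>x\<in>S. f x = 1)"
proof -
  have "sum f S = (\<Sum>x\<in>S. 1 + (f x - 1))"
  proof (rule sum.cong[OF refl])
    fix x assume "x \<in> S"
    then show "f x = 1 + (f x - 1)" using assms(2)[of x] by simp
  qed
  then have eq: "sum f S = card S + (\<Sum>x\<in>S. f x - 1)" by (simp only: sum.distrib card_eq_sum)
  then show "card S \<le> sum f S" by simp
  have "card S = sum f S \<longleftrightarrow> (\<forall>x\<in>S. f x - 1 = 0)" using eq assms(1) by simp
  also have "\<dots> \<longleftrightarrow> (\<forall>x\<in>S. f x = 1)" using assms(2) by force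
  finally show "card S = sum f S \<longleftrightarrow> (\<forall>x\<in>S. f x = 1)" .
qed

theorem mainTheorem3:
  fixes p :: "'n::finite set \<Rightarrow> real" and d :: nat
  assumes "0 < d" and "d < CARD('n)"
    and "tropical_plucker d p"
  shows "finite (tls_vertices d p)
    \<and> card (tls_vertices d p) \<le> (CARD('n) - 2) choose (d - 1)
    \<and> (card (tls_vertices d p) = (CARD('n) - 2) choose (d - 1)
         \<longleftrightarrow> series_parallel_tls d p)"
proof -
  note pl = assms(3) and d = assms(1,2)
  obtain ord where ord: "bij_betw ord (UNIV :: 'n set) {0..<CARD('n)}"
    using ex_bij_betw_finite_nat[of "UNIV :: 'n set"] by auto
  then have inj: "inj ord" by (simp add: bij_betw_def)
  let ?f = "\<lambda>M. card (beta_bases UNIV ord M)"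
  have two: "2 \<le> CARD('n)" using d by simp
  have cell: "matroid UNIV M" "connected_bases UNIV M" if "M \<in> connected_cells d p" for M
    using that initial_bases_matroid[OF pl less_imp_le[OF d(2)]] by (auto simp: connected_cells_def)
  have f: "int (?f M) = beta UNIV M" if "M \<in> connected_cells d p" for M
    using card_beta_bases[OF cell(1)[OF that] inj] by simp
  have ge: "1 \<le> ?f M" if "M \<in> connected_cells d p" for M
    using beta_pos_iff_connected(1)[OF cell(1)[OF that] two] cell(2)[OF that] f[OF that] by linarith
  have fin: "finite (connected_cells d p)" by simp
  \<comment> \<open>Summands of at least one with a fixed total bound the number of cells, with
    equality only if every summand is one.\<close>
  note cnt = sum_eq_card_iff[where f = ?f, OF fin ge] and total = sum_card_beta_bases[OF pl d ord]
  have "card (tls_vertices d p) = (CARD('n) - 2) choose (d - 1) \<longleftrightarrow> (\<forall>M\<in>connected_cells d p. ?f M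
      = 1)"
    using cnt(2) total card_tls_vertices(1)[OF pl d] by simp
  also have "\<dots> \<longleftrightarrow> (\<forall>M\<in>connected_cells d p. series_parallel_matroid UNIV M)"
    using series_parallel_matroid_iff_beta[OF cell two] f by (metis of_nat_1 of_nat_eq_iff)
  also have "\<dots> \<longleftrightarrow> series_parallel_tls d p"
    unfolding series_parallel_tls_def maximal_cells_eq[OF pl d]
        by (auto simp: matroid_polytope_inject)
  finally show ?thesis using cnt(1) total card_tls_vertices[OF pl d] by simp
qed

end
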